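(* Let $m\ge0$ and $\ell\ge0$ be fixed integers. For every integer $K\ge1$, as $n\to\infty$, $$d_{\rm TV}\Big((M_{n,i}-b_n)_{i=1}^K\,,\,\big(\lceil\xi_i+(e-1)\tau+c_n\rceil\big)_{i=1}^K\Big)\to 0,$$ where $\xi_1>\xi_2>\cdots$ are the atoms, in decreasing order, of the Poisson point process $\Xi$ on $\mathbb R$ with intensity measure $e^{-x}\,\mathrm dx$, and $\tau$ has the ${\rm Gumbel}(\ell+1)$ distribution and is independent of $\Xi$.
   Context: Let $(\Pi_i(t),t\ge 0)$, $i=1,2,\dots$, be i.i.d. unit-rate Poisson counting processes. For $n>\ell$ let $\tau_n:=\min\{t\ge 0:\Pi_i(t)>m\text{ for all but }\ell\text{ indices }i\in\{1,\dots,n\}\}$. Let $M_{n,1}(t)\ge\cdots\ge M_{n,n}(t)$ be the nonincreasing order statistics of $\Pi_1(t),\dots,\Pi_n(t)$, and $M_{n,i}:=M_{n,i}(\tau_n)$. With $L:=\log n$, put $$a_n:=eL+\Big((e-1)m-\tfrac12\Big)\log L-\log\Big((e-1)(m!)^{e-1}\sqrt{2\pi e}\Big),\quad b_n:=\lfloor a_n\rfloor,\quad c_n:=a_n-\lfloor a_n\rfloor .$$ ${\rm Gumbel}(\ell+1)$ is the distribution on $\mathbb R$ with density $\frac{1}{\ell!}\exp(-(\ell+1)s-e^{-s})$. $d_{\rm TV}(X,Y)$ denotes the total variation distance between the distributions of $X$ and $Y$. *)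

theory Defs
  imports "HOL-Probability.Probability"
begin

section \<open>Total variation distance\<close>

text \<open>The two laws are meant to be probability measures on the same measurable space.\<close>

definition tv_dist :: "'a measure \<Rightarrow> 'a measure \<Rightarrow> real" where
  "tv_dist P Q = (SUP A\<in>sets P. \<bar>measure P A - measure Q A\<bar>)"

text \<open>The law of the random integer vector \<open>(X 1, \<dots>, X K)\<close>.\<close>

definition int_vector_law :: "'w measure \<Rightarrow> nat \<Rightarrow> (nat \<Rightarrow> 'w \<Rightarrow> int) \<Rightarrow> (nat \<Rightarrow> int) measure" where
  "int_vector_law M K X =
     distr M (PiM {1..K} (\<lambda>_. count_space UNIV)) (\<lambda>\<omega>. \<lambda>i\<in>{1..K}. X i \<omega>)"

section \<open>Independent Poisson counting processes\<close>

text \<open>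
  Only times \<open>t \<ge> 0\<close> matter. Monotonicity and right-continuity (for the discrete topology on
  \<^typ>\<open>nat\<close>) hold for every path; that jumps have size one then holds almost surely.
\<close>

definition unit_poisson_process :: "'w measure \<Rightarrow> (real \<Rightarrow> 'w \<Rightarrow> nat) \<Rightarrow> bool" where
  "unit_poisson_process M N \<longleftrightarrow>
     (\<forall>t\<ge>0. N t \<in> measurable M (count_space UNIV)) \<and>
     (\<forall>\<omega>\<in>space M. N 0 \<omega> = 0 \<and> mono_on {0..} (\<lambda>t. N t \<omega>) \<and>
        (\<forall>t\<ge>0. continuous (at_right t) (\<lambda>s. N s \<omega>))) \<and>
     (\<forall>s t. 0 \<le> s \<and> s < t \<longrightarrow>
        distr M (count_space UNIV) (\<lambda>\<omega>. N t \<omega> - N s \<omega>) = measure_pmf (poisson_pmf (t - s))) \<and>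
     (\<forall>(t :: nat \<Rightarrow> real) k. 0 \<le> t 0 \<and> incseq t \<longrightarrow>
        prob_space.indep_vars M (\<lambda>_. count_space UNIV) (\<lambda>j \<omega>. N (t (Suc j)) \<omega> - N (t j) \<omega>) {..<k})"

definition iid_unit_poisson_processes :: "'w measure \<Rightarrow> (nat \<Rightarrow> real \<Rightarrow> 'w \<Rightarrow> nat) \<Rightarrow> bool" where
  "iid_unit_poisson_processes M N \<longleftrightarrow>
     (\<forall>i\<ge>1. unit_poisson_process M (N i)) \<and>
     prob_space.indep_vars M (\<lambda>_. PiM {0..} (\<lambda>_. count_space UNIV))
       (\<lambda>i \<omega>. \<lambda>t\<in>{0..}. N i t \<omega>) {1..}"

text \<open>
  The minimum exists almost surely: the paths are unbounded almost surely, and right-continuous. Because almost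
  surely no two of the processes jump simultaneously, it makes no difference (up to a null set)
  whether there are at most or exactly \<open>l\<close> exceptional indices. The value 0 on the remaining null
  set is a harmless convention; it avoids evaluating the processes at negative times, where nothing
  is assumed about them.
\<close>

definition hitting_time ::
    "(nat \<Rightarrow> real \<Rightarrow> 'w \<Rightarrow> nat) \<Rightarrow> nat \<Rightarrow> nat \<Rightarrow> nat \<Rightarrow> 'w \<Rightarrow> real" where
  "hitting_time N m l n \<omega> =
     (if \<exists>t\<ge>0. card {i\<in>{1..n}. \<not> N i t \<omega> > m} \<le> l
      then LEAST t. 0 \<le> t \<and> card {i\<in>{1..n}. \<not> N i t \<omega> > m} \<le> l
      else 0)"

text \<open>The \<open>i\<close>-th largest of \<open>N 1 t, \<dots>, N n t\<close>, meaningful for \<open>1 \<le> i \<le> n\<close>.\<close>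

definition order_stat ::
    "(nat \<Rightarrow> real \<Rightarrow> 'w \<Rightarrow> nat) \<Rightarrow> nat \<Rightarrow> nat \<Rightarrow> real \<Rightarrow> 'w \<Rightarrow> nat" where
  "order_stat N n i t \<omega> = rev (sort (map (\<lambda>j. N j t \<omega>) [1..<Suc n])) ! (i - 1)"

definition order_stat_hit ::
    "(nat \<Rightarrow> real \<Rightarrow> 'w \<Rightarrow> nat) \<Rightarrow> nat \<Rightarrow> nat \<Rightarrow> nat \<Rightarrow> nat \<Rightarrow> 'w \<Rightarrow> nat" where
  "order_stat_hit N m l n i \<omega> = order_stat N n i (hitting_time N m l n \<omega>) \<omega>"

definition centering :: "nat \<Rightarrow> nat \<Rightarrow> real" where
  "centering m n = (let L = ln (real n); e = exp 1 in
     e * L + ((e - 1) * real m - 1 / 2) * ln L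
       - ln ((e - 1) * (fact m) powr (e - 1) * sqrt (2 * pi * e)))"

section \<open>Poisson point processes on the real line\<close>

text \<open>A point process is a random locally finite integer-valued Borel measure.\<close>

definition point_process :: "'w measure \<Rightarrow> ('w \<Rightarrow> real measure) \<Rightarrow> bool" where
  "point_process M X \<longleftrightarrow>
     (\<forall>\<omega>\<in>space M. sets (X \<omega>) = sets borel \<and>
        (\<forall>A\<in>sets borel. bounded A \<longrightarrow> emeasure (X \<omega>) A \<in> range of_nat)) \<and>
     (\<forall>A\<in>sets borel. (\<lambda>\<omega>. emeasure (X \<omega>) A) \<in> borel_measurable M)"

definition poisson_point_process ::
    "'w measure \<Rightarrow> real measure \<Rightarrow> ('w \<Rightarrow> real measure) \<Rightarrow> bool" where
  "poisson_point_process M \<mu> X \<longleftrightarrow>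
     point_process M X \<and>
     (\<forall>A\<in>sets borel. emeasure \<mu> A < \<infinity> \<longrightarrow>
        (\<forall>k::nat. measure M {\<omega>\<in>space M. emeasure (X \<omega>) A = of_nat k} =
           exp (- measure \<mu> A) * measure \<mu> A ^ k / fact k)) \<and>
     (\<forall>A\<in>sets borel. emeasure \<mu> A = \<infinity> \<longrightarrow> (AE \<omega> in M. emeasure (X \<omega>) A = \<infinity>)) \<and>
     (\<forall>(A :: nat \<Rightarrow> real set) k.
        (\<forall>j<k. A j \<in> sets borel) \<and> disjoint_family_on A {..<k} \<longrightarrow>
        prob_space.indep_vars M (\<lambda>_. borel) (\<lambda>j \<omega>. emeasure (X \<omega>) (A j)) {..<k})"

definition decreasing_atoms :: "real measure \<Rightarrow> (nat \<Rightarrow> real) \<Rightarrow> bool" where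
  "decreasing_atoms \<nu> x \<longleftrightarrow>
     (\<forall>i\<ge>1. x (Suc i) < x i) \<and> {y. emeasure \<nu> {y} > 0} = x ` {1..}"

definition exp_intensity :: "real measure" where
  "exp_intensity = density lborel (\<lambda>x. ennreal (exp (- x)))"

text \<open>The density of \<open>Gumbel(k)\<close> for an integer \<open>k \<ge> 1\<close>.\<close>

definition gumbel_density :: "nat \<Rightarrow> real \<Rightarrow> real" where
  "gumbel_density k s = 1 / fact (k - 1) * exp (- real k * s - exp (- s))"

text \<open>
  The random measure \<open>X\<close> is identified with the family of its values on Borel sets, which
  generates the sigma-algebra usually put on the space of measures.
\<close>

definition indep_of_point_process ::
    "'w measure \<Rightarrow> ('w \<Rightarrow> real) \<Rightarrow> ('w \<Rightarrow> real measure) \<Rightarrow> bool" where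
  "indep_of_point_process M T X \<longleftrightarrow>
     T \<in> borel_measurable M \<and>
     prob_space.indep_set M
       (sets (vimage_algebra (space M) T borel))
       (sets (vimage_algebra (space M) (\<lambda>\<omega>. \<lambda>A\<in>sets borel. emeasure (X \<omega>) A)
         (PiM (sets borel) (\<lambda>_. borel))))"

end

theory Submission
  imports Defs "HOL-Real_Asymp.Real_Asymp"
begin

text \<open>
  Write \<open>L = ln n\<close> and look at the processes at time \<open>t(s) = L + m ln L - ln (m!) + s\<close>. At
  that time a single process is at most \<open>m\<close> with probability about \<open>exp (-s) / n\<close>, and it
  exceeds the level \<open>\<lfloor>a\<rfloor> + k\<close>, where \<open>a\<close> is the centering and
  \<open>c\<close> its fractional part, with probability about \<open>exp ((e - 1) s + c - k) / n\<close>. The second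
  estimate is where the centering comes from: it rests on Stirling's formula and on the geometric decay, with ratio
  \<open>1/e\<close>, of a Poisson tail at \<open>e\<close> times the mean (\<open>low_rate\<close>,
  \<open>high_rate\<close>).

  Both are rare events for independent processes, so the number of processes that are still low and the numbers of
  processes on the various high levels become independent Poisson variables
  (\<open>rare_events_poisson_limit\<close>). This remains true if low processes are counted at time
  \<open>t(s)\<close> and high ones at another time \<open>t(s')\<close>, because a process that is low at one of the
  two times is, with conditional probability tending to one, not high at the other
  (\<open>low_high_joint_limit\<close>). On the limiting side the high counts are those of the atoms of
  \<open>\<Xi>\<close> shifted by \<open>(e - 1) s' + c\<close> and rounded up, and the event that at most
  \<open>l\<close> processes are low has limiting probability \<open>P (\<tau> \<le> s)\<close>
  (\<open>gumbel_cdf\<close>); there the shift is independent of \<open>\<Xi>\<close> by assumption.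

  To evaluate the high counts at the random hitting time without conditioning on it, note that they increase in time.
  On the event that the hitting time falls between \<open>t(s)\<close> and \<open>t(s')\<close>, the event that the
  \<open>K\<close> largest heights are bounded by given integers is therefore squeezed between the same events at the
  two deterministic times. Summing over a fine grid squeezes its probability between two sums of probabilities that
  the joint limit controls (\<open>monotone_sandwich\<close>). The limiting vector satisfies the same sandwich with
  \<open>\<tau>\<close> in the role of the rescaled hitting time, and its two bounds are close, uniformly in
  \<open>c\<close>, because the law of the shifted point process is continuous in the shift
  (\<open>counts_le_continuous\<close>). Hence the difference of the two distribution functions tends to zero
  (\<open>cdf_limit\<close>). For integer vectors this gives convergence of the point probabilities, and since the
  limiting vectors are tight, uniformly in \<open>c\<close>, convergence in total variation
  (\<open>tv_limit_from_cdf_limit\<close>).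
\<close>

section \<open>Stirling's formula\<close>

definition stirling_gap :: "nat \<Rightarrow> real" where
  "stirling_gap n = ln (fact n) - ((real n + 1/2) * ln (real n) - real n)"

text \<open>
  The increments of this sequence are \<open>O(1/n\<^sup>2)\<close>, hence summable.
\<close>

lemma stirling_gap_convergent: "convergent stirling_gap"
proof -
  define f where "f n = stirling_gap (Suc n) - stirling_gap (Suc (Suc n))" for n
  have f_eq: "f n = (real n + 3/2) * ln (1 + 1 / (real n + 1)) - 1" for n
  proof -
    have "ln (1 + 1 / (real n + 1)) = ln ((real n + 2) / (real n + 1))"
      by (simp add: field_simps)
    also have "\<dots> = ln (real n + 2) - ln (real n + 1)"
      by (subst ln_divide_pos) auto
    finally have 1: "ln (1 + 1 / (real n + 1)) = ln (real n + 2) - ln (real n + 1)" .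
    have 2: "ln (fact (Suc (Suc n)) :: real) = ln (real n + 2) + ln (fact (Suc n))"
      by (subst fact_Suc) (simp add: ln_mult add_ac del: fact_Suc)
    have 3: "real (Suc n) = real n + 1" "real (Suc (Suc n)) = real n + 2" by simp_all
    show ?thesis
      unfolding f_def stirling_gap_def 1 2 3 by (simp add: algebra_simps)
  qed
  have "f \<in> O(\<lambda>n. 1 / real n ^ 2)"
    unfolding f_eq by real_asymp
  moreover have "summable (\<lambda>n. norm (1 / real n ^ 2))"
    using inverse_power_summable[of 2, where 'a=real] by (simp add: field_simps)
  ultimately have "summable f"
    by (rule summable_comparison_test_bigo[rotated])
  hence "convergent (\<lambda>n. \<Sum>k<n. f k)"
    by (simp add: summable_iff_convergent)
  moreover have "(\<Sum>k<n. f k) = stirling_gap 1 - stirling_gap (Suc n)" for n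
    by (induction n) (auto simp: f_def)
  ultimately have "convergent (\<lambda>n. stirling_gap 1 - stirling_gap (Suc n))" by simp
  hence "convergent (\<lambda>n. stirling_gap (Suc n))"
    using convergent_diff[OF convergent_const[of "stirling_gap 1"], of "\<lambda>n. stirling_gap 1 - stirling_gap (Suc n)"] by simp
  thus ?thesis by (simp add: convergent_Suc_iff)
qed

lemma wallis_product_fact:
  "(\<Prod>k=1..n. (4*real k^2) / (4*real k^2 - 1)) = 2 ^ (4*n) * fact n ^ 4 / ((fact (2*n))\<^sup>2 * (2 * real n + 1))"
proof (induction n)
  case (Suc n)
  have f: "fact (2 * Suc n) = (2 * real n + 2) * (2 * real n + 1) * fact (2 * n)"
    by (simp add: algebra_simps)
  have d: "4 * (real (Suc n))\<^sup>2 - 1 = (2 * real n + 1) * (2 * real n + 3)"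
    by (simp add: algebra_simps power2_eq_square)
  have "(\<Prod>k=1..Suc n. (4*real k^2) / (4*real k^2 - 1)) =
     2 ^ (4*n) * fact n ^ 4 / ((fact (2*n))\<^sup>2 * (2 * real n + 1)) * ((4*real (Suc n)^2) / ((2 * real n + 1) * (2 * real n + 3)))"
    unfolding d[symmetric] Suc[symmetric] by simp
  also have "\<dots> = 2 ^ (4*Suc n) * fact (Suc n) ^ 4 / ((fact (2*Suc n))\<^sup>2 * (2 * real (Suc n) + 1))"
  proof -
    have g: "fact (Suc n) = (real n + 1) * fact n" by (simp add: algebra_simps)
    have h: "2 ^ (4 * Suc n) = 16 * (2::real) ^ (4*n)" by (simp add: power_add)
    have gen: "P * F ^ 4 / (G\<^sup>2 * (2 * x + 1)) * ((4 * (x+1)^2) / ((2 * x + 1) * (2 * x + 3)))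
      = 16 * P * ((x+1) * F) ^ 4 / (((2 * x + 2) * (2 * x + 1) * G)\<^sup>2 * (2 * (x+1) + 1))"
      if "x \<ge> 0" "G > 0" for P F G x :: real
    proof -
      have nz: "2 * x + 1 \<noteq> 0" "2 * x + 3 \<noteq> 0" "x + 1 \<noteq> 0" "G \<noteq> 0" using that by auto
      have e: "2 * x + 2 = 2 * (x + 1)" "2 * (x + 1) + 1 = 2 * x + 3" by simp_all
      show ?thesis
        unfolding e power_mult_distrib using nz
        by (simp add: divide_simps) (simp add: power4_eq_xxxx power2_eq_square)
    qed
    show ?thesis unfolding f g h using gen[of "real n" "fact (2*n)" "2^(4*n)" "fact n"]
      by (simp add: add_ac)
  qed
  finally show ?case .
qed auto

text \<open>
  The constant comes from Wallis' product: in \<open>4 stirling_gap n - 2 stirling_gap (2 n)\<close>, which converges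
  to twice the unknown limit, the factorials combine to the \<open>n\<close>-th partial product.
\<close>

theorem stirling_ln_fact: "stirling_gap \<longlonglongrightarrow> ln (2 * pi) / 2"
proof -
  obtain c where c: "stirling_gap \<longlonglongrightarrow> c"
    using stirling_gap_convergent by (auto simp: convergent_def)
  define W where "W n = (\<Prod>k=1..n. (4*real k^2) / (4*real k^2 - 1))" for n
  have key: "4 * stirling_gap n - 2 * stirling_gap (2 * n) = ln (W n) + ln (2 + 1 / real n) + ln 2" if "n \<ge> 1" for n
  proof -
    have "ln (W n) = ln (2 ^ (4*n) * fact n ^ 4) - ln ((fact (2*n))\<^sup>2 * (2 * real n + 1))"
      unfolding W_def wallis_product_fact by (subst ln_divide_pos) auto
    also have "ln (2 ^ (4*n) * fact n ^ 4 :: real) = 4 * real n * ln 2 + 4 * ln (fact n)"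
      by (simp add: ln_mult ln_realpow)
    also have "ln ((fact (2*n))\<^sup>2 * (2 * real n + 1)) = 2 * ln (fact (2*n)) + ln (2 * real n + 1)"
      by (subst ln_mult) (auto simp add: ln_realpow)
    finally have W: "ln (W n) = 4 * real n * ln 2 + 4 * ln (fact n) - (2 * ln (fact (2*n)) + ln (2 * real n + 1))" .
    have "ln (2 + 1 / real n) = ln ((2 * real n + 1) / real n)"
      using that by (simp add: field_simps)
    also have "\<dots> = ln (2 * real n + 1) - ln (real n)"
      using that by (subst ln_div) auto
    finally have 2: "ln (2 + 1 / real n) = ln (2 * real n + 1) - ln (real n)" .
    have 3: "ln (real (2 * n)) = ln 2 + ln (real n)" using that by (simp add: ln_mult)
    show ?thesis unfolding stirling_gap_def W 2 3 by (simp add: algebra_simps)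
  qed
  have "(\<lambda>n. ln (W n) + ln (2 + 1 / real n) + ln 2) \<longlonglongrightarrow> ln (pi / 2) + ln 2 + ln 2"
  proof (intro tendsto_add tendsto_const)
    show "(\<lambda>n. ln (W n)) \<longlonglongrightarrow> ln (pi / 2)"
      using wallis unfolding W_def by (intro tendsto_ln) auto
    show "(\<lambda>n. ln (2 + 1 / real n)) \<longlonglongrightarrow> ln 2" by real_asymp
  qed
  also have "ln (pi / 2) + ln 2 + ln 2 = ln (2 * pi)"
    by (simp add: ln_mult ln_div)
  finally have "(\<lambda>n. ln (W n) + ln (2 + 1 / real n) + ln 2) \<longlonglongrightarrow> ln (2 * pi)" .
  moreover have "\<forall>\<^sub>F n in sequentially. ln (W n) + ln (2 + 1 / real n) + ln 2 = 4 * stirling_gap n - 2 * stirling_gap (2 * n)"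
    using eventually_ge_at_top[of 1] by eventually_elim (simp add: key)
  ultimately have "(\<lambda>n. 4 * stirling_gap n - 2 * stirling_gap (2 * n)) \<longlonglongrightarrow> ln (2 * pi)"
    by (rule Lim_transform_eventually)
  moreover have "(\<lambda>n. stirling_gap (2 * n)) \<longlonglongrightarrow> c"
    using c by (rule filterlim_compose) (rule filterlim_subseq, simp add: strict_mono_def)
  hence "(\<lambda>n. 4 * stirling_gap n - 2 * stirling_gap (2 * n)) \<longlonglongrightarrow> 4 * c - 2 * c"
    using c by (intro tendsto_intros)
  ultimately have "ln (2 * pi) = 4 * c - 2 * c" by (rule LIMSEQ_unique)
  thus ?thesis using c by simp
qed

section \<open>Poisson tails at e times the mean\<close>

text \<open>
  Allows linearising \<open>L ln (1 + u)\<close> when \<open>L\<close> is large and \<open>u\<close> is of smaller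
  order than \<open>1 / sqrt L\<close>.
\<close>

lemma ln_one_plus_quadratic_limit:
  fixes L u :: "nat \<Rightarrow> real"
  assumes u: "u \<longlonglongrightarrow> 0" and Lu: "(\<lambda>n. L n * (u n)\<^sup>2) \<longlonglongrightarrow> 0" and L: "\<forall>\<^sub>F n in sequentially. L n > 0"
  shows "(\<lambda>n. L n * (ln (1 + u n) - u n)) \<longlonglongrightarrow> 0"
proof (rule Lim_null_comparison)
  have "\<forall>\<^sub>F n in sequentially. \<bar>u n\<bar> < 1/2"
    using tendstoD[OF u, of "1/2"] by simp
  thus "\<forall>\<^sub>F n in sequentially. norm (L n * (ln (1 + u n) - u n)) \<le> 2 * (L n * (u n)\<^sup>2)"
    using L
  proof eventually_elim
    case (elim n)
    have "\<bar>ln (1 + u n) - u n\<bar> \<le> 2 * (u n)\<^sup>2"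
      using abs_ln_one_plus_x_minus_x_bound[of "u n"] elim by auto
    hence "L n * \<bar>ln (1 + u n) - u n\<bar> \<le> L n * (2 * (u n)\<^sup>2)"
      using elim by (intro mult_left_mono) auto
    thus ?case using elim by (simp add: abs_mult mult_ac)
  qed
  show "(\<lambda>n. 2 * (L n * (u n)\<^sup>2)) \<longlonglongrightarrow> 0"
    using tendsto_mult_right_zero[OF Lu, of 2] by (simp add: mult_ac)
qed

text \<open>
  Write the mean as \<open>L (1 + u)\<close> and the point as \<open>e L (1 + w)\<close>. By Stirling's formula the
  logarithm of the point probability is \<open>e L (1 + w) (ln (1 + u) - ln (1 + w))\<close> up to explicit terms. The
  hypotheses on \<open>\<delta>\<close> and \<open>\<beta>\<close> make all quadratic terms in \<open>u\<close> and
  \<open>w\<close> negligible, so that only \<open>e \<delta> - \<beta>\<close> survives. The further conclusions are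
  the side conditions under which \<open>poisson_tail_ratio\<close> applies.
\<close>

lemma ln_poisson_pmf_asymp:
  fixes L \<delta> \<beta> :: "nat \<Rightarrow> real" and b :: "nat \<Rightarrow> nat"
  assumes L: "filterlim L at_top sequentially"
    and b: "\<And>n. real (b n) = exp 1 * L n + \<beta> n"
    and d2: "(\<lambda>n. (\<delta> n)\<^sup>2 / L n) \<longlonglongrightarrow> 0" and b2: "(\<lambda>n. (\<beta> n)\<^sup>2 / L n) \<longlonglongrightarrow> 0"
  shows "(\<lambda>n. ln (pmf (poisson_pmf (L n + \<delta> n)) (b n))
     - ((exp 1 - 1) * \<delta> n - \<beta> n - L n - ln (L n) / 2 - ln (2 * pi * exp 1) / 2)) \<longlonglongrightarrow> 0"
    and "\<forall>\<^sub>F n in sequentially. L n + \<delta> n > 0 \<and> b n > 0"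
    and "(\<lambda>n. (L n + \<delta> n) / real (b n)) \<longlonglongrightarrow> exp (-1)"
    and "filterlim b at_top sequentially"
proof -
  define u where "u n = \<delta> n / L n" for n
  define w where "w n = \<beta> n / (exp 1 * L n)" for n
  have L0: "\<forall>\<^sub>F n in sequentially. L n > 0"
    using L by (rule filterlim_at_top_dense[THEN iffD1, rule_format])
  have Linf: "(\<lambda>n. 1 / L n) \<longlonglongrightarrow> 0"
    using L by (intro tendsto_divide_0[OF tendsto_const] filterlim_at_top_imp_at_infinity)
  have sqrt0: "f \<longlonglongrightarrow> 0" if "(\<lambda>n. (f n)\<^sup>2) \<longlonglongrightarrow> 0" for f :: "nat \<Rightarrow> real"
    using tendsto_real_sqrt[OF that] by (simp add: tendsto_rabs_zero_iff)
  have Lu2: "(\<lambda>n. L n * (u n)\<^sup>2) \<longlonglongrightarrow> 0"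
    by (rule Lim_transform_eventually[OF d2]) (use L0 in eventually_elim, auto simp: u_def power2_eq_square)
  have "(\<lambda>n. (\<beta> n)\<^sup>2 / L n * (1 / (exp 1)\<^sup>2)) \<longlonglongrightarrow> 0" using b2 by (rule tendsto_mult_left_zero)
  hence Lw2: "(\<lambda>n. L n * (w n)\<^sup>2) \<longlonglongrightarrow> 0"
    by (rule Lim_transform_eventually) (use L0 in eventually_elim, auto simp: w_def power2_eq_square)
  have u0: "u \<longlonglongrightarrow> 0"
  proof (rule sqrt0)
    have "(\<lambda>n. L n * (u n)\<^sup>2 * (1 / L n)) \<longlonglongrightarrow> 0 * 0" using Lu2 Linf by (intro tendsto_mult)
    thus "(\<lambda>n. (u n)\<^sup>2) \<longlonglongrightarrow> 0" 
      unfolding mult_zero_left by (rule Lim_transform_eventually) (use L0 in eventually_elim, auto)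
  qed
  have w0: "w \<longlonglongrightarrow> 0"
  proof (rule sqrt0)
    have "(\<lambda>n. L n * (w n)\<^sup>2 * (1 / L n)) \<longlonglongrightarrow> 0 * 0" using Lw2 Linf by (intro tendsto_mult)
    thus "(\<lambda>n. (w n)\<^sup>2) \<longlonglongrightarrow> 0"
      unfolding mult_zero_left by (rule Lim_transform_eventually) (use L0 in eventually_elim, auto)
  qed
  have Luw: "(\<lambda>n. L n * (w n * (u n - w n))) \<longlonglongrightarrow> 0"
  proof (rule Lim_null_comparison)
    show "(\<lambda>n. L n * (u n)\<^sup>2 + 2 * (L n * (w n)\<^sup>2)) \<longlonglongrightarrow> 0"
      using tendsto_add[OF Lu2 tendsto_mult_left[OF Lw2, of 2]] by simp
    show "\<forall>\<^sub>F n in sequentially. norm (L n * (w n * (u n - w n))) \<le> L n * (u n)\<^sup>2 + 2 * (L n * (w n)\<^sup>2)"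
      using L0
    proof eventually_elim
      case (elim n)
      have "\<bar>w n * (u n - w n)\<bar> \<le> (u n)\<^sup>2 + 2 * (w n)\<^sup>2"
      proof (rule abs_leI)
        have "0 \<le> (w n - u n / 2)\<^sup>2" "0 \<le> (w n + u n / 2)\<^sup>2" by simp_all
        thus "w n * (u n - w n) \<le> (u n)\<^sup>2 + 2 * (w n)\<^sup>2" "- (w n * (u n - w n)) \<le> (u n)\<^sup>2 + 2 * (w n)\<^sup>2"
          using zero_le_square[of "u n"] zero_le_square[of "w n"]
          unfolding power2_eq_square by (simp_all add: algebra_simps, linarith+)
      qed
      hence "L n * \<bar>w n * (u n - w n)\<bar> \<le> L n * ((u n)\<^sup>2 + 2 * (w n)\<^sup>2)" using elim by (intro mult_left_mono) auto
      thus ?case unfolding real_norm_def abs_mult[of "L n"] using elim by (simp add: distrib_left)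
    qed
  qed
  have t_eq: "\<forall>\<^sub>F n in sequentially. L n + \<delta> n = L n * (1 + u n)"
    using L0 by eventually_elim (auto simp: u_def field_simps)
  have b_eq: "\<forall>\<^sub>F n in sequentially. real (b n) = exp 1 * L n * (1 + w n)"
    using L0 by eventually_elim (auto simp: b w_def field_simps)
  have u_half: "\<forall>\<^sub>F n in sequentially. \<bar>u n\<bar> < 1/2" using tendstoD[OF u0, of "1/2"] by simp
  have w_half: "\<forall>\<^sub>F n in sequentially. \<bar>w n\<bar> < 1/2" using tendstoD[OF w0, of "1/2"] by simp
  show pos: "\<forall>\<^sub>F n in sequentially. L n + \<delta> n > 0 \<and> b n > 0"
    using t_eq b_eq u_half w_half L0
  proof eventually_elim
    case (elim n)
    have "real (b n) > 0" unfolding elim(2) using elim by (intro mult_pos_pos) auto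
    moreover have "L n + \<delta> n > 0" unfolding elim(1) using elim by (intro mult_pos_pos) auto
    ultimately show ?case by simp
  qed
  show "(\<lambda>n. (L n + \<delta> n) / real (b n)) \<longlonglongrightarrow> exp (-1)"
  proof -
    have "(\<lambda>n. (1 + u n) / (1 + w n) * exp (-1)) \<longlonglongrightarrow> (1 + 0) / (1 + 0) * exp (-1)"
      using u0 w0 by (intro tendsto_intros) auto
    moreover have "\<forall>\<^sub>F n in sequentially. (1 + u n) / (1 + w n) * exp (-1) = (L n + \<delta> n) / real (b n)"
      using t_eq b_eq w_half L0
    proof eventually_elim
      case (elim n)
      have "L n * (1 + u n) / (exp 1 * L n * (1 + w n)) = L n * (1 + u n) / (L n * (exp 1 * (1 + w n)))"
        by (simp only: mult_ac)
      also have "\<dots> = (1 + u n) / (exp 1 * (1 + w n))" using elim by simp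
      also have "\<dots> = (1 + u n) / (1 + w n) * exp (-1)" by (simp add: exp_minus field_simps)
      finally show ?case unfolding elim(1,2) by simp
    qed
    ultimately show ?thesis by (simp add: tendsto_cong)
  qed
  show binf: "filterlim b at_top sequentially"
  proof -
    have "filterlim (\<lambda>n. exp 1 / 2 * L n) at_top sequentially"
      using L by (intro filterlim_tendsto_pos_mult_at_top[OF tendsto_const]) auto
    moreover have "\<forall>\<^sub>F n in sequentially. exp 1 / 2 * L n \<le> real (b n)"
      using b_eq w_half L0
    proof eventually_elim
      case (elim n)
      have "exp 1 * L n * (1/2) \<le> exp 1 * L n * (1 + w n)" using elim by (intro mult_left_mono) auto
      thus ?case using elim by simp
    qed
    ultimately have "filterlim (\<lambda>n. real (b n)) at_top sequentially"
      by (rule filterlim_at_top_mono)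
    thus ?thesis using filterlim_sequentially_iff_filterlim_real by blast
  qed
  define r where "r n = exp 1 * (L n * (w n * (u n - w n)))
      + exp 1 * (1 + w n) * (L n * (ln (1 + u n) - u n) - L n * (ln (1 + w n) - w n))
      - ln (1 + w n) / 2 - (stirling_gap (b n) - ln (2 * pi) / 2)" for n
  have r: "r \<longlonglongrightarrow> exp 1 * 0 + exp 1 * (1 + 0) * (0 - 0) - ln (1 + 0) / 2 - (ln (2 * pi) / 2 - ln (2 * pi) / 2)"
    unfolding r_def
    by (intro tendsto_add tendsto_diff tendsto_mult tendsto_divide tendsto_const tendsto_ln
          Luw w0 ln_one_plus_quadratic_limit[OF u0 Lu2 L0] ln_one_plus_quadratic_limit[OF w0 Lw2 L0]
          filterlim_compose[OF stirling_ln_fact binf]) auto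
  have "\<forall>\<^sub>F n in sequentially. r n = ln (pmf (poisson_pmf (L n + \<delta> n)) (b n))
     - ((exp 1 - 1) * \<delta> n - \<beta> n - L n - ln (L n) / 2 - ln (2 * pi * exp 1) / 2)"
    using t_eq b_eq u_half w_half L0 pos
  proof eventually_elim
    case (elim n)
    let ?t = "L n + \<delta> n" and ?b = "real (b n)"
    have lt: "ln ?t = ln (L n) + ln (1 + u n)"
      unfolding elim(1) using elim by (subst ln_mult) auto
    have lb: "ln ?b = 1 + ln (L n) + ln (1 + w n)"
      unfolding elim(2) using elim by (subst ln_mult; (subst ln_mult)?) auto
    have ud: "\<delta> n = L n * u n" and wd: "\<beta> n = exp 1 * L n * w n" using elim by (auto simp: u_def w_def)
    have "ln (pmf (poisson_pmf ?t) (b n)) = ?b * ln ?t - ln (fact (b n)) - ?t"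
      using elim by (simp add: ln_mult ln_div ln_realpow)
    also have "ln (fact (b n)) = stirling_gap (b n) + (?b + 1/2) * ln ?b - ?b"
      by (simp add: stirling_gap_def)
    also have "?b * ln ?t - (stirling_gap (b n) + (?b + 1/2) * ln ?b - ?b) - ?t
        = ?b * (ln (1 + u n) - ln (1 + w n)) - (1 + ln (L n) + ln (1 + w n)) / 2 - stirling_gap (b n) - ?t"
      unfolding lt lb by (simp add: algebra_simps)
    finally have P: "ln (pmf (poisson_pmf ?t) (b n)) = \<dots>" .
    have l2: "ln (2 * pi * exp 1) = ln (2 * pi) + 1" by (subst ln_mult) auto
    show ?case unfolding P r_def l2 unfolding b ud wd by (simp add: field_simps)
  qed
  thus "(\<lambda>n. ln (pmf (poisson_pmf (L n + \<delta> n)) (b n))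
     - ((exp 1 - 1) * \<delta> n - \<beta> n - L n - ln (L n) / 2 - ln (2 * pi * exp 1) / 2)) \<longlonglongrightarrow> 0"
    using r by (simp add: tendsto_cong)
qed

abbreviation poisson_prob :: "real \<Rightarrow> nat set \<Rightarrow> real" where
  "poisson_prob t A \<equiv> measure (measure_pmf (poisson_pmf t)) A"

lemma measure_pmf_atLeast_nat:
  "(\<lambda>k. pmf p (b + k)) sums measure (measure_pmf p) {b..}" for p :: "nat pmf"
proof -
  have s: "(\<lambda>k. measure (measure_pmf p) {b + k}) sums measure (measure_pmf p) (\<Union>k. {b + k})"
    by (rule measure_pmf.finite_measure_UNION) (auto simp: disjoint_family_on_def)
  have "(\<Union>k. {b + k}) = {b..}" by (auto simp: le_iff_add)
  thus ?thesis using s by (simp add: measure_pmf_single)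
qed

text \<open>
  Successive point probabilities beyond \<open>b\<close> have ratio close to \<open>t / b\<close>, hence to
  \<open>1 / e\<close>. So the tail is asymptotically a geometric series; Tannery's theorem, with a geometric majorant
  of ratio \<open>1 / 2\<close>, justifies passing to the limit term by term.
\<close>

lemma poisson_tail_ratio:
  fixes t :: "nat \<Rightarrow> real" and b :: "nat \<Rightarrow> nat"
  assumes t: "\<forall>\<^sub>F n in sequentially. t n > 0 \<and> b n > 0" and tb: "(\<lambda>n. t n / real (b n)) \<longlonglongrightarrow> exp (-1)"
    and b: "filterlim b at_top sequentially"
  shows "(\<lambda>n. poisson_prob (t n) {b n..} / pmf (poisson_pmf (t n)) (b n))
    \<longlonglongrightarrow> exp 1 / (exp 1 - 1)"
proof -
  define f where "f n k = (\<Prod>i=1..k. t n / (real (b n) + real i))" for n k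
  have br: "filterlim (\<lambda>n. real (b n)) at_top sequentially"
    using b filterlim_sequentially_iff_filterlim_real by blast
  have bpos: "\<forall>\<^sub>F n in sequentially. b n > 0" using t by eventually_elim auto
  have lim1: "(\<lambda>n. t n / (real (b n) + real i)) \<longlonglongrightarrow> exp (-1)" for i
  proof -
    have "(\<lambda>n. real i / real (b n)) \<longlonglongrightarrow> 0"
      using br by (intro tendsto_divide_0[OF tendsto_const] filterlim_at_top_imp_at_infinity)
    hence "(\<lambda>n. (t n / real (b n)) / (1 + real i / real (b n))) \<longlonglongrightarrow> exp (-1) / (1 + 0)"
      using tb by (intro tendsto_intros) auto
    moreover have "\<forall>\<^sub>F n in sequentially. (t n / real (b n)) / (1 + real i / real (b n)) = t n / (real (b n) + real i)"
      using bpos by eventually_elim (auto simp: field_simps)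
    ultimately show ?thesis by (simp only: tendsto_cong) simp
  qed
  have limf: "(\<lambda>n. f n k) \<longlonglongrightarrow> exp (-1) ^ k" for k
  proof -
    have "(\<lambda>n. f n k) \<longlonglongrightarrow> (\<Prod>i=1..k. exp (-1))" unfolding f_def by (intro tendsto_prod lim1)
    thus ?thesis by simp
  qed
  have f_eq: "pmf (poisson_pmf (t n)) (b n + k) = pmf (poisson_pmf (t n)) (b n) * f n k" if "t n > 0" for n k
  proof (induction k)
    case (Suc k)
    have f0: "fact (b n + k) * (real (b n) + real k + 1) = (fact (b n + Suc k) :: real)" by (simp add: algebra_simps)
    have "pmf (poisson_pmf (t n)) (b n + Suc k) = pmf (poisson_pmf (t n)) (b n + k) * (t n / (real (b n) + real (Suc k)))"
      using that by (simp add: f0[symmetric] field_simps)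
    thus ?case using Suc by (simp add: f_def mult_ac)
  qed (auto simp: f_def)
  have e2: "exp (-1) < (1/2::real)"
  proof -
    have "2 < exp (1::real)" using exp_lower_Taylor_quadratic[of 1] by simp
    hence "inverse (exp 1) < inverse (2::real)" by (intro less_imp_inverse_less) auto
    thus ?thesis by (simp add: exp_minus)
  qed
  have "\<forall>\<^sub>F n in sequentially. t n / real (b n) < 1/2" using order_tendstoD(2)[OF tb e2] .
  hence dom: "\<forall>\<^sub>F n in sequentially. t n > 0 \<and> (\<forall>k. norm (f n k) \<le> (1/2) ^ k)"
    using t
  proof eventually_elim
    case (elim n)
    have "norm (f n k) \<le> (1/2)^k" for k
    proof -
      have "norm (f n k) = (\<Prod>i=1..k. t n / (real (b n) + real i))"
        unfolding f_def using elim by (simp add: abs_prod)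
      also have "\<dots> \<le> (\<Prod>i=1..k. 1/2)"
      proof (intro prod_mono conjI)
        fix i assume "i \<in> {1..k}"
        have "t n / (real (b n) + real i) \<le> t n / real (b n)"
          using elim by (intro divide_left_mono) auto
        thus "t n / (real (b n) + real i) \<le> 1/2" using elim by simp
        show "0 \<le> t n / (real (b n) + real i)" using elim by simp
      qed
      finally show ?thesis by simp
    qed
    thus ?case using elim by auto
  qed
  have "((\<lambda>n. \<Sum>k. f n k) \<longlongrightarrow> (\<Sum>k. exp (-1) ^ k)) sequentially"
  proof (rule tannerys_theorem[where M = "\<lambda>k. (1/2)^k" and a = "\<lambda>k n. f n k", THEN conjunct2, THEN conjunct2])
    show "\<forall>\<^sub>F (k, n) in at_top \<times>\<^sub>F sequentially. norm (f n k) \<le> (1 / 2) ^ k"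
      using eventually_prodI[OF always_eventually dom, of "\<lambda>_. True"]
      by (rule eventually_mono) auto
  qed (auto intro: limf summable_geometric)
  moreover have "(\<Sum>k. exp (-1) ^ k) = exp 1 / (exp 1 - (1::real))"
    using e2 by (subst suminf_geometric) (auto simp: exp_minus divide_simps)
  moreover have "\<forall>\<^sub>F n in sequentially. (\<Sum>k. f n k) = poisson_prob (t n) {b n..} / pmf (poisson_pmf (t n)) (b n)"
    using dom
  proof eventually_elim
    case (elim n)
    hence tp: "t n > 0" by simp
    have p0: "pmf (poisson_pmf (t n)) (b n) > 0" using tp by simp
    have "(\<lambda>k. pmf (poisson_pmf (t n)) (b n) * f n k) sums poisson_prob (t n) {b n..}"
      using measure_pmf_atLeast_nat[of "poisson_pmf (t n)" "b n"] by (simp only: f_eq[OF tp])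
    hence "(\<lambda>k. f n k) sums (poisson_prob (t n) {b n..} / pmf (poisson_pmf (t n)) (b n))"
      using p0 by (subst (asm) sums_mult_iff[symmetric, of "pmf (poisson_pmf (t n)) (b n)"]; simp?) (auto dest: sums_mult_D)
    thus ?case by (rule sums_unique[symmetric])
  qed
  ultimately show ?thesis by (simp add: tendsto_cong)
qed

section \<open>The time scale and the two rates\<close>

text \<open>
  The real parameter \<open>s\<close> is the rescaled time. The truncation at \<open>0\<close> only matters for small
  \<open>n\<close> and keeps all evaluation times in the range where the processes are controlled.
\<close>

definition time_at :: "nat \<Rightarrow> nat \<Rightarrow> real \<Rightarrow> real" where
  "time_at m n s = max 0 (ln (real n) + real m * ln (ln (real n)) - ln (fact m) + s)"

lemma time_at_nonneg: "0 \<le> time_at m n s"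
  by (simp add: time_at_def)

lemma time_at_mono: "s \<le> s' \<Longrightarrow> time_at m n s \<le> time_at m n s'"
  by (simp add: time_at_def)

lemma time_at_eventually:
  "\<forall>\<^sub>F n in sequentially. time_at m n s = ln (real n) + real m * ln (ln (real n)) - ln (fact m) + s \<and> 0 < time_at m n s"
proof -
  have "filterlim (\<lambda>n. ln (real n) + real m * ln (ln (real n)) - ln (fact m) + s) at_top sequentially"
    by real_asymp
  hence "\<forall>\<^sub>F n in sequentially. 0 < ln (real n) + real m * ln (ln (real n)) - ln (fact m) + s"
    by (rule filterlim_at_top_dense[THEN iffD1, rule_format])
  thus ?thesis by eventually_elim (auto simp: time_at_def)
qed

lemma ln_real_at_top: "filterlim (\<lambda>n. ln (real n)) at_top sequentially"
  by real_asymp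

text \<open>
  In \<open>P (X \<le> m)\<close> only the term with exponent \<open>m\<close> survives in the limit, and
  \<open>n exp (- t) = m! exp (- s) / L\<^sup>m\<close> by the choice of the time scale.
\<close>

lemma low_rate:
  "(\<lambda>n. real n * poisson_prob (time_at m n s) {..m}) \<longlonglongrightarrow> exp (- s)"
proof -
  define L where "L n = ln (real n)" for n :: nat
  define t where "t n = L n + real m * ln (L n) - ln (fact m) + s" for n
  have L: "filterlim L at_top sequentially" unfolding L_def by (rule ln_real_at_top)
  have L0: "\<forall>\<^sub>F n in sequentially. L n > 0" using L by (rule filterlim_at_top_dense[THEN iffD1, rule_format])
  have tL: "(\<lambda>n. t n / L n) \<longlonglongrightarrow> 1" unfolding t_def L_def by real_asymp
  have iL: "(\<lambda>n. 1 / L n) \<longlonglongrightarrow> 0" unfolding L_def by real_asymp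
  have "(\<lambda>n. \<Sum>k\<le>m. (t n / L n) ^ k * (1 / L n) ^ (m - k) * (fact m / fact k * exp (- s)))
     \<longlonglongrightarrow> (\<Sum>k\<le>m. 1 ^ k * 0 ^ (m - k) * (fact m / fact k * exp (- s)))"
    by (intro tendsto_intros tL iL)
  also have "(\<Sum>k\<le>m. 1 ^ k * 0 ^ (m - k) * (fact m / fact k * exp (- s))) = (\<Sum>k\<le>m. if k = m then exp (- s) else 0)"
    by (intro sum.cong) (auto simp: power_0_left)
  also have "\<dots> = exp (- s)" by simp
  finally have lim: "(\<lambda>n. \<Sum>k\<le>m. (t n / L n) ^ k * (1 / L n) ^ (m - k) * (fact m / fact k * exp (- s))) \<longlonglongrightarrow> exp (- s)" .
  show ?thesis
  proof (rule Lim_transform_eventually[OF lim])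
    show "\<forall>\<^sub>F n in sequentially. (\<Sum>k\<le>m. (t n / L n) ^ k * (1 / L n) ^ (m - k) * (fact m / fact k * exp (- s)))
        = real n * poisson_prob (time_at m n s) {..m}"
      using time_at_eventually[of m s] L0 eventually_gt_at_top[of 0]
    proof eventually_elim
      case (elim n)
      hence tt: "time_at m n s = t n" "0 < t n" by (auto simp: t_def L_def)
      have "exp (t n) = real n * L n ^ m / fact m * exp s"
      proof -
        have "exp (t n) = exp (L n) * exp (ln (L n)) ^ m / exp (ln (fact m)) * exp s"
          unfolding t_def exp_add exp_diff exp_of_nat_mult ..
        thus ?thesis using elim by (simp add: L_def)
      qed
      hence e: "real n * exp (- t n) = fact m * exp (- s) / L n ^ m"
        using elim by (simp add: exp_minus field_simps)
      have "real n * poisson_prob (t n) {..m} = (\<Sum>k\<le>m. t n ^ k / fact k * (real n * exp (- t n)))"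
        using tt by (subst measure_measure_pmf_finite) (auto simp: sum_distrib_left mult_ac)
      also have "\<dots> = (\<Sum>k\<le>m. (t n / L n) ^ k * (1 / L n) ^ (m - k) * (fact m / fact k * exp (- s)))"
      proof (rule sum.cong[OF refl])
        fix k assume "k \<in> {..m}"
        hence "L n ^ m = L n ^ k * L n ^ (m - k)" by (simp add: power_add[symmetric])
        thus "t n ^ k / fact k * (real n * exp (- t n)) = (t n / L n) ^ k * (1 / L n) ^ (m - k) * (fact m / fact k * exp (- s))"
          unfolding e by (simp add: power_divide)
      qed
      finally show ?case by (simp add: tt)
    qed
  qed
qed

lemma centering_at_top: "filterlim (centering m) at_top sequentially"
proof -
  have 1: "filterlim (\<lambda>n. exp 1 * ln (real n) + ((exp 1 - 1) * real m - 1/2) * ln (ln (real n)) - C) at_top sequentially" for C :: real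
    by real_asymp
  show ?thesis using 1 unfolding centering_def Let_def .
qed

lemma affine_log_log_square_over_log:
  "(\<lambda>n. (A * ln (ln (real n)) + B)\<^sup>2 / ln (real n)) \<longlonglongrightarrow> 0"
proof -
  have "(\<lambda>n. (ln (ln (real n)))\<^sup>2 / ln (real n)) \<longlonglongrightarrow> 0" "(\<lambda>n. ln (ln (real n)) / ln (real n)) \<longlonglongrightarrow> 0"
    "(\<lambda>n. 1 / ln (real n)) \<longlonglongrightarrow> 0"
    by real_asymp+
  hence "(\<lambda>n. A\<^sup>2 * ((ln (ln (real n)))\<^sup>2 / ln (real n)) + 2 * A * B * (ln (ln (real n)) / ln (real n)) + B\<^sup>2 * (1 / ln (real n)))
     \<longlonglongrightarrow> A\<^sup>2 * 0 + 2 * A * B * 0 + B\<^sup>2 * 0"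
    by (intro tendsto_intros)
  thus ?thesis by (simp add: power2_sum power_mult_distrib add_divide_distrib mult_ac add_ac)
qed

text \<open>
  The level must be an integer, so the fractional part of the centering does not disappear but shifts the exponent:
  the expected count need not converge, it only approaches a bounded sequence.
\<close>

theorem high_rate:
  "(\<lambda>n. real n * poisson_prob (time_at m n s) {x. \<lfloor>centering m n\<rfloor> + k < int x}
     - exp ((exp 1 - 1) * s + frac (centering m n) - real_of_int k)) \<longlonglongrightarrow> 0"
proof -
  define e where "e = exp (1::real)"
  have e1: "e > 1" by (simp add: e_def)
  define L where "L n = ln (real n)" for n :: nat
  define \<delta> where "\<delta> n = real m * ln (L n) - ln (fact m) + s" for n
  define C where "C = ln ((e - 1) * (fact m) powr (e - 1) * sqrt (2 * pi * e))"
  define A where "A = (e - 1) * real m - 1/2"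
  define b where "b n = nat (\<lfloor>centering m n\<rfloor> + k + 1)" for n
  define \<beta> where "\<beta> n = real (b n) - exp 1 * L n" for n
  define c where "c n = frac (centering m n)" for n
  have c01: "0 \<le> c n" "c n < 1" for n by (auto simp: c_def frac_lt_1)
  have L: "filterlim L at_top sequentially" unfolding L_def by (rule ln_real_at_top)
  have cent: "centering m n = e * L n + A * ln (L n) - C" for n
    by (simp add: centering_def Let_def e_def L_def A_def C_def)
  have C_eq: "C = ln (e - 1) + (e - 1) * ln (fact m) + ln (2 * pi * e) / 2"
  proof -
    have "C = ln (e - 1) + ln ((fact m) powr (e - 1)) + ln (sqrt (2 * pi * e))"
      unfolding C_def using e1 by (simp add: ln_mult)
    thus ?thesis using e1 by (simp add: ln_powr ln_sqrt)
  qed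
  have fl: "\<forall>\<^sub>F n in sequentially. \<lfloor>centering m n\<rfloor> + k + 1 \<ge> 0"
  proof -
    have "\<forall>\<^sub>F n in sequentially. centering m n \<ge> real_of_int (- k)"
      using centering_at_top[of m] by (auto simp: filterlim_at_top)
    thus ?thesis by eventually_elim linarith
  qed
  have \<beta>_eq: "\<forall>\<^sub>F n in sequentially. \<beta> n = A * ln (L n) - C - c n + real_of_int k + 1"
    using fl
  proof eventually_elim
    case (elim n)
    hence "real (b n) = real_of_int \<lfloor>centering m n\<rfloor> + real_of_int k + 1" by (simp add: b_def)
    also have "real_of_int \<lfloor>centering m n\<rfloor> = centering m n - c n" by (simp add: c_def frac_def)
    finally show ?case by (simp add: \<beta>_def cent e_def)
  qed
  have \<delta>2: "(\<lambda>n. (\<delta> n)\<^sup>2 / L n) \<longlonglongrightarrow> 0"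
    using affine_log_log_square_over_log[of "real m" "s - ln (fact m)"] by (simp add: \<delta>_def L_def algebra_simps)
  have \<beta>2: "(\<lambda>n. (\<beta> n)\<^sup>2 / L n) \<longlonglongrightarrow> 0"
  proof (rule Lim_null_comparison)
    \<comment> \<open>Majorant for the bounded part of \<open>\<beta>\<close>, including the oscillating fractional part.\<close>
    define B where "B = \<bar>C\<bar> + 1 + \<bar>real_of_int k\<bar> + 1"
    show "(\<lambda>n. (\<bar>A\<bar> * ln (L n) + B)\<^sup>2 / L n) \<longlonglongrightarrow> 0"
      unfolding L_def by (rule affine_log_log_square_over_log)
    have L1: "\<forall>\<^sub>F n in sequentially. L n > 1" using L by (rule filterlim_at_top_dense[THEN iffD1, rule_format])
    show "\<forall>\<^sub>F n in sequentially. norm ((\<beta> n)\<^sup>2 / L n) \<le> (\<bar>A\<bar> * ln (L n) + B)\<^sup>2 / L n"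
      using \<beta>_eq L1
    proof eventually_elim
      case (elim n)
      have "\<bar>\<beta> n\<bar> \<le> \<bar>A * ln (L n)\<bar> + B" unfolding elim(1) B_def using c01[of n] by linarith
      also have "\<bar>A * ln (L n)\<bar> = \<bar>A\<bar> * ln (L n)" using elim by (simp add: abs_mult)
      finally have "\<bar>\<beta> n\<bar> \<le> \<bar>A\<bar> * ln (L n) + B" .
      hence "(\<beta> n)\<^sup>2 \<le> (\<bar>A\<bar> * ln (L n) + B)\<^sup>2" using power_mono[of "\<bar>\<beta> n\<bar>" _ 2] by simp
      thus ?case using elim by (simp add: divide_right_mono)
    qed
  qed
  have breal: "real (b n) = exp 1 * L n + \<beta> n" for n by (simp add: \<beta>_def)
  note asymp = ln_poisson_pmf_asymp[OF L breal \<delta>2 \<beta>2]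
  note ratio = poisson_tail_ratio[OF asymp(2,3,4)]
  let ?pmf = "\<lambda>n. pmf (poisson_pmf (L n + \<delta> n)) (b n)"
  let ?tail = "\<lambda>n. poisson_prob (L n + \<delta> n) {b n..}"
  define x where "x n = (exp 1 - 1) * s + c n - real_of_int k" for n
  have "(\<lambda>n. ?tail n / ?pmf n * exp ((ln (?pmf n) - ((exp 1 - 1) * \<delta> n - \<beta> n - L n - ln (L n) / 2 - ln (2 * pi * exp 1) / 2))
       + (ln (e - 1) - 1))) \<longlonglongrightarrow> exp 1 / (exp 1 - 1) * exp (0 + (ln (e - 1) - 1))"
    by (intro tendsto_mult ratio tendsto_exp tendsto_add asymp(1) tendsto_const)
  also have "exp 1 / (exp 1 - 1) * exp (0 + (ln (e - 1) - 1)) = (1::real)"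
    using e1 by (simp add: exp_diff e_def)
  finally have lim1: "(\<lambda>n. ?tail n / ?pmf n * exp ((ln (?pmf n) - ((exp 1 - 1) * \<delta> n - \<beta> n - L n - ln (L n) / 2 - ln (2 * pi * exp 1) / 2))
       + (ln (e - 1) - 1))) \<longlonglongrightarrow> 1" .
  have "(\<lambda>n. real n * ?tail n / exp (x n)) \<longlonglongrightarrow> 1"
  proof (rule Lim_transform_eventually[OF lim1])
    show "\<forall>\<^sub>F n in sequentially. ?tail n / ?pmf n * exp ((ln (?pmf n) - ((exp 1 - 1) * \<delta> n - \<beta> n - L n - ln (L n) / 2 - ln (2 * pi * exp 1) / 2))
       + (ln (e - 1) - 1)) = real n * ?tail n / exp (x n)"
      using \<beta>_eq asymp(2) eventually_gt_at_top[of 0]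
    proof eventually_elim
      case (elim n)
      have p: "?pmf n > 0" using elim by simp
      have "(ln (?pmf n) - ((exp 1 - 1) * \<delta> n - \<beta> n - L n - ln (L n) / 2 - ln (2 * pi * exp 1) / 2)) + (ln (e - 1) - 1)
         = ln (?pmf n) + L n - x n"
        unfolding elim(1) C_eq \<delta>_def A_def x_def e_def by (simp add: field_simps)
      hence "exp ((ln (?pmf n) - ((exp 1 - 1) * \<delta> n - \<beta> n - L n - ln (L n) / 2 - ln (2 * pi * exp 1) / 2)) + (ln (e - 1) - 1))
         = ?pmf n * real n / exp (x n)"
        using p elim by (simp only: exp_diff exp_add exp_ln L_def of_nat_0_less_iff)
      thus ?case using p by simp
    qed
  qed
  hence lim2: "(\<lambda>n. real n * ?tail n / exp (x n) - 1) \<longlonglongrightarrow> 0" using tendsto_diff[OF _ tendsto_const[of 1]] by fastforce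
  define X where "X = exp ((exp 1 - 1) * s + 1 - real_of_int k)"
  have lim3: "(\<lambda>n. real n * ?tail n - exp (x n)) \<longlonglongrightarrow> 0"
  proof (rule Lim_null_comparison)
    show "(\<lambda>n. \<bar>real n * ?tail n / exp (x n) - 1\<bar> * X) \<longlonglongrightarrow> 0"
      by (intro tendsto_mult_left_zero tendsto_rabs_zero lim2)
    show "\<forall>\<^sub>F n in sequentially. norm (real n * ?tail n - exp (x n)) \<le> \<bar>real n * ?tail n / exp (x n) - 1\<bar> * X"
    proof (rule always_eventually, rule allI)
      fix n
      have "norm (real n * ?tail n - exp (x n)) = \<bar>(real n * ?tail n / exp (x n) - 1) * exp (x n)\<bar>"
        by (simp add: left_diff_distrib)
      also have "\<dots> = \<bar>real n * ?tail n / exp (x n) - 1\<bar> * exp (x n)" by (simp add: abs_mult)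
      also have "\<dots> \<le> \<bar>real n * ?tail n / exp (x n) - 1\<bar> * X"
        unfolding X_def x_def using c01[of n] by (intro mult_left_mono) auto
      finally show "norm (real n * ?tail n - exp (x n)) \<le> \<bar>real n * ?tail n / exp (x n) - 1\<bar> * X" .
    qed
  qed
  show ?thesis
  proof (rule Lim_transform_eventually[OF lim3])
    show "\<forall>\<^sub>F n in sequentially. real n * ?tail n - exp (x n) =
      real n * poisson_prob (time_at m n s) {x. \<lfloor>centering m n\<rfloor> + k < int x}
     - exp ((exp 1 - 1) * s + frac (centering m n) - real_of_int k)"
      using time_at_eventually[of m s] fl
    proof eventually_elim
      case (elim n)
      have "time_at m n s = L n + \<delta> n" using elim by (simp add: L_def \<delta>_def)
      moreover have "{x. \<lfloor>centering m n\<rfloor> + k < int x} = {b n..}" using elim by (auto simp: b_def)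
      ultimately show ?case by (simp add: x_def c_def)
    qed
  qed
qed

section \<open>Poisson limits for counts of rare events\<close>

text \<open>
  Each of the points \<open>2 ^ (- k)\<close> is isolated from all the others. Hence a tent function around
  \<open>2 ^ (- c)\<close> is continuous and restricts to the indicator of \<open>c\<close> on these points; the
  Weierstrass theorem replaces it by a polynomial.
\<close>

lemma polynomial_indicator_of_geometric:
  fixes e :: real and c :: nat
  assumes e: "e > 0"
  obtains a :: "nat \<Rightarrow> real" and d :: nat
  where "\<And>k. \<bar>(\<Sum>i\<le>d. a i * ((1/2) ^ i) ^ k) - indicator {c} k\<bar> \<le> e"
proof -
  define g where "g x = max 0 (1 - 2 ^ (c+1) * \<bar>x - (1/2) ^ c\<bar>)" for x :: real
  have "continuous_on {0..1} g" unfolding g_def[abs_def] by (intro continuous_intros)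
  then obtain p where p: "real_polynomial_function p" "\<And>x. x \<in> {0..1} \<Longrightarrow> \<bar>g x - p x\<bar> < e"
    using Stone_Weierstrass_real_polynomial_function[of "{0..1}" g e] e by blast
  from p(1) obtain a d where ad: "p = (\<lambda>x. \<Sum>i\<le>d. a i * x ^ i)"
    by (auto simp: real_polynomial_function_iff_sum)
  have g: "g ((1/2) ^ k) = indicator {c} k" for k
  proof -
    consider "k = c" | "k > c" | "k < c" by linarith
    thus ?thesis
    proof cases
      case 2
      hence "(1/2::real) ^ k \<le> (1/2) ^ (c+1)" by (intro power_decreasing) auto
      moreover have "(1/2::real) ^ c = 2 * (1/2) ^ (c+1)" by simp
      ultimately have "\<bar>(1/2) ^ k - (1/2::real) ^ c\<bar> \<ge> (1/2) ^ (c+1)" by linarith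
      hence "2 ^ (c+1) * \<bar>(1/2) ^ k - (1/2::real) ^ c\<bar> \<ge> 2 ^ (c+1) * (1/2) ^ (c+1)"
        by (intro mult_left_mono) auto
      also have "2 ^ (c+1) * (1/2::real) ^ (c+1) = 1" by (simp add: power_one_over)
      finally show ?thesis using 2 by (simp add: g_def)
    next
      case 3
      hence "(1/2::real) ^ (c-1) \<le> (1/2) ^ k" by (intro power_decreasing) auto
      moreover have "(1/2::real) ^ c = (1/2) ^ (c-1) / 2" using 3 by (cases c) auto
      moreover have "(1/2::real) ^ c \<ge> (1/2) ^ (c+1)" by (intro power_decreasing) auto
      ultimately have "(1/2) ^ k - (1/2::real) ^ c \<ge> (1/2) ^ (c+1)" by linarith
      hence "\<bar>(1/2) ^ k - (1/2::real) ^ c\<bar> \<ge> (1/2) ^ (c+1)" by linarith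
      hence "2 ^ (c+1) * \<bar>(1/2) ^ k - (1/2::real) ^ c\<bar> \<ge> 2 ^ (c+1) * (1/2) ^ (c+1)"
        by (intro mult_left_mono) auto
      also have "2 ^ (c+1) * (1/2::real) ^ (c+1) = 1" by (simp add: power_one_over)
      finally show ?thesis using 3 by (simp add: g_def)
    qed (auto simp: g_def)
  qed
  show thesis
  proof (rule that)
    fix k :: nat
    have "(1/2::real) ^ k \<in> {0..1}" by (auto intro: power_le_one)
    from p(2)[OF this] g[of k] show "\<bar>(\<Sum>i\<le>d. a i * ((1/2) ^ i) ^ k) - indicator {c} k\<bar> \<le> e"
      by (simp add: ad power_mult[symmetric] mult.commute abs_minus_commute)
  qed
qed

lemma poisson_pgf:
  assumes rate: "rate > 0" and z: "0 \<le> z" "z \<le> 1"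
  shows "measure_pmf.expectation (poisson_pmf rate) (\<lambda>k. z ^ k) = exp (- rate * (1 - z))"
proof -
  have s: "(\<lambda>k. pmf (poisson_pmf rate) k * z ^ k) sums (exp (rate * z) * exp (- rate))"
    using sums_mult2[OF exp_converges[of "rate * z"], of "exp (- rate)"] rate
    by (simp add: power_mult_distrib field_simps)
  have "measure_pmf.expectation (poisson_pmf rate) (\<lambda>k. z ^ k)
      = (\<integral>k. pmf (poisson_pmf rate) k * z ^ k \<partial>count_space UNIV)"
    unfolding measure_pmf_eq_density by (subst integral_density) auto
  also have "\<dots> = (\<Sum>k. pmf (poisson_pmf rate) k * z ^ k)"
  proof (rule integral_count_space_nat)
    have "norm (pmf (poisson_pmf rate) k * z ^ k) = pmf (poisson_pmf rate) k * z ^ k" for k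
      using z by (simp add: abs_mult del: pmf_poisson)
    thus "integrable (count_space UNIV) (\<lambda>k. pmf (poisson_pmf rate) k * z ^ k)"
      unfolding integrable_count_space_nat_iff using s by (simp add: sums_iff del: pmf_poisson)
  qed
  also have "\<dots> = exp (rate * z) * exp (- rate)" using s by (simp add: sums_iff)
  also have "\<dots> = exp (- rate * (1 - z))" by (simp add: exp_add[symmetric] algebra_simps)
  finally show ?thesis .
qed

context prob_space begin

text \<open>
  A continuity theorem for generating functions in which the target may vary with \<open>n\<close> and a weight
  \<open>Y n\<close> is carried along. By \<open>polynomial_indicator_of_geometric\<close> the indicator of
  \<open>c\<close> is uniformly close to a linear combination of the functions \<open>k \<mapsto> z ^ k\<close> with
  \<open>z\<close> a power of \<open>1 / 2\<close>, on which the hypothesis can be used.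
\<close>

lemma geometric_moments_determine_atoms:
  fixes C :: "nat \<Rightarrow> 'a \<Rightarrow> nat" and Y :: "nat \<Rightarrow> 'a \<Rightarrow> real" and rate w :: "nat \<Rightarrow> real"
  assumes C: "\<And>n. C n \<in> measurable M (count_space UNIV)"
    and Y: "\<And>n. Y n \<in> borel_measurable M" "\<And>n \<omega>. \<bar>Y n \<omega>\<bar> \<le> 1"
    and rate: "\<And>n. rate n > 0" and w: "\<And>n. \<bar>w n\<bar> \<le> 1"
    and lim: "\<And>z. 0 < z \<Longrightarrow> z \<le> 1 \<Longrightarrow>
      (\<lambda>n. expectation (\<lambda>\<omega>. Y n \<omega> * z ^ C n \<omega>) - w n * exp (- rate n * (1 - z))) \<longlonglongrightarrow> 0"
  shows "(\<lambda>n. expectation (\<lambda>\<omega>. Y n \<omega> * indicator {c} (C n \<omega>)) - w n * pmf (poisson_pmf (rate n)) c) \<longlonglongrightarrow> 0"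
proof (rule tendstoI)
  fix e :: real assume "e > 0"
  define e' where "e' = e / 3"
  have e': "e' > 0" using \<open>e > 0\<close> by (simp add: e'_def)
  obtain a d where ad: "\<And>k. \<bar>(\<Sum>i\<le>d. a i * ((1/2) ^ i) ^ k) - indicator {c} k\<bar> \<le> e'"
    using polynomial_indicator_of_geometric[OF e', of c] by blast
  define q where "q k = (\<Sum>i\<le>d. a i * ((1/2) ^ i) ^ k)" for k :: nat
  have q: "\<bar>q k - indicator {c} k\<bar> \<le> e'" for k using ad[of k] by (simp add: q_def)
  have half: "0 < ((1::real)/2) ^ i" "((1::real)/2) ^ i \<le> 1" for i by (auto intro: power_le_one)
  define D where "D n = (\<Sum>i\<le>d. a i * (expectation (\<lambda>\<omega>. Y n \<omega> * ((1/2) ^ i) ^ C n \<omega>) - w n * exp (- rate n * (1 - (1/2) ^ i))))" for n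
  have "D \<longlonglongrightarrow> (\<Sum>i\<le>d. a i * 0)"
    unfolding D_def by (intro tendsto_sum tendsto_mult tendsto_const lim half)
  hence D: "\<forall>\<^sub>F n in sequentially. \<bar>D n\<bar> < e'" using tendstoD[of D 0, OF _ e'] by simp
  have bound: "\<bar>expectation (\<lambda>\<omega>. Y n \<omega> * indicator {c} (C n \<omega>)) - w n * pmf (poisson_pmf (rate n)) c\<bar> \<le> \<bar>D n\<bar> + 2 * e'" for n
  proof -
    note [measurable] = C Y(1)
    let ?p = "poisson_pmf (rate n)"
    have intY: "integrable M (\<lambda>\<omega>. Y n \<omega> * h (C n \<omega>))" if "\<And>k. \<bar>h k\<bar> \<le> B" for h :: "nat \<Rightarrow> real" and B
    proof (rule integrable_const_bound[where B = B])
      show "AE \<omega> in M. norm (Y n \<omega> * h (C n \<omega>)) \<le> B"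
      proof (rule AE_I2)
        fix \<omega>
        have "\<bar>Y n \<omega>\<bar> * \<bar>h (C n \<omega>)\<bar> \<le> 1 * B" by (intro mult_mono Y that) auto
        thus "norm (Y n \<omega> * h (C n \<omega>)) \<le> B" by (simp add: abs_mult)
      qed
    qed measurable
    have pow: "\<bar>((1/2) ^ i) ^ k\<bar> \<le> (1::real)" for i k by (auto simp: power_le_one power_abs)
    have qb: "\<bar>q k\<bar> \<le> 1 + e'" for k using q[of k] e' by (cases "k = c") auto
    have 1: "expectation (\<lambda>\<omega>. Y n \<omega> * q (C n \<omega>)) = (\<Sum>i\<le>d. a i * expectation (\<lambda>\<omega>. Y n \<omega> * ((1/2) ^ i) ^ C n \<omega>))"
    proof -
      have "expectation (\<lambda>\<omega>. Y n \<omega> * q (C n \<omega>)) = expectation (\<lambda>\<omega>. \<Sum>i\<le>d. a i * (Y n \<omega> * ((1/2) ^ i) ^ C n \<omega>))"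
        by (simp add: q_def sum_distrib_left mult_ac)
      also have "\<dots> = (\<Sum>i\<le>d. expectation (\<lambda>\<omega>. a i * (Y n \<omega> * ((1/2) ^ i) ^ C n \<omega>)))"
        by (rule Bochner_Integration.integral_sum) (intro integrable_mult_right intY[of _ 1] pow)
      finally show ?thesis by simp
    qed
    have 2: "measure_pmf.expectation ?p q = (\<Sum>i\<le>d. a i * exp (- rate n * (1 - (1/2) ^ i)))"
    proof -
      have "measure_pmf.expectation ?p q = measure_pmf.expectation ?p (\<lambda>k. \<Sum>i\<le>d. a i * ((1/2) ^ i) ^ k)"
        by (simp add: q_def[abs_def])
      also have "\<dots> = (\<Sum>i\<le>d. measure_pmf.expectation ?p (\<lambda>k. a i * ((1/2) ^ i) ^ k))"
        by (rule Bochner_Integration.integral_sum)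
          (intro integrable_mult_right measure_pmf.integrable_const_bound[where B = 1], use pow in auto)
      finally show ?thesis using poisson_pgf[OF rate[of n] less_imp_le[OF half(1)] half(2)] by simp
    qed
    have 3: "\<bar>expectation (\<lambda>\<omega>. Y n \<omega> * indicator {c} (C n \<omega>)) - expectation (\<lambda>\<omega>. Y n \<omega> * q (C n \<omega>))\<bar> \<le> e'"
    proof -
      have i: "\<bar>indicator {c} k\<bar> \<le> (1::real)" for k by (auto simp: indicator_def)
      have "expectation (\<lambda>\<omega>. Y n \<omega> * indicator {c} (C n \<omega>)) - expectation (\<lambda>\<omega>. Y n \<omega> * q (C n \<omega>)) =
         expectation (\<lambda>\<omega>. Y n \<omega> * indicator {c} (C n \<omega>) - Y n \<omega> * q (C n \<omega>))"
        by (rule Bochner_Integration.integral_diff[symmetric]) (intro intY[OF i] intY[OF qb])+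
      also have "\<bar>\<dots>\<bar> \<le> expectation (\<lambda>\<omega>. \<bar>Y n \<omega> * indicator {c} (C n \<omega>) - Y n \<omega> * q (C n \<omega>)\<bar>)"
        by (rule integral_abs_bound)
      also have "\<dots> \<le> e'"
      proof (rule integral_le_const)
        show "integrable M (\<lambda>\<omega>. \<bar>Y n \<omega> * indicator {c} (C n \<omega>) - Y n \<omega> * q (C n \<omega>)\<bar>)"
          by (intro integrable_abs Bochner_Integration.integrable_diff intY[OF i] intY[OF qb])
        show "AE \<omega> in M. \<bar>Y n \<omega> * indicator {c} (C n \<omega>) - Y n \<omega> * q (C n \<omega>)\<bar> \<le> e'"
        proof (rule AE_I2)
          fix \<omega>
          have "\<bar>Y n \<omega>\<bar> * \<bar>q (C n \<omega>) - indicator {c} (C n \<omega>)\<bar> \<le> 1 * e'" by (intro mult_mono Y q) auto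
          thus "\<bar>Y n \<omega> * indicator {c} (C n \<omega>) - Y n \<omega> * q (C n \<omega>)\<bar> \<le> e'"
            by (simp add: abs_mult[symmetric] right_diff_distrib abs_minus_commute)
        qed
      qed
      finally show ?thesis .
    qed
    have 4: "\<bar>w n * measure_pmf.expectation ?p q - w n * pmf ?p c\<bar> \<le> e'"
    proof -
      have "pmf ?p c = measure_pmf.expectation ?p (indicator {c})" by (simp add: measure_pmf_single)
      hence "measure_pmf.expectation ?p q - pmf ?p c = measure_pmf.expectation ?p (\<lambda>k. q k - indicator {c} k)"
        by (simp only:) (subst Bochner_Integration.integral_diff; 
          (intro measure_pmf.integrable_const_bound[where B = "1 + e'"])?, use qb e' in \<open>auto simp: indicator_def\<close>)
      also have "\<bar>\<dots>\<bar> \<le> measure_pmf.expectation ?p (\<lambda>k. \<bar>q k - indicator {c} k\<bar>)" by (rule integral_abs_bound)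
      also have "\<dots> \<le> e'"
        by (rule measure_pmf.integral_le_const)
          (intro measure_pmf.integrable_const_bound[where B = e'], use q in auto)
      finally have "\<bar>w n\<bar> * \<bar>measure_pmf.expectation ?p q - pmf ?p c\<bar> \<le> 1 * e'"
        using w[of n] by (intro mult_mono) auto
      thus ?thesis by (simp add: abs_mult[symmetric] right_diff_distrib)
    qed
    have "expectation (\<lambda>\<omega>. Y n \<omega> * q (C n \<omega>)) - w n * measure_pmf.expectation ?p q = D n"
      unfolding 1 2 D_def by (simp add: sum_distrib_left sum_subtractf right_diff_distrib mult_ac)
    thus ?thesis using 3 4 by linarith
  qed
  from D show "\<forall>\<^sub>F n in sequentially. dist (expectation (\<lambda>\<omega>. Y n \<omega> * indicator {c} (C n \<omega>)) - w n * pmf (poisson_pmf (rate n)) c) 0 < e"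
  proof eventually_elim
    case (elim n)
    have "\<bar>D n\<bar> + 2 * e' < e" using elim by (simp add: e'_def)
    thus ?case using bound[of n] by simp
  qed
qed

text \<open>
  The factors \<open>z ^ C\<close> are replaced by indicators one coordinate at a time; the other factors form the
  weight in \<open>geometric_moments_determine_atoms\<close>.
\<close>

lemma poisson_limit_from_pgf:
  fixes C :: "nat \<Rightarrow> 'j \<Rightarrow> 'a \<Rightarrow> nat" and rate :: "nat \<Rightarrow> 'j \<Rightarrow> real"
  assumes J: "finite J"
    and C: "\<And>n j. j \<in> J \<Longrightarrow> C n j \<in> measurable M (count_space UNIV)"
    and rate: "\<And>n j. rate n j > 0"
    and lim: "\<And>z. (\<And>j. 0 < z j \<and> z j \<le> 1) \<Longrightarrow>
      (\<lambda>n. expectation (\<lambda>\<omega>. \<Prod>j\<in>J. z j ^ C n j \<omega>) - (\<Prod>j\<in>J. exp (- rate n j * (1 - z j)))) \<longlonglongrightarrow> 0"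
  shows "(\<lambda>n. prob {\<omega>\<in>space M. \<forall>j\<in>J. C n j \<omega> = c j} - (\<Prod>j\<in>J. pmf (poisson_pmf (rate n j)) (c j))) \<longlonglongrightarrow> 0"
proof -
  have "(\<lambda>n. expectation (\<lambda>\<omega>. (\<Prod>j\<in>S. indicator {c j} (C n j \<omega>)) * (\<Prod>j\<in>J-S. z j ^ C n j \<omega>))
      - (\<Prod>j\<in>S. pmf (poisson_pmf (rate n j)) (c j)) * (\<Prod>j\<in>J-S. exp (- rate n j * (1 - z j)))) \<longlonglongrightarrow> 0"
    if "S \<subseteq> J" "\<And>j. 0 < z j \<and> z j \<le> 1" for S z
    using finite_subset[OF that(1) J] that
  proof (induction S arbitrary: z rule: finite_induct)
    case empty
    thus ?case using lim[of z] by simp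
  next
    case (insert a S)
    define R where "R = J - insert a S"
    have JS: "J - S = insert a R" "a \<notin> R" "finite R" "R \<subseteq> J" "a \<in> J" "S \<subseteq> J" "finite S"
      using insert J by (auto simp: R_def)
    define Y where "Y n \<omega> = (\<Prod>j\<in>S. indicator {c j} (C n j \<omega>)) * (\<Prod>j\<in>R. z j ^ C n j \<omega>)" for n \<omega>
    define w where "w n = (\<Prod>j\<in>S. pmf (poisson_pmf (rate n j)) (c j)) * (\<Prod>j\<in>R. exp (- rate n j * (1 - z j)))" for n
    have "(\<lambda>n. expectation (\<lambda>\<omega>. Y n \<omega> * indicator {c a} (C n a \<omega>)) - w n * pmf (poisson_pmf (rate n a)) (c a)) \<longlonglongrightarrow> 0"
    proof (rule geometric_moments_determine_atoms)
      show "C n a \<in> measurable M (count_space UNIV)" for n using C JS by auto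
      have [measurable]: "C n j \<in> measurable M (count_space UNIV)" if "j \<in> J" for n j using C that .
      show "Y n \<in> borel_measurable M" for n
        unfolding Y_def using JS
        by (intro borel_measurable_times borel_measurable_prod measurable_compose[OF C]) auto
      show "\<bar>Y n \<omega>\<bar> \<le> 1" for n \<omega>
      proof -
        have "(\<Prod>j\<in>S. indicator {c j} (C n j \<omega>)) \<le> (1::real)" "(\<Prod>j\<in>R. z j ^ C n j \<omega>) \<le> 1"
          using insert.prems by (auto intro!: prod_le_1 power_le_one simp: less_imp_le)
        moreover have "(\<Prod>j\<in>S. indicator {c j} (C n j \<omega>)) \<ge> (0::real)" "(\<Prod>j\<in>R. z j ^ C n j \<omega>) \<ge> 0"
          using insert.prems by (auto intro!: prod_nonneg simp: less_imp_le)
        ultimately show ?thesis by (simp add: Y_def abs_mult mult_le_one)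
      qed
      show "\<bar>w n\<bar> \<le> 1" for n
      proof -
        have "(\<Prod>j\<in>S. pmf (poisson_pmf (rate n j)) (c j)) \<le> 1" by (intro prod_le_1) (auto simp del: pmf_poisson simp: pmf_le_1)
        moreover have "(\<Prod>j\<in>R. exp (- rate n j * (1 - z j))) \<le> 1"
          using insert.prems rate by (intro prod_le_1) (auto simp: less_imp_le intro!: mult_nonneg_nonneg)
        moreover have "(\<Prod>j\<in>S. pmf (poisson_pmf (rate n j)) (c j)) \<ge> 0" by (intro prod_nonneg) (auto simp del: pmf_poisson)
        moreover have "(\<Prod>j\<in>R. exp (- rate n j * (1 - z j))) \<ge> 0" by (intro prod_nonneg) auto
        ultimately show ?thesis by (simp add: w_def abs_mult mult_le_one del: pmf_poisson)
      qed
      show "rate n a > 0" for n by (rule rate)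
    next
      fix x :: real assume x: "0 < x" "x \<le> 1"
      define z' where "z' = z(a := x)"
      have z': "\<And>j. 0 < z' j \<and> z' j \<le> 1" using insert.prems x by (auto simp: z'_def)
      have z'a: "z' a = x" by (simp add: z'_def)
      have zR: "(\<Prod>j\<in>R. z' j ^ C n j \<omega>) = (\<Prod>j\<in>R. z j ^ C n j \<omega>)" for n \<omega>
        using JS by (intro prod.cong) (auto simp: z'_def)
      have zR': "(\<Prod>j\<in>R. exp (- (rate n j * (1 - z' j)))) = (\<Prod>j\<in>R. exp (- (rate n j * (1 - z j))))" for n
        using JS by (intro prod.cong) (auto simp: z'_def)
      show "(\<lambda>n. expectation (\<lambda>\<omega>. Y n \<omega> * x ^ C n a \<omega>) - w n * exp (- rate n a * (1 - x))) \<longlonglongrightarrow> 0"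
        using insert.IH[of z', OF JS(6) z'] JS
        by (simp add: zR zR' Y_def w_def z'a mult_ac del: pmf_poisson)
    qed
    thus ?case using JS insert.hyps by (simp add: Y_def w_def R_def[symmetric] mult_ac del: pmf_poisson)
  qed
  from this[of J "\<lambda>_. 1"] have *: "(\<lambda>n. expectation (\<lambda>\<omega>. \<Prod>j\<in>J. indicator {c j} (C n j \<omega>)) - (\<Prod>j\<in>J. pmf (poisson_pmf (rate n j)) (c j))) \<longlonglongrightarrow> 0"
    by simp
  have "expectation (\<lambda>\<omega>. \<Prod>j\<in>J. indicator {c j} (C n j \<omega>)) = prob {\<omega>\<in>space M. \<forall>j\<in>J. C n j \<omega> = c j}" for n
  proof -
    have [measurable]: "C n j \<in> measurable M (count_space UNIV)" if "j \<in> J" for j using C that .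
    have "expectation (\<lambda>\<omega>. \<Prod>j\<in>J. indicator {c j} (C n j \<omega>)) = expectation (indicator {\<omega>\<in>space M. \<forall>j\<in>J. C n j \<omega> = c j} :: 'a \<Rightarrow> real)"
    proof (rule Bochner_Integration.integral_cong[OF refl])
      fix \<omega> assume "\<omega> \<in> space M"
      show "(\<Prod>j\<in>J. indicator {c j} (C n j \<omega>)) = (indicator {\<omega>\<in>space M. \<forall>j\<in>J. C n j \<omega> = c j} \<omega> :: real)"
      proof (cases "\<forall>j\<in>J. C n j \<omega> = c j")
        case False
        hence "(\<Prod>j\<in>J. indicator {c j} (C n j \<omega>)) = (0::real)"
          using J by (intro prod_zero) (auto simp: indicator_def)
        thus ?thesis using False by simp
      next
        case True
        hence "(\<Prod>j\<in>J. indicator {c j} (C n j \<omega>)) = (1::real)"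
          by (intro prod.neutral) (auto simp: indicator_def)
        thus ?thesis using True \<open>\<omega> \<in> space M\<close> by simp
      qed
    qed
    moreover have "{\<omega>\<in>space M. \<forall>j\<in>J. C n j \<omega> = c j} \<in> sets M"
    proof -
      have "{\<omega>\<in>space M. C n j \<omega> = c j} \<in> sets M" if "j \<in> J" for j 
        using measurable_sets[OF C[OF that, of n], of "{c j}"] by (simp add: vimage_def Int_def conj_commute)
      thus ?thesis using J by (intro sets.sets_Collect_finite_All) auto
    qed
    ultimately show ?thesis by (simp add: Int_absorb2 Collect_restrict)
  qed
  thus ?thesis using * by simp
qed

text \<open>
  Every trial contributes a factor \<open>\<Prod>j. (if Z \<in> E j then z j else 1)\<close> to the joint generating
  function of the counts. Where no two events overlap this factor is linear in the indicators, so its expectation is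
  \<open>1 - \<lambda> / n\<close> up to errors whose sum over the trials tends to zero. By independence the
  generating function is the product of these expectations, and it is compared factor by factor with
  \<open>exp (- \<lambda> / n)\<close>.
\<close>

theorem rare_events_poisson_limit:
  fixes Z :: "nat \<Rightarrow> nat \<Rightarrow> 'a \<Rightarrow> 'b" and E :: "nat \<Rightarrow> 'j \<Rightarrow> 'b set" and rate :: "nat \<Rightarrow> 'j \<Rightarrow> real"
  assumes J: "finite J"
    and ind: "\<And>n. indep_vars (\<lambda>_. S) (Z n) {1..n}"
    and E: "\<And>n j. j \<in> J \<Longrightarrow> E n j \<in> sets S"
    and rate: "\<And>n j. 0 < rate n j" "\<And>n j. j \<in> J \<Longrightarrow> rate n j \<le> B"
    and p: "\<And>j. j \<in> J \<Longrightarrow> (\<lambda>n. \<Sum>i\<in>{1..n}. \<bar>prob (Z n i -` E n j \<inter> space M) - rate n j / real n\<bar>) \<longlonglongrightarrow> 0"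
    and overlap: "\<And>j j'. j \<in> J \<Longrightarrow> j' \<in> J \<Longrightarrow> j \<noteq> j' \<Longrightarrow>
       (\<lambda>n. \<Sum>i\<in>{1..n}. prob (Z n i -` (E n j \<inter> E n j') \<inter> space M)) \<longlonglongrightarrow> 0"
  shows "(\<lambda>n. prob {\<omega>\<in>space M. \<forall>j\<in>J. card {i\<in>{1..n}. Z n i \<omega> \<in> E n j} = c j}
     - (\<Prod>j\<in>J. pmf (poisson_pmf (rate n j)) (c j))) \<longlonglongrightarrow> 0"
proof (rule poisson_limit_from_pgf[OF J])
  have Zm: "Z n i \<in> measurable M S" if "i \<in> {1..n}" for n i
    using ind[of n] that by (auto simp: indep_vars_def)
  have Zset: "Z n i -` A \<inter> space M \<in> sets M" if "i \<in> {1..n}" "A \<in> sets S" for n i A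
    using Zm that by (auto intro: measurable_sets)
  have card_sum: "card {i\<in>{1..n}. Z n i \<omega> \<in> A} = (\<Sum>i\<in>{1..n}. if Z n i \<omega> \<in> A then 1 else 0)" for n A \<omega>
    by (simp add: sum.If_cases Int_def conj_commute)
  show "(\<lambda>\<omega>. card {i\<in>{1..n}. Z n i \<omega> \<in> E n j}) \<in> measurable M (count_space UNIV)" if "j \<in> J" for n j
    unfolding card_sum
  proof (rule measurable_sum_nat)
    fix i assume "i \<in> {1..n}"
    thus "(\<lambda>\<omega>. if Z n i \<omega> \<in> E n j then 1 else 0) \<in> measurable M (count_space UNIV)"
      using Zset[OF _ E[OF that]] by (intro measurable_If) (auto simp: vimage_def Int_def conj_commute)
  qed
  show "0 < rate n j" for n j by (rule rate)
  fix z :: "'j \<Rightarrow> real" assume z: "\<And>j. 0 < z j \<and> z j \<le> 1"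
  define h where "h n x = (\<Prod>j\<in>J. if x \<in> E n j then z j else 1)" for n x
  define W where "W n i \<omega> = h n (Z n i \<omega>)" for n i \<omega>
  define lam where "lam n = (\<Sum>j\<in>J. rate n j * (1 - z j))" for n
  define q where "q n i = 1 - expectation (W n i)" for n i
  define pr where "pr n i j = prob (Z n i -` E n j \<inter> space M)" for n i j
  define offdiag where "offdiag = {(j,j'). j\<in>J \<and> j'\<in>J \<and> j\<noteq>j'}"
  define ov where "ov n i = (\<Sum>(j,j')\<in>offdiag. prob (Z n i -` (E n j \<inter> E n j') \<inter> space M))" for n i
  have offdiag: "finite offdiag" unfolding offdiag_def by (rule finite_subset[of _ "J \<times> J"]) (use J in auto)
  have h01: "0 \<le> h n x" "h n x \<le> 1" for n x
    using z unfolding h_def by (auto intro!: prod_nonneg prod_le_1 simp: less_imp_le)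
  have hm: "h n \<in> borel_measurable S" for n
    unfolding h_def using E by (intro borel_measurable_prod measurable_If) auto
  have h_lin: "\<bar>h n x - (1 - (\<Sum>j\<in>J. (1 - z j) * indicator (E n j) x))\<bar>
      \<le> (1 + real (card J)) * (\<Sum>(j,j')\<in>offdiag. indicator (E n j \<inter> E n j') x)" for n x
  proof (cases "\<exists>j\<in>J. \<exists>j'\<in>J. j \<noteq> j' \<and> x \<in> E n j \<inter> E n j'")
    case True
    then obtain j j' where jj: "(j,j') \<in> offdiag" "x \<in> E n j \<inter> E n j'" by (auto simp: offdiag_def)
    have "indicator (E n j \<inter> E n j') x \<le> (\<Sum>(j,j')\<in>offdiag. indicator (E n j \<inter> E n j') x :: real)"
      using member_le_sum[of "(j,j')" offdiag "\<lambda>(j,j'). indicator (E n j \<inter> E n j') x :: real"] jj offdiag by auto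
    hence 1: "1 \<le> (\<Sum>(j,j')\<in>offdiag. indicator (E n j \<inter> E n j') x :: real)" using jj by simp
    have "(\<Sum>j\<in>J. (1 - z j) * indicator (E n j) x) \<le> (\<Sum>j\<in>J. 1)"
      by (intro sum_mono) (use z in \<open>auto simp: indicator_def less_imp_le\<close>)
    moreover have "(\<Sum>j\<in>J. (1 - z j) * indicator (E n j) x) \<ge> 0"
      by (intro sum_nonneg) (use z in \<open>auto simp: indicator_def less_imp_le\<close>)
    ultimately have "\<bar>h n x - (1 - (\<Sum>j\<in>J. (1 - z j) * indicator (E n j) x))\<bar> \<le> 1 + real (card J)"
      using h01[of n x] by simp
    also have "\<dots> \<le> (1 + real (card J)) * (\<Sum>(j,j')\<in>offdiag. indicator (E n j \<inter> E n j') x)"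
      using mult_left_mono[OF 1, of "1 + real (card J)"] by simp
    finally show ?thesis .
  next
    case False
    have "h n x = 1 - (\<Sum>j\<in>J. (1 - z j) * indicator (E n j) x)"
    proof (cases "\<exists>j\<in>J. x \<in> E n j")
      case True
      then obtain j where j: "j \<in> J" "x \<in> E n j" by blast
      have o: "x \<notin> E n i" if "i \<in> J - {j}" for i using False j that by auto
      have "h n x = z j * (\<Prod>i\<in>J-{j}. if x \<in> E n i then z i else 1)"
        unfolding h_def using j J by (subst prod.remove[of _ j]) auto
      also have "(\<Prod>i\<in>J-{j}. if x \<in> E n i then z i else 1) = 1" using o by (intro prod.neutral) auto
      also have "z j * 1 = 1 - ((1 - z j) * indicator (E n j) x + (\<Sum>i\<in>J-{j}. (1 - z i) * indicator (E n i) x))"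
        using j o by simp
      also have "\<dots> = 1 - (\<Sum>j\<in>J. (1 - z j) * indicator (E n j) x)"
        using j J by (subst sum.remove[of J j]) auto
      finally show ?thesis .
    qed (auto simp: h_def)
    thus ?thesis by (auto intro!: mult_nonneg_nonneg sum_nonneg)
  qed
  have Wm: "W n i \<in> borel_measurable M" if "i \<in> {1..n}" for n i
    unfolding W_def by (rule measurable_compose[OF Zm[OF that] hm])
  have Wint: "integrable M (W n i)" if "i \<in> {1..n}" for n i
    by (rule integrable_const_bound[where B = 1]) (use Wm[OF that] h01 in \<open>auto simp: W_def\<close>)
  have qbound: "\<bar>q n i - lam n / real n\<bar> \<le> (\<Sum>j\<in>J. \<bar>pr n i j - rate n j / real n\<bar>) + (1 + real (card J)) * ov n i"
    if i: "i \<in> {1..n}" for n i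
  proof -
    have ind_int: "integrable M (\<lambda>\<omega>. indicator A (Z n i \<omega>) :: real)" 
      and ind_eq: "expectation (\<lambda>\<omega>. indicator A (Z n i \<omega>)) = prob (Z n i -` A \<inter> space M)" if "A \<in> sets S" for A
    proof -
      have "expectation (\<lambda>\<omega>. indicator A (Z n i \<omega>)) = expectation (indicator (Z n i -` A \<inter> space M))"
        by (intro Bochner_Integration.integral_cong) (auto simp: indicator_def)
      also have "\<dots> = prob (Z n i -` A \<inter> space M)"
        by (simp add: Int_assoc)
      finally show "expectation (\<lambda>\<omega>. indicator A (Z n i \<omega>)) = prob (Z n i -` A \<inter> space M)" .
      have "(\<lambda>\<omega>. indicator A (Z n i \<omega>) :: real) \<in> borel_measurable M"
        using measurable_compose[OF Zm[OF i] borel_measurable_indicator[OF that]] .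
      thus "integrable M (\<lambda>\<omega>. indicator A (Z n i \<omega>) :: real)"
        by (intro integrable_const_bound[where B = 1]) (auto simp: indicator_def)
    qed
    have EE: "E n j \<inter> E n j' \<in> sets S" if "(j,j') \<in> offdiag" for j j'
      using E[of j n] E[of j' n] that by (auto simp: offdiag_def)
    define lin where "lin \<omega> = 1 - (\<Sum>j\<in>J. (1 - z j) * indicator (E n j) (Z n i \<omega>))" for \<omega>
    have lin_int: "integrable M lin"
      unfolding lin_def by (intro Bochner_Integration.integrable_diff Bochner_Integration.integrable_sum integrable_mult_right ind_int E) auto
    have lin_eq: "expectation lin = 1 - (\<Sum>j\<in>J. (1 - z j) * pr n i j)"
    proof -
      have "expectation lin = 1 - expectation (\<lambda>\<omega>. \<Sum>j\<in>J. (1 - z j) * indicator (E n j) (Z n i \<omega>))"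
        unfolding lin_def
        by (subst Bochner_Integration.integral_diff)
           (auto intro!: Bochner_Integration.integrable_sum integrable_mult_right ind_int E simp: prob_space)
      also have "expectation (\<lambda>\<omega>. \<Sum>j\<in>J. (1 - z j) * indicator (E n j) (Z n i \<omega>)) = (\<Sum>j\<in>J. expectation (\<lambda>\<omega>. (1 - z j) * indicator (E n j) (Z n i \<omega>)))"
        by (rule Bochner_Integration.integral_sum) (intro integrable_mult_right ind_int E)
      finally show ?thesis by (simp add: ind_eq[OF E] pr_def)
    qed
    have "\<bar>expectation (W n i) - expectation lin\<bar> = \<bar>expectation (\<lambda>\<omega>. W n i \<omega> - lin \<omega>)\<bar>"
      by (subst Bochner_Integration.integral_diff[OF Wint[OF i] lin_int]) simp
    also have "\<dots> \<le> expectation (\<lambda>\<omega>. \<bar>W n i \<omega> - lin \<omega>\<bar>)" by (rule integral_abs_bound)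
    also have "\<dots> \<le> expectation (\<lambda>\<omega>. (1 + real (card J)) * (\<Sum>(j,j')\<in>offdiag. indicator (E n j \<inter> E n j') (Z n i \<omega>)))"
    proof (rule integral_mono)
      show "integrable M (\<lambda>\<omega>. \<bar>W n i \<omega> - lin \<omega>\<bar>)"
        by (intro integrable_abs Bochner_Integration.integrable_diff Wint i lin_int)
      show "integrable M (\<lambda>\<omega>. (1 + real (card J)) * (\<Sum>(j,j')\<in>offdiag. indicator (E n j \<inter> E n j') (Z n i \<omega>)))"
        by (intro integrable_mult_right Bochner_Integration.integrable_sum) (auto split: prod.split intro!: ind_int EE)
      show "\<bar>W n i \<omega> - lin \<omega>\<bar> \<le> (1 + real (card J)) * (\<Sum>(j,j')\<in>offdiag. indicator (E n j \<inter> E n j') (Z n i \<omega>))" for \<omega>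
        unfolding W_def lin_def by (rule h_lin)
    qed
    also have "\<dots> = (1 + real (card J)) * (\<Sum>(j,j')\<in>offdiag. expectation (\<lambda>\<omega>. indicator (E n j \<inter> E n j') (Z n i \<omega>)))"
      unfolding integral_mult_right_zero case_prod_beta
      by (subst Bochner_Integration.integral_sum) (auto intro!: ind_int EE)
    also have "\<dots> = (1 + real (card J)) * ov n i"
      unfolding ov_def by (intro arg_cong2[where f = "(*)"] refl sum.cong) (auto simp: ind_eq EE)
    finally have 1: "\<bar>expectation (W n i) - expectation lin\<bar> \<le> (1 + real (card J)) * ov n i" .
    have "\<bar>(\<Sum>j\<in>J. (1 - z j) * pr n i j) - lam n / real n\<bar> = \<bar>\<Sum>j\<in>J. (1 - z j) * (pr n i j - rate n j / real n)\<bar>"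
      by (simp add: lam_def sum_divide_distrib sum_subtractf[symmetric] algebra_simps)
    also have "\<dots> \<le> (\<Sum>j\<in>J. \<bar>(1 - z j) * (pr n i j - rate n j / real n)\<bar>)" by (rule sum_abs)
    also have "\<dots> \<le> (\<Sum>j\<in>J. \<bar>pr n i j - rate n j / real n\<bar>)"
      by (intro sum_mono) (use z in \<open>auto simp: abs_mult less_imp_le intro!: mult_left_le_one_le\<close>)
    finally show ?thesis using 1 unfolding q_def lin_eq by linarith
  qed
  have lam0: "0 \<le> lam n" for n
    unfolding lam_def using rate(1)[of n] z by (intro sum_nonneg mult_nonneg_nonneg) (auto simp: less_imp_le)
  have lamB: "lam n \<le> card J * B" for n
  proof -
    have "lam n \<le> (\<Sum>j\<in>J. B)" unfolding lam_def
    proof (rule sum_mono)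
      fix j assume "j \<in> J"
      have "rate n j * (1 - z j) \<le> rate n j * 1" using z[of j] rate(1)[of n j] by (intro mult_left_mono) (auto simp: less_imp_le)
      thus "rate n j * (1 - z j) \<le> B" using rate(2)[OF \<open>j \<in> J\<close>, of n] by simp
    qed
    thus ?thesis by simp
  qed
  have pgf: "expectation (\<lambda>\<omega>. \<Prod>j\<in>J. z j ^ card {i\<in>{1..n}. Z n i \<omega> \<in> E n j}) = (\<Prod>i\<in>{1..n}. 1 - q n i)" for n
  proof -
    have "(\<Prod>j\<in>J. z j ^ card {i\<in>{1..n}. Z n i \<omega> \<in> E n j}) = (\<Prod>i\<in>{1..n}. W n i \<omega>)" for \<omega>
      unfolding W_def h_def
      by (subst prod.swap) (simp add: prod.If_cases Int_def conj_commute)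
    hence "expectation (\<lambda>\<omega>. \<Prod>j\<in>J. z j ^ card {i\<in>{1..n}. Z n i \<omega> \<in> E n j}) = expectation (\<lambda>\<omega>. \<Prod>i\<in>{1..n}. W n i \<omega>)" by simp
    also have "\<dots> = (\<Prod>i\<in>{1..n}. expectation (W n i))"
    proof (rule indep_vars_lebesgue_integral)
      show "indep_vars (\<lambda>_. borel) (W n) {1..n}"
        unfolding W_def using indep_vars_compose2[OF ind hm] .
    qed (auto intro: Wint)
    finally show ?thesis by (simp add: q_def)
  qed
  show "(\<lambda>n. expectation (\<lambda>\<omega>. \<Prod>j\<in>J. z j ^ card {i\<in>{1..n}. Z n i \<omega> \<in> E n j})
      - (\<Prod>j\<in>J. exp (- rate n j * (1 - z j)))) \<longlonglongrightarrow> 0"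
  proof (rule Lim_null_comparison)
    let ?K = "card J * B"
    let ?bd = "\<lambda>n. (\<Sum>i\<in>{1..n}. (\<Sum>j\<in>J. \<bar>pr n i j - rate n j / real n\<bar>) + (1 + real (card J)) * ov n i) + ?K\<^sup>2 / real n"
    show "\<forall>\<^sub>F n in sequentially. norm (expectation (\<lambda>\<omega>. \<Prod>j\<in>J. z j ^ card {i\<in>{1..n}. Z n i \<omega> \<in> E n j})
      - (\<Prod>j\<in>J. exp (- rate n j * (1 - z j)))) \<le> ?bd n"
      using eventually_gt_at_top[of 0]
    proof eventually_elim
      case (elim n)
      have q01: "0 \<le> q n i" "q n i \<le> 1" if "i \<in> {1..n}" for i
      proof -
        show "0 \<le> q n i" unfolding q_def using Wint[OF that]
          by (simp add: integral_le_const W_def h01)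
        show "q n i \<le> 1" unfolding q_def using h01 by (simp add: W_def)
      qed
      have e: "(\<Prod>j\<in>J. exp (- rate n j * (1 - z j))) = (\<Prod>i\<in>{1..n}. exp (- (lam n / real n)))"
      proof -
        have "(\<Prod>j\<in>J. exp (- rate n j * (1 - z j))) = exp (- lam n)"
          using J by (simp add: exp_sum[symmetric] lam_def sum_negf)
        also have "\<dots> = exp (real n * (- (lam n / real n)))" using elim by simp
        also have "\<dots> = (\<Prod>i\<in>{1..n}. exp (- (lam n / real n)))" by (subst exp_of_nat_mult) simp
        finally show ?thesis .
      qed
      have ln0: "0 \<le> lam n / real n" using lam0 by simp
      have "norm ((\<Prod>i\<in>{1..n}. 1 - q n i) - (\<Prod>i\<in>{1..n}. exp (- (lam n / real n))))
         \<le> (\<Sum>i\<in>{1..n}. norm ((1 - q n i) - exp (- (lam n / real n))))"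
        using q01 ln0 by (intro norm_prod_diff) auto
      also have "\<dots> \<le> (\<Sum>i\<in>{1..n}. \<bar>q n i - lam n / real n\<bar> + (lam n / real n)\<^sup>2)"
      proof (rule sum_mono)
        fix i
        have "1 - lam n / real n \<le> exp (- (lam n / real n))" 
          using exp_ge_add_one_self[of "- (lam n / real n)"] by simp
        moreover have "exp (- (lam n / real n)) \<le> 1 - lam n / real n + (lam n / real n)\<^sup>2"
        proof -
          have gen: "exp (- x) \<le> 1 - x + x\<^sup>2" if x: "0 \<le> x" for x :: real
          proof -
            have "exp (- x) = 1 / exp x" by (simp add: exp_minus field_simps)
            also have "\<dots> \<le> 1 / (1 + x)" using x exp_ge_add_one_self[of x] by (intro divide_left_mono) auto
            also have "\<dots> \<le> 1 - x + x\<^sup>2"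
            proof -
              have "(1 - x + x\<^sup>2) * (1 + x) = 1 + x ^ 3" by (simp add: algebra_simps power2_eq_square power3_eq_cube)
              hence "1 \<le> (1 - x + x\<^sup>2) * (1 + x)" using x by simp
              thus ?thesis using x by (simp add: pos_divide_le_eq)
            qed
            finally show ?thesis .
          qed
          show ?thesis by (rule gen[OF ln0])
        qed
        ultimately show "norm ((1 - q n i) - exp (- (lam n / real n))) \<le> \<bar>q n i - lam n / real n\<bar> + (lam n / real n)\<^sup>2"
          unfolding real_norm_def by linarith
      qed
      also have "\<dots> = (\<Sum>i\<in>{1..n}. \<bar>q n i - lam n / real n\<bar>) + (lam n)\<^sup>2 / real n"
        using elim by (simp add: sum.distrib power2_eq_square)
      also have "\<dots> \<le> (\<Sum>i\<in>{1..n}. (\<Sum>j\<in>J. \<bar>pr n i j - rate n j / real n\<bar>) + (1 + real (card J)) * ov n i) + ?K\<^sup>2 / real n"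
        using lam0 lamB by (intro add_mono sum_mono qbound divide_right_mono power_mono) auto
      finally show ?case unfolding pgf e .
    qed
    have pl: "(\<lambda>n. \<Sum>i\<in>{1..n}. \<Sum>j\<in>J. \<bar>pr n i j - rate n j / real n\<bar>) \<longlonglongrightarrow> 0"
      by (subst sum.swap) (rule tendsto_null_sum, use p in \<open>simp add: pr_def\<close>)
    have ol: "(\<lambda>n. \<Sum>i\<in>{1..n}. ov n i) \<longlonglongrightarrow> 0"
      unfolding ov_def
      by (subst sum.swap) (rule tendsto_null_sum, use overlap in \<open>auto simp: offdiag_def\<close>)
    have "(\<lambda>n. (\<Sum>i\<in>{1..n}. \<Sum>j\<in>J. \<bar>pr n i j - rate n j / real n\<bar>) + (1 + real (card J)) * (\<Sum>i\<in>{1..n}. ov n i) + ?K\<^sup>2 / real n)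
       \<longlonglongrightarrow> 0 + (1 + real (card J)) * 0 + 0"
      by (intro tendsto_intros pl ol lim_const_over_n)
    thus "?bd \<longlonglongrightarrow> 0" by (simp add: sum.distrib sum_distrib_left)
  qed
qed

end

section \<open>Paths, the hitting time and order statistics\<close>

text \<open>
  In a decreasing list the entries above \<open>v\<close> form an initial segment.
\<close>

lemma rev_sort_nth_le_iff:
  fixes xs :: "'a::linorder list"
  assumes "i < length xs"
  shows "rev (sort xs) ! i \<le> v \<longleftrightarrow> length (filter (\<lambda>x. v < x) xs) \<le> i"
proof -
  define ys where "ys = rev (sort xs)"
  have ys: "sorted (rev ys)" "length ys = length xs" "mset ys = mset xs" by (auto simp: ys_def)
  have "length (filter (\<lambda>x. v < x) xs) = length (filter (\<lambda>x. v < x) ys)"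
    by (rule mset_eq_length) (simp add: ys(3))
  also have "filter (\<lambda>x. v < x) ys = takeWhile (\<lambda>x. v < x) ys"
    using filter_equals_takeWhile_sorted_rev[of "\<lambda>x. x" ys v] ys(1) by simp
  finally have len: "length (filter (\<lambda>x. v < x) xs) = length (takeWhile (\<lambda>x. v < x) ys)" .
  have "v < ys ! i \<longleftrightarrow> i < length (takeWhile (\<lambda>x. v < x) ys)"
  proof
    assume v: "v < ys ! i"
    have "v < ys ! j" if "j < Suc i" for j
      using sorted_rev_nth_mono[OF ys(1), of j i] that v assms ys(2) by auto
    hence "Suc i \<le> length (takeWhile (\<lambda>x. v < x) ys)"
      using assms ys(2) by (intro length_takeWhile_less_P_nth) auto
    thus "i < length (takeWhile (\<lambda>x. v < x) ys)" by simp
  next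
    assume i: "i < length (takeWhile (\<lambda>x. v < x) ys)"
    hence "takeWhile (\<lambda>x. v < x) ys ! i \<in> set (takeWhile (\<lambda>x. v < x) ys)" by (rule nth_mem)
    thus "v < ys ! i" using i by (auto dest: set_takeWhileD simp: takeWhile_nth)
  qed
  thus ?thesis unfolding len ys_def[symmetric] by (simp add: not_less[symmetric])
qed

lemma order_stat_le_iff:
  assumes "1 \<le> i" "i \<le> n"
  shows "int (order_stat N n i t \<omega>) \<le> z \<longleftrightarrow> card {j\<in>{1..n}. z < int (N j t \<omega>)} \<le> i - 1"
proof (cases "z < 0")
  case True
  hence "{j\<in>{1..n}. z < int (N j t \<omega>)} = {1..n}" by auto
  thus ?thesis using True assms by auto
next
  case False
  define v where "v = nat z"
  have z: "z = int v" using False by (simp add: v_def)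
  have "length (filter (\<lambda>x. v < x) (map (\<lambda>j. N j t \<omega>) [1..<Suc n])) = card {j\<in>{1..n}. v < N j t \<omega>}"
  proof -
    have "length (filter (\<lambda>x. v < x) (map (\<lambda>j. N j t \<omega>) [1..<Suc n])) = card (set (filter (\<lambda>j. v < N j t \<omega>) [1..<Suc n]))"
      unfolding filter_map length_map comp_def by (rule distinct_card[symmetric]) (simp del: upt_Suc)
    also have "set (filter (\<lambda>j. v < N j t \<omega>) [1..<Suc n]) = {j\<in>{1..n}. v < N j t \<omega>}"
      unfolding set_filter set_upt by auto
    finally show ?thesis .
  qed
  thus ?thesis
    using rev_sort_nth_le_iff[of "i - 1" "map (\<lambda>j. N j t \<omega>) [1..<Suc n]" v] assms
    by (simp add: order_stat_def z del: upt_Suc)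
qed

lemma card_filter_eq_sum:
  "finite A \<Longrightarrow> card {i\<in>A. P i} = (\<Sum>i\<in>A. if P i then 1 else 0)"
  by (simp add: sum.If_cases Int_def conj_commute)

lemma unit_poisson_processD:
  assumes "unit_poisson_process M X"
  shows "0 \<le> t \<Longrightarrow> X t \<in> measurable M (count_space UNIV)"
    and "\<omega> \<in> space M \<Longrightarrow> X 0 \<omega> = 0"
    and "0 \<le> s \<Longrightarrow> s < t \<Longrightarrow> distr M (count_space UNIV) (\<lambda>\<omega>. X t \<omega> - X s \<omega>) = measure_pmf (poisson_pmf (t - s))"
    and "\<omega> \<in> space M \<Longrightarrow> mono_on {0..} (\<lambda>t. X t \<omega>)"
    and "\<omega> \<in> space M \<Longrightarrow> 0 \<le> t \<Longrightarrow> continuous (at_right t) (\<lambda>s. X s \<omega>)"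
    and "0 \<le> u 0 \<Longrightarrow> incseq u \<Longrightarrow>
      prob_space.indep_vars M (\<lambda>_. count_space UNIV) (\<lambda>j \<omega>. X (u (Suc j)) \<omega> - X (u j) \<omega>) {..<k}"
proof -
  note X = assms[unfolded unit_poisson_process_def]
  note X1 = X[THEN conjunct1] and X2 = X[THEN conjunct2, THEN conjunct1]
    and X3 = X[THEN conjunct2, THEN conjunct2, THEN conjunct1]
    and X4 = X[THEN conjunct2, THEN conjunct2, THEN conjunct2]
  show "0 \<le> t \<Longrightarrow> X t \<in> measurable M (count_space UNIV)" using X1 by blast
  show "\<omega> \<in> space M \<Longrightarrow> X 0 \<omega> = 0" using X2 by blast
  show "\<omega> \<in> space M \<Longrightarrow> mono_on {0..} (\<lambda>t. X t \<omega>)" using X2 by blast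
  show "\<omega> \<in> space M \<Longrightarrow> 0 \<le> t \<Longrightarrow> continuous (at_right t) (\<lambda>s. X s \<omega>)" using X2 by blast
  show "0 \<le> s \<Longrightarrow> s < t \<Longrightarrow> distr M (count_space UNIV) (\<lambda>\<omega>. X t \<omega> - X s \<omega>) = measure_pmf (poisson_pmf (t - s))"
    by (rule X3[rule_format]) simp
  show "0 \<le> u 0 \<Longrightarrow> incseq u \<Longrightarrow>
      prob_space.indep_vars M (\<lambda>_. count_space UNIV) (\<lambda>j \<omega>. X (u (Suc j)) \<omega> - X (u j) \<omega>) {..<k}"
    by (rule X4[rule_format]) simp
qed

text \<open>
  A single outcome, together with the path properties that hold for it; everything about the hitting time is
  deterministic at this level.
\<close>

locale poisson_paths =
  fixes N :: "nat \<Rightarrow> real \<Rightarrow> 'w \<Rightarrow> nat" and \<omega> :: 'w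
  assumes N_mono: "i \<ge> 1 \<Longrightarrow> 0 \<le> s \<Longrightarrow> s \<le> t \<Longrightarrow> N i s \<omega> \<le> N i t \<omega>"
    and N_right_cont: "i \<ge> 1 \<Longrightarrow> 0 \<le> t \<Longrightarrow> continuous (at_right t) (\<lambda>s. N i s \<omega>)"
begin

lemma constant_to_the_right:
  assumes "0 \<le> t"
  obtains u where "u > t" "\<And>i s. i \<in> {1..n} \<Longrightarrow> t \<le> s \<Longrightarrow> s < u \<Longrightarrow> N i s \<omega> = N i t \<omega>"
proof -
  have "\<forall>\<^sub>F s in at_right t. N i s \<omega> = N i t \<omega>" if "i \<in> {1..n}" for i
    using N_right_cont[of i t] that assms unfolding continuous_within tendsto_discrete by simp
  hence "\<forall>\<^sub>F s in at_right t. \<forall>i\<in>{1..n}. N i s \<omega> = N i t \<omega>"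
    by (intro eventually_ball_finite) auto
  then obtain u where "u > t" "\<And>s. t < s \<Longrightarrow> s < u \<Longrightarrow> \<forall>i\<in>{1..n}. N i s \<omega> = N i t \<omega>"
    by (auto simp: eventually_at_right_field)
  thus thesis using that[of u] by (metis le_less)
qed

lemma low_count_antimono:
  assumes "0 \<le> s" "s \<le> t"
  shows "card {i\<in>{1..n}. \<not> m < N i t \<omega>} \<le> card {i\<in>{1..n}. \<not> m < N i s \<omega>}"
proof (rule card_mono)
  show "{i\<in>{1..n}. \<not> m < N i t \<omega>} \<subseteq> {i\<in>{1..n}. \<not> m < N i s \<omega>}"
    using N_mono[OF _ assms] by (auto simp: not_less intro: order.trans)
qed simp

lemma high_count_mono:
  assumes "0 \<le> s" "s \<le> t"
  shows "card {i\<in>{1..n}. z < int (N i s \<omega>)} \<le> card {i\<in>{1..n}. z < int (N i t \<omega>)}"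
proof (rule card_mono)
  have "z < int (N i t \<omega>)" if "i \<in> {1..n}" "z < int (N i s \<omega>)" for i
    using N_mono[OF _ assms, of i] that by simp
  thus "{i\<in>{1..n}. z < int (N i s \<omega>)} \<subseteq> {i\<in>{1..n}. z < int (N i t \<omega>)}" by blast
qed simp

text \<open>
  The set of admissible times is closed upwards by monotonicity and contains its infimum by right-continuity, so the
  least element exists.
\<close>

lemma hitting_time_attained:
  assumes ex: "\<exists>t\<ge>0. card {i\<in>{1..n}. \<not> N i t \<omega> > m} \<le> l"
  shows "0 \<le> hitting_time N m l n \<omega>"
    and "0 \<le> t \<Longrightarrow> hitting_time N m l n \<omega> \<le> t \<longleftrightarrow> card {i\<in>{1..n}. \<not> N i t \<omega> > m} \<le> l"
proof -
  define T where "T = {t. 0 \<le> t \<and> card {i\<in>{1..n}. \<not> N i t \<omega> > m} \<le> l}"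
  have T: "T \<noteq> {}" "bdd_below T" using ex by (auto simp: T_def intro!: bdd_belowI[of _ 0])
  have I0: "0 \<le> Inf T" using T by (intro cInf_greatest) (auto simp: T_def)
  have "Inf T \<in> T"
  proof -
    obtain u where u: "u > Inf T" "\<And>i s. i \<in> {1..n} \<Longrightarrow> Inf T \<le> s \<Longrightarrow> s < u \<Longrightarrow> N i s \<omega> = N i (Inf T) \<omega>"
      by (rule constant_to_the_right[OF I0, where n = n]) (rule that; blast)
    obtain s where s: "s \<in> T" "s < u" using u(1) T by (meson cInf_lessD)
    have "Inf T \<le> s" using s T by (intro cInf_lower)
    hence "{i\<in>{1..n}. \<not> N i (Inf T) \<omega> > m} = {i\<in>{1..n}. \<not> N i s \<omega> > m}"
      using u(2)[OF _ _ s(2)] by (intro Collect_cong conj_cong refl) metis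
    thus ?thesis using s I0 by (simp add: T_def)
  qed
  have "hitting_time N m l n \<omega> = (LEAST t. t \<in> T)"
    using ex by (simp add: hitting_time_def T_def)
  also have "\<dots> = Inf T"
    using \<open>Inf T \<in> T\<close> T by (intro Least_equality cInf_lower)
  finally have h: "hitting_time N m l n \<omega> = Inf T" .
  show "0 \<le> hitting_time N m l n \<omega>" using I0 h by simp
  show "hitting_time N m l n \<omega> \<le> t \<longleftrightarrow> card {i\<in>{1..n}. \<not> N i t \<omega> > m} \<le> l" if t: "0 \<le> t"
  proof
    assume "hitting_time N m l n \<omega> \<le> t"
    hence "card {i\<in>{1..n}. \<not> N i t \<omega> > m} \<le> card {i\<in>{1..n}. \<not> N i (Inf T) \<omega> > m}"
      using low_count_antimono[OF I0] h by simp
    thus "card {i\<in>{1..n}. \<not> N i t \<omega> > m} \<le> l" using \<open>Inf T \<in> T\<close> by (simp add: T_def)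
  next
    assume "card {i\<in>{1..n}. \<not> N i t \<omega> > m} \<le> l"
    thus "hitting_time N m l n \<omega> \<le> t" unfolding h using T t by (intro cInf_lower) (auto simp: T_def)
  qed
qed

lemma hitting_time_nonneg: "0 \<le> hitting_time N m l n \<omega>"
  using hitting_time_attained(1)[of n m l] by (cases "\<exists>t\<ge>0. card {i\<in>{1..n}. \<not> N i t \<omega> > m} \<le> l") (auto simp: hitting_time_def)

text \<open>
  The second alternative describes the outcomes for which the hitting time has its default value \<open>0\<close>; by
  monotonicity it suffices to look at integer times.
\<close>

lemma hitting_time_le_iff:
  assumes "0 \<le> t"
  shows "hitting_time N m l n \<omega> \<le> t \<longleftrightarrow> card {i\<in>{1..n}. \<not> N i t \<omega> > m} \<le> l
     \<or> (\<forall>k::nat. \<not> card {i\<in>{1..n}. \<not> N i (real k) \<omega> > m} \<le> l)"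
proof (cases "\<exists>t\<ge>0. card {i\<in>{1..n}. \<not> N i t \<omega> > m} \<le> l")
  case True
  then obtain s where s: "s \<ge> 0" "card {i\<in>{1..n}. \<not> N i s \<omega> > m} \<le> l" by blast
  obtain k :: nat where "s \<le> real k" using real_arch_simple[of s] by blast
  hence "card {i\<in>{1..n}. \<not> N i (real k) \<omega> > m} \<le> l" using low_count_antimono[OF s(1), of "real k" n m] s(2) by simp
  thus ?thesis using hitting_time_attained(2)[OF True assms] by blast
next
  case False
  thus ?thesis using assms by (auto simp: hitting_time_def)
qed

text \<open>
  An integer-valued right-continuous path is constant for a short while after the hitting time, and this interval
  contains a rational. This expresses the value at the random time by countably many events at deterministic times,
  which gives measurability.
\<close>

lemma N_hitting_time_le_iff:
  assumes "i \<ge> 1"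
  shows "N i (hitting_time N m l n \<omega>) \<omega> \<le> v \<longleftrightarrow>
    (\<exists>q\<in>\<rat>\<inter>{0..}. hitting_time N m l n \<omega> \<le> q \<and> N i q \<omega> \<le> v)"
proof
  assume le: "N i (hitting_time N m l n \<omega>) \<omega> \<le> v"
  obtain u where u: "u > hitting_time N m l n \<omega>"
    "\<And>j s. j \<in> {1..i} \<Longrightarrow> hitting_time N m l n \<omega> \<le> s \<Longrightarrow> s < u \<Longrightarrow> N j s \<omega> = N j (hitting_time N m l n \<omega>) \<omega>"
    by (rule constant_to_the_right[OF hitting_time_nonneg, where n = i]) (rule that; blast)
  obtain q where q: "q \<in> \<rat>" "hitting_time N m l n \<omega> < q" "q < u" using Rats_dense_in_real[OF u(1)] by blast
  have q0: "0 \<le> q" using hitting_time_nonneg[of m l n] q by linarith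
  have "N i q \<omega> = N i (hitting_time N m l n \<omega>) \<omega>" using u(2)[of i q] assms q by simp
  hence "N i q \<omega> \<le> v" using le by (simp only:)
  thus "\<exists>q\<in>\<rat>\<inter>{0..}. hitting_time N m l n \<omega> \<le> q \<and> N i q \<omega> \<le> v"
    using q q0 less_imp_le[OF q(2)] by blast
next
  assume "\<exists>q\<in>\<rat>\<inter>{0..}. hitting_time N m l n \<omega> \<le> q \<and> N i q \<omega> \<le> v"
  then obtain q where "hitting_time N m l n \<omega> \<le> q" "N i q \<omega> \<le> v" by blast
  thus "N i (hitting_time N m l n \<omega>) \<omega> \<le> v"
    using N_mono[OF assms hitting_time_nonneg, of m l n q] by linarith
qed

end

locale poisson_family = prob_space M for M :: "'w measure" +
  fixes N :: "nat \<Rightarrow> real \<Rightarrow> 'w \<Rightarrow> nat"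
  assumes iid: "iid_unit_poisson_processes M N"
begin

lemma N_process: "i \<ge> 1 \<Longrightarrow> unit_poisson_process M (N i)"
  using iid by (simp add: iid_unit_poisson_processes_def)

lemma N_measurable: "i \<ge> 1 \<Longrightarrow> 0 \<le> t \<Longrightarrow> N i t \<in> measurable M (count_space UNIV)"
  by (rule unit_poisson_processD(1)[OF N_process])

lemma paths: "\<omega> \<in> space M \<Longrightarrow> poisson_paths N \<omega>"
proof
  fix i :: nat and s t :: real assume "\<omega> \<in> space M" "i \<ge> 1" "0 \<le> s" "s \<le> t"
  thus "N i s \<omega> \<le> N i t \<omega>"
    by (intro monotone_onD[OF unit_poisson_processD(4)[OF N_process, of i \<omega>], of s t]) auto
next
  fix i :: nat and t :: real assume "\<omega> \<in> space M" "i \<ge> 1" "0 \<le> t"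
  thus "continuous (at_right t) (\<lambda>s. N i s \<omega>)"
    by (intro unit_poisson_processD(5)[OF N_process, of i \<omega> t]) auto
qed

lemma N_event:
  assumes "i \<ge> 1" "0 \<le> t"
  shows "{\<omega>\<in>space M. P (N i t \<omega>)} \<in> sets M"
proof -
  have "{\<omega>\<in>space M. P (N i t \<omega>)} = N i t -` Collect P \<inter> space M" by blast
  also have "\<dots> \<in> sets M" by (rule measurable_sets[OF N_measurable[OF assms]]) simp
  finally show ?thesis .
qed

lemma count_event:
  assumes "0 \<le> t"
  shows "{\<omega>\<in>space M. Q (card {i\<in>{1..n}. P (N i t \<omega>)})} \<in> sets M"
proof -
  have "(\<lambda>\<omega>. card {i\<in>{1..n}. P (N i t \<omega>)}) \<in> measurable M (count_space UNIV)"
    unfolding card_filter_eq_sum[OF finite_atLeastAtMost]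
  proof (intro measurable_sum_nat measurable_If)
    fix i assume "i \<in> {1..n}"
    hence "i \<ge> 1" by simp
    thus "{\<omega> \<in> space M. P (N i t \<omega>)} \<in> sets M"
      by (rule N_event[OF _ assms, of i P])
  qed auto
  hence "(\<lambda>\<omega>. card {i\<in>{1..n}. P (N i t \<omega>)}) -` Collect Q \<inter> space M \<in> sets M"
    by (rule measurable_sets) simp
  moreover have "{\<omega>\<in>space M. Q (card {i\<in>{1..n}. P (N i t \<omega>)})} =
    (\<lambda>\<omega>. card {i\<in>{1..n}. P (N i t \<omega>)}) -` Collect Q \<inter> space M" by blast
  ultimately show ?thesis by (simp only:)
qed

lemma hitting_time_event:
  assumes "0 \<le> t"
  shows "{\<omega>\<in>space M. hitting_time N m l n \<omega> \<le> t} \<in> sets M"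
proof -
  define A where "A u = {\<omega>\<in>space M. card {i\<in>{1..n}. \<not> m < N i u \<omega>} \<le> l}" for u
  have A: "A u \<in> sets M" if "0 \<le> u" for u
    unfolding A_def by (rule count_event[OF that, where P = "\<lambda>x. \<not> m < x" and Q = "\<lambda>c. c \<le> l"])
  have iff: "hitting_time N m l n \<omega> \<le> t \<longleftrightarrow> \<omega> \<in> A t \<or> (\<forall>k. \<omega> \<notin> A (real k))" if "\<omega> \<in> space M" for \<omega>
    using poisson_paths.hitting_time_le_iff[OF paths[OF that] assms, of m l n] that
    unfolding A_def mem_Collect_eq by (simp only: simp_thms)
  have "{\<omega>\<in>space M. hitting_time N m l n \<omega> \<le> t} = A t \<union> (space M - (\<Union>k. A (real k)))"
  proof (rule set_eqI)
    fix \<omega>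
    show "\<omega> \<in> {\<omega>\<in>space M. hitting_time N m l n \<omega> \<le> t} \<longleftrightarrow> \<omega> \<in> A t \<union> (space M - (\<Union>k. A (real k)))"
    proof (cases "\<omega> \<in> space M")
      case True
      thus ?thesis using iff[OF True] by blast
    next
      case False
      hence "\<omega> \<notin> A t" by (simp add: A_def)
      thus ?thesis using False by blast
    qed
  qed
  also have "\<dots> \<in> sets M"
    using A[OF assms] A by (intro sets.Un sets.Diff sets.countable_UN) auto
  finally show ?thesis .
qed

lemma N_hitting_time_measurable:
  assumes "i \<ge> 1"
  shows "(\<lambda>\<omega>. N i (hitting_time N m l n \<omega>) \<omega>) \<in> measurable M (count_space UNIV)"
proof -
  have le: "{\<omega>\<in>space M. N i (hitting_time N m l n \<omega>) \<omega> \<le> v} \<in> sets M" for v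
  proof -
    have iff: "N i (hitting_time N m l n \<omega>) \<omega> \<le> v \<longleftrightarrow>
        (\<exists>q\<in>\<rat>\<inter>{0..}. hitting_time N m l n \<omega> \<le> q \<and> N i q \<omega> \<le> v)" if "\<omega> \<in> space M" for \<omega>
      by (rule poisson_paths.N_hitting_time_le_iff[OF paths[OF that] assms])
    have "{\<omega>\<in>space M. N i (hitting_time N m l n \<omega>) \<omega> \<le> v} =
      (\<Union>q\<in>\<rat>\<inter>{0..}. {\<omega>\<in>space M. hitting_time N m l n \<omega> \<le> q} \<inter> {\<omega>\<in>space M. N i q \<omega> \<le> v})"
      (is "?L = ?R")
    proof (rule set_eqI)
      fix \<omega>
      show "\<omega> \<in> ?L \<longleftrightarrow> \<omega> \<in> ?R"
      proof (cases "\<omega> \<in> space M")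
        case True
        thus ?thesis unfolding mem_Collect_eq iff[OF True] by blast
      qed simp
    qed
    also have "\<dots> \<in> sets M"
    proof (rule sets.countable_UN'')
      show "countable (\<rat>\<inter>{0::real..})" by (rule countable_Int1[OF countable_rat])
      fix q :: real assume "q \<in> \<rat>\<inter>{0..}"
      thus "{\<omega>\<in>space M. hitting_time N m l n \<omega> \<le> q} \<inter> {\<omega>\<in>space M. N i q \<omega> \<le> v} \<in> sets M"
        using assms N_event[of i q "\<lambda>x. x \<le> v"] by (intro sets.Int hitting_time_event) auto
    qed
    finally show ?thesis .
  qed
  show ?thesis
  proof (subst measurable_count_space_eq2_countable, safe)
    fix v
    have "(\<lambda>\<omega>. N i (hitting_time N m l n \<omega>) \<omega>) -` {v} \<inter> space M =
      {\<omega>\<in>space M. N i (hitting_time N m l n \<omega>) \<omega> \<le> v} - (\<Union>u<v. {\<omega>\<in>space M. N i (hitting_time N m l n \<omega>) \<omega> \<le> u})"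
      by (auto simp: not_le) (metis lessThan_iff le_neq_implies_less less_irrefl)
    also have "\<dots> \<in> sets M" using le by (intro sets.Diff sets.finite_UN) auto
    finally show "(\<lambda>\<omega>. N i (hitting_time N m l n \<omega>) \<omega>) -` {v} \<inter> space M \<in> sets M" .
  qed auto
qed

lemma order_stat_hit_measurable:
  assumes "1 \<le> i" "i \<le> n"
  shows "(\<lambda>\<omega>. int (order_stat_hit N m l n i \<omega>)) \<in> measurable M (count_space UNIV)"
proof -
  have le: "{\<omega>\<in>space M. int (order_stat_hit N m l n i \<omega>) \<le> z} \<in> sets M" for z
  proof -
    have "(\<lambda>\<omega>. card {j\<in>{1..n}. z < int (N j (hitting_time N m l n \<omega>) \<omega>)}) \<in> measurable M (count_space UNIV)"
      unfolding card_filter_eq_sum[OF finite_atLeastAtMost]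
    proof (intro measurable_sum_nat measurable_If)
      fix j assume "j \<in> {1..n}"
      hence "(\<lambda>\<omega>. N j (hitting_time N m l n \<omega>) \<omega>) -` {v. z < int v} \<inter> space M \<in> sets M"
        by (intro measurable_sets[OF N_hitting_time_measurable]) auto
      moreover have "{\<omega> \<in> space M. z < int (N j (hitting_time N m l n \<omega>) \<omega>)} =
        (\<lambda>\<omega>. N j (hitting_time N m l n \<omega>) \<omega>) -` {v. z < int v} \<inter> space M" by blast
      ultimately show "{\<omega> \<in> space M. z < int (N j (hitting_time N m l n \<omega>) \<omega>)} \<in> sets M" by (simp only:)
    qed auto
    hence "(\<lambda>\<omega>. card {j\<in>{1..n}. z < int (N j (hitting_time N m l n \<omega>) \<omega>)}) -` {..i-1} \<inter> space M \<in> sets M"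
      by (rule measurable_sets) simp
    moreover have "{\<omega>\<in>space M. int (order_stat_hit N m l n i \<omega>) \<le> z} =
      (\<lambda>\<omega>. card {j\<in>{1..n}. z < int (N j (hitting_time N m l n \<omega>) \<omega>)}) -` {..i-1} \<inter> space M"
      unfolding order_stat_hit_def order_stat_le_iff[OF assms] by blast
    ultimately show ?thesis by (simp only:)
  qed
  show ?thesis
  proof (subst measurable_count_space_eq2_countable, safe)
    fix z
    have "(\<lambda>\<omega>. int (order_stat_hit N m l n i \<omega>)) -` {z} \<inter> space M =
      {\<omega>\<in>space M. int (order_stat_hit N m l n i \<omega>) \<le> z} - {\<omega>\<in>space M. int (order_stat_hit N m l n i \<omega>) \<le> z - 1}"
      by auto
    also have "\<dots> \<in> sets M" using le by (intro sets.Diff)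
    finally show "(\<lambda>\<omega>. int (order_stat_hit N m l n i \<omega>)) -` {z} \<inter> space M \<in> sets M" .
  qed auto
qed

lemma prob_N:
  assumes "i \<ge> 1" "0 < t"
  shows "prob {\<omega>\<in>space M. N i t \<omega> \<in> A} = poisson_prob t A"
proof -
  have "distr M (count_space UNIV) (\<lambda>\<omega>. N i t \<omega> - N i 0 \<omega>) = measure_pmf (poisson_pmf (t - 0))"
    using assms(2) by (intro unit_poisson_processD(3)[OF N_process[OF assms(1)]]) auto
  hence "poisson_prob t A = measure (distr M (count_space UNIV) (\<lambda>\<omega>. N i t \<omega> - N i 0 \<omega>)) A" by simp
  also have "\<dots> = prob ((\<lambda>\<omega>. N i t \<omega> - N i 0 \<omega>) -` A \<inter> space M)"
  proof (rule measure_distr)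
    have "N i 0 \<omega> = 0" if "\<omega> \<in> space M" for \<omega>
      using unit_poisson_processD(2)[OF N_process[OF assms(1)] that] .
    thus "(\<lambda>\<omega>. N i t \<omega> - N i 0 \<omega>) \<in> measurable M (count_space UNIV)"
      using N_measurable[of i t] assms by (subst measurable_cong[where g = "N i t"]) auto
  qed simp
  also have "(\<lambda>\<omega>. N i t \<omega> - N i 0 \<omega>) -` A \<inter> space M = {\<omega>\<in>space M. N i t \<omega> \<in> A}"
    using unit_poisson_processD(2)[OF N_process[OF assms(1)]] by auto
  finally show ?thesis ..
qed

text \<open>
  Reaching \<open>v\<close> at time \<open>t\<close> from at most \<open>m\<close> at time \<open>s\<close> takes an
  increment of at least \<open>v - m\<close>, and the increment is independent of the value at time \<open>s\<close>.
\<close>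

lemma prob_low_then_high:
  assumes "i \<ge> 1" "0 < s" "s < t"
  shows "prob {\<omega>\<in>space M. N i s \<omega> \<le> m \<and> v \<le> N i t \<omega>} \<le>
    poisson_prob s {..m} * poisson_prob (t - s) {v-m..}"
proof -
  \<comment> \<open>Independence of increments is stated along infinite time sequences, so the two times are extended by a constant.\<close>
  define T :: "nat \<Rightarrow> real" where "T j = (if j = 0 then 0 else if j = 1 then s else t)" for j
  define X where "X j \<omega> = N i (T (Suc j)) \<omega> - N i (T j) \<omega>" for j \<omega>
  have "0 \<le> T 0" "incseq T" using assms by (auto simp: T_def incseq_def)
  hence ind: "indep_vars (\<lambda>_. count_space UNIV) X {..<2}"
    unfolding X_def by (rule unit_poisson_processD(6)[OF N_process[OF assms(1)]])
  define A where "A j = (if j = 0 then {..m} else {v-m..})" for j :: nat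
  have "prob (\<Inter>j\<in>{..<2}. X j -` A j \<inter> space M) = (\<Prod>j\<in>{..<2}. prob (X j -` A j \<inter> space M))"
    by (rule indep_varsD[OF ind]) (auto simp: lessThan_empty_iff)
  also have "\<dots> = prob (X 0 -` {..m} \<inter> space M) * prob (X 1 -` {v-m..} \<inter> space M)"
    by (simp add: A_def numeral_2_eq_2)
  also have "prob (X 0 -` {..m} \<inter> space M) = poisson_prob s {..m}"
  proof -
    have "X 0 -` {..m} \<inter> space M = {\<omega>\<in>space M. N i s \<omega> \<in> {..m}}"
      using unit_poisson_processD(2)[OF N_process[OF assms(1)]] by (auto simp: X_def T_def)
    thus ?thesis using prob_N[OF assms(1,2), of "{..m}"] by (simp only:)
  qed
  also have "prob (X 1 -` {v-m..} \<inter> space M) = poisson_prob (t - s) {v-m..}"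
  proof -
    have X1: "X 1 = (\<lambda>\<omega>. N i t \<omega> - N i s \<omega>)" by (auto simp: X_def T_def)
    have "random_variable (count_space UNIV) (X 1)" using ind by (auto simp: indep_vars_def)
    hence "measure (distr M (count_space UNIV) (X 1)) {v-m..} = prob (X 1 -` {v-m..} \<inter> space M)"
      by (rule measure_distr) auto
    moreover have "distr M (count_space UNIV) (X 1) = measure_pmf (poisson_pmf (t - s))"
      unfolding X1 using assms by (intro unit_poisson_processD(3)[OF N_process]) auto
    ultimately show ?thesis by simp
  qed
  finally have eq: "prob (\<Inter>j\<in>{..<2}. X j -` A j \<inter> space M) =
    poisson_prob s {..m} * poisson_prob (t - s) {v-m..}" .
  have "prob {\<omega>\<in>space M. N i s \<omega> \<le> m \<and> v \<le> N i t \<omega>} \<le> prob (\<Inter>j\<in>{..<2}. X j -` A j \<inter> space M)"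
  proof (rule finite_measure_mono)
    show "(\<Inter>j\<in>{..<2}. X j -` A j \<inter> space M) \<in> sets M"
      using ind by (intro sets.finite_INT) (auto simp: indep_vars_def lessThan_empty_iff intro!: measurable_sets)
    show "{\<omega>\<in>space M. N i s \<omega> \<le> m \<and> v \<le> N i t \<omega>} \<subseteq> (\<Inter>j\<in>{..<2}. X j -` A j \<inter> space M)"
      by (auto simp: X_def A_def T_def less_2_cases_iff)
  qed
  thus ?thesis unfolding eq .
qed

lemma indep_pairs:
  assumes "0 \<le> s" "0 \<le> t"
  shows "indep_vars (\<lambda>_. count_space UNIV) (\<lambda>i \<omega>. (N i s \<omega>, N i t \<omega>)) {1..n}"
proof -
  have "indep_vars (\<lambda>_. PiM {0..} (\<lambda>_. count_space UNIV)) (\<lambda>i \<omega>. \<lambda>t\<in>{0..}. N i t \<omega>) {1..n}"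
    by (rule indep_vars_subset[OF iid[unfolded iid_unit_poisson_processes_def, THEN conjunct2]]) auto
  moreover have "(\<lambda>x. (x s, x t)) \<in> measurable (PiM {0..} (\<lambda>_. count_space UNIV)) (count_space (UNIV :: (nat \<times> nat) set))"
  proof -
    have "(\<lambda>x. (x s, x t)) \<in> measurable (PiM {0..} (\<lambda>_. count_space UNIV)) (count_space UNIV \<Otimes>\<^sub>M count_space (UNIV :: nat set))"
      using assms by (intro measurable_Pair measurable_component_singleton) auto
    thus ?thesis by (simp add: pair_measure_countable)
  qed
  ultimately have "indep_vars (\<lambda>_. count_space UNIV) (\<lambda>i \<omega>. (\<lambda>x. (x s, x t)) (\<lambda>t\<in>{0..}. N i t \<omega>)) {1..n}"
    by (rule indep_vars_compose2)
  moreover have "(\<lambda>x. (x s, x t)) (\<lambda>t\<in>{0..}. N i t \<omega>) = (N i s \<omega>, N i t \<omega>)" for i \<omega>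
    using assms by (simp add: restrict_def)
  ultimately show ?thesis by (simp only:)
qed

end

section \<open>The Poisson process with exponential intensity and the Gumbel law\<close>

lemma exp_intensity_sets [simp, measurable_cong]: "sets exp_intensity = sets borel"
  by (simp add: exp_intensity_def)

lemma emeasure_exp_intensity_greaterThan: "emeasure exp_intensity {u<..} = ennreal (exp (- u))"
proof -
  have "emeasure exp_intensity {u<..} = (\<integral>\<^sup>+x. ennreal (exp (- x)) * indicator {u<..} x \<partial>lborel)"
    unfolding exp_intensity_def by (subst emeasure_density) auto
  also have "\<dots> = (\<integral>\<^sup>+x. ennreal (exp (- x)) * indicator {u..} x \<partial>lborel)"
    by (intro nn_integral_cong_AE) (use AE_lborel_singleton[of u] in eventually_elim, auto simp: indicator_def)
  also have "\<dots> = 0 - (- exp (- u))"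
  proof (rule nn_integral_FTC_atLeast)
    have "((\<lambda>x::real. exp (- x)) \<longlongrightarrow> 0) at_top"
      by (rule filterlim_compose[OF exp_at_bot filterlim_uminus_at_bot_at_top])
    thus "((\<lambda>x::real. - exp (- x)) \<longlongrightarrow> 0) at_top" using tendsto_minus by fastforce
  qed (auto intro!: derivative_eq_intros)
  finally show ?thesis by simp
qed

lemma measure_exp_intensity_greaterThan: "measure exp_intensity {u<..} = exp (- u)"
  by (simp add: measure_def emeasure_exp_intensity_greaterThan)

lemma exp_intensity_Ioc:
  assumes "u \<le> v"
  shows "measure exp_intensity {u<..v} = exp (- u) - exp (- v)" "emeasure exp_intensity {u<..v} < \<infinity>"
proof -
  have eq: "{u<..v} = {u<..} - {v<..}" by auto
  have "measure exp_intensity ({u<..} - {v<..}) = measure exp_intensity {u<..} - measure exp_intensity {v<..}"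
    using assms by (intro measure_Diff) (auto simp: emeasure_exp_intensity_greaterThan)
  thus "measure exp_intensity {u<..v} = exp (- u) - exp (- v)"
    by (simp add: eq measure_exp_intensity_greaterThan)
  have "emeasure exp_intensity {u<..v} \<le> emeasure exp_intensity {u<..}"
    by (intro emeasure_mono) auto
  also have "\<dots> < \<infinity>" by (simp add: emeasure_exp_intensity_greaterThan)
  finally show "emeasure exp_intensity {u<..v} < \<infinity>" .
qed

text \<open>
  The masses of shrinking balls around a point without mass are integers that tend to zero, so a whole neighbourhood
  is null; by the Lindelof property countably many such neighbourhoods suffice.
\<close>

lemma no_atoms_imp_null:
  fixes \<nu> :: "real measure"
  assumes sets: "sets \<nu> = sets borel"
    and int: "\<And>A. A \<in> sets borel \<Longrightarrow> bounded A \<Longrightarrow> emeasure \<nu> A \<in> range of_nat"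
    and A: "A \<in> sets borel" and na: "\<And>y. y \<in> A \<Longrightarrow> emeasure \<nu> {y} = 0"
  shows "emeasure \<nu> A = 0"
proof -
  \<comment> \<open>A point outside \<open>A\<close> may be an atom, but then its singleton misses \<open>A\<close>.\<close>
  have "\<exists>d>0. emeasure \<nu> (ball y d \<inter> A) = 0" for y
  proof -
    define B where "B n = ball y (inverse (real (Suc n))) \<inter> A" for n
    have BA: "B n \<in> sets borel" "bounded (B n)" for n using A by (auto simp: B_def intro: bounded_Int)
    have mono: "B n \<subseteq> B k" if "k \<le> n" for k n
    proof -
      have "inverse (real (Suc n)) \<le> inverse (real (Suc k))" using that by (intro le_imp_inverse_le) auto
      thus ?thesis unfolding B_def by (intro Int_mono subset_ball order.refl)
    qed
    have "(\<lambda>n. emeasure \<nu> (B n)) \<longlonglongrightarrow> emeasure \<nu> (\<Inter>n. B n)"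
    proof (rule Lim_emeasure_decseq)
      show "range B \<subseteq> sets \<nu>" using BA sets by auto
      show "decseq B" using mono by (auto simp: decseq_def)
      show "emeasure \<nu> (B n) \<noteq> \<infinity>" for n
      proof -
        obtain k :: nat where "emeasure \<nu> (B n) = of_nat k" using int[OF BA, of n] by blast
        thus ?thesis by simp
      qed
    qed
    also have "(\<Inter>n. B n) = {y} \<inter> A"
    proof (intro equalityI subsetI)
      fix x assume x: "x \<in> (\<Inter>n. B n)"
      have "x = y"
      proof (rule ccontr)
        assume "x \<noteq> y"
        then obtain n where "inverse (real (Suc n)) < dist y x" using reals_Archimedean[of "dist y x"] by auto
        moreover have "dist y x < inverse (real (Suc n))" using x by (auto simp: B_def)
        ultimately show False by simp
      qed
      thus "x \<in> {y} \<inter> A" using x by (auto simp: B_def)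
    qed (auto simp: B_def)
    also have "emeasure \<nu> ({y} \<inter> A) = 0" using na by (cases "y \<in> A") auto
    finally have "\<forall>\<^sub>F n in sequentially. emeasure \<nu> (B n) < 1" by (rule order_tendstoD) simp
    then obtain n where n: "emeasure \<nu> (B n) < 1" by (auto simp: eventually_sequentially)
    obtain k :: nat where "emeasure \<nu> (B n) = of_nat k" using int[OF BA] by auto
    with n have "emeasure \<nu> (B n) = 0" by (cases k) (auto simp: of_nat_less_iff[of k 1, simplified])
    thus ?thesis by (intro exI[of _ "inverse (real (Suc n))"]) (auto simp: B_def)
  qed
  then obtain d where d: "\<And>y. d y > 0" "\<And>y. emeasure \<nu> (ball y (d y) \<inter> A) = 0" by metis
  obtain \<F> where \<F>: "\<F> \<subseteq> (\<lambda>y. ball y (d y)) ` UNIV" "countable \<F>" "\<Union>\<F> = \<Union>((\<lambda>y. ball y (d y)) ` UNIV)"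
    using Lindelof[of "(\<lambda>y. ball y (d y)) ` UNIV"] by auto
  have "y \<in> \<Union>\<F>" for y unfolding \<F>(3) using d(1) by (intro UN_I[of y]) auto
  hence "A = (\<Union>U\<in>\<F>. U \<inter> A)" by auto
  moreover have "(\<Union>U\<in>\<F>. U \<inter> A) \<in> null_sets \<nu>"
  proof (rule null_sets_UN'[OF \<F>(2)])
    fix U assume "U \<in> \<F>"
    then obtain y where "U = ball y (d y)" using \<F>(1) by blast
    thus "U \<inter> A \<in> null_sets \<nu>" using d(2)[of y] A by (intro null_setsI) (simp_all add: sets)
  qed
  ultimately have "A \<in> null_sets \<nu>" by (simp only:)
  thus ?thesis by blast
qed

text \<open>
  If every atom has mass one, then by \<open>no_atoms_imp_null\<close> the mass of a half-line is the number of atoms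
  in it, and the \<open>i\<close>-th largest atom lies outside the half-line iff it contains at most
  \<open>i - 1\<close> of them.
\<close>

lemma atoms_above_iff:
  fixes \<nu> :: "real measure"
  assumes sets: "sets \<nu> = sets borel"
    and int: "\<And>A. A \<in> sets borel \<Longrightarrow> bounded A \<Longrightarrow> emeasure \<nu> A \<in> range of_nat"
    and fin: "emeasure \<nu> {x<..} < \<infinity>"
    and simple: "\<And>y. \<not> 2 \<le> emeasure \<nu> {y}"
    and dec: "decreasing_atoms \<nu> \<xi>" and i: "i \<ge> 1"
  shows "\<xi> i \<le> x \<longleftrightarrow> emeasure \<nu> {x<..} \<le> of_nat (i - 1)"
proof -
  have dec1: "\<xi> (Suc j) < \<xi> j" if "j \<ge> 1" for j using dec that by (simp add: decreasing_atoms_def)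
  have atoms: "{y. emeasure \<nu> {y} > 0} = \<xi> ` {1..}" using dec by (simp add: decreasing_atoms_def)
  have lt: "\<xi> k < \<xi> j" if "1 \<le> j" "j < k" for j k
    using that
  proof (induction k)
    case (Suc k)
    thus ?case using dec1[of k] by (cases "j = k") auto
  qed simp
  have inj: "inj_on \<xi> {1..}"
  proof (rule inj_onI)
    fix j k assume "j \<in> {1::nat..}" "k \<in> {1..}" "\<xi> j = \<xi> k"
    thus "j = k" using lt[of j k] lt[of k j] by (cases j k rule: linorder_cases) auto
  qed
  have mass: "emeasure \<nu> {\<xi> j} = 1" if "j \<ge> 1" for j
  proof -
    have "0 < emeasure \<nu> {\<xi> j}" using atoms that by auto
    moreover obtain k :: nat where k: "emeasure \<nu> {\<xi> j} = of_nat k" using int[of "{\<xi> j}"] by auto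
    moreover have "\<not> 2 \<le> (of_nat k :: ennreal)" using simple[of "\<xi> j"] k by simp
    hence "\<not> 2 \<le> k" using of_nat_mono[of 2 k, where 'a=ennreal] by auto
    moreover have "k \<noteq> 0" using calculation by auto
    ultimately have "k = 1" by auto
    thus ?thesis using k by simp
  qed
  define S where "S = {j. j \<ge> 1 \<and> x < \<xi> j}"
  have cardle: "of_nat (card T) \<le> emeasure \<nu> {x<..}" if "finite T" "T \<subseteq> S" for T
  proof -
    have "of_nat (card T) = (\<Sum>j\<in>T. emeasure \<nu> {\<xi> j})" using that mass by (simp add: S_def subset_iff)
    also have "\<dots> = emeasure \<nu> (\<Union>j\<in>T. {\<xi> j})"
      using that inj sets by (intro sum_emeasure) (auto simp: disjoint_family_on_def S_def inj_on_def)
    also have "\<dots> \<le> emeasure \<nu> {x<..}" using that sets by (intro emeasure_mono) (auto simp: S_def)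
    finally show ?thesis .
  qed
  have finS: "finite S"
  proof (rule ccontr)
    assume "infinite S"
    obtain N :: nat where N: "emeasure \<nu> {x<..} < of_nat N"
      using fin ennreal_Ex_less_of_nat[of "emeasure \<nu> {x<..}"] by auto
    obtain T where "T \<subseteq> S" "finite T" "card T = N" using infinite_arbitrarily_large[OF \<open>infinite S\<close>] by metis
    with cardle[of T] N show False by simp
  qed
  have borelS: "\<xi> ` S \<in> sets borel" using finS by (intro borel_closed finite_imp_closed finite_imageI)
  have total: "emeasure \<nu> {x<..} = of_nat (card S)"
  proof -
    have "emeasure \<nu> {x<..} = emeasure \<nu> (\<xi> ` S) + emeasure \<nu> ({x<..} - \<xi> ` S)"
    proof -
      have "{x<..} = \<xi> ` S \<union> ({x<..} - \<xi> ` S)" by (auto simp: S_def)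
      thus ?thesis using borelS sets plus_emeasure[of "\<xi> ` S" \<nu> "{x<..} - \<xi> ` S"] by auto
    qed
    also have "emeasure \<nu> ({x<..} - \<xi> ` S) = 0"
    proof (rule no_atoms_imp_null[OF sets int])
      show "{x<..} - \<xi> ` S \<in> sets borel"
        using borelS by (intro sets.Diff) auto
      fix y assume y: "y \<in> {x<..} - \<xi> ` S"
      hence "y \<notin> \<xi> ` {1..}" by (auto simp: S_def)
      hence "\<not> emeasure \<nu> {y} > 0" using atoms by blast
      thus "emeasure \<nu> {y} = 0" by simp
    qed
    also have "emeasure \<nu> (\<xi> ` S) = of_nat (card S)"
    proof -
      have "emeasure \<nu> (\<Union>j\<in>S. {\<xi> j}) = (\<Sum>j\<in>S. emeasure \<nu> {\<xi> j})"
        using finS inj sets by (intro sum_emeasure[symmetric]) (auto simp: disjoint_family_on_def S_def inj_on_def)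
      also have "\<dots> = of_nat (card S)" using mass by (simp add: S_def)
      also have "(\<Union>j\<in>S. {\<xi> j}) = \<xi> ` S" by auto
      finally show ?thesis .
    qed
    finally show ?thesis by simp
  qed
  have "\<xi> i \<le> x \<longleftrightarrow> card S \<le> i - 1"
  proof
    assume le: "\<xi> i \<le> x"
    have "S \<subseteq> {1..<i}"
    proof
      fix j assume j: "j \<in> S"
      have "\<not> i \<le> j" 
      proof
        assume "i \<le> j"
        hence "\<xi> j \<le> \<xi> i" using lt[of i j] i by (cases "i = j") auto
        thus False using j le by (simp add: S_def)
      qed
      thus "j \<in> {1..<i}" using j by (simp add: S_def)
    qed
    hence "card S \<le> card {1..<i}" by (intro card_mono) auto
    thus "card S \<le> i - 1" by simp
  next
    assume c: "card S \<le> i - 1"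
    show "\<xi> i \<le> x"
    proof (rule ccontr)
      assume "\<not> \<xi> i \<le> x"
      have "{1..i} \<subseteq> S"
      proof
        fix j assume j: "j \<in> {1..i}"
        hence "\<xi> i \<le> \<xi> j" using lt[of j i] by (cases "i = j") auto
        thus "j \<in> S" using j \<open>\<not> \<xi> i \<le> x\<close> by (simp add: S_def)
      qed
      hence "card {1..i} \<le> card S" using finS by (intro card_mono)
      thus False using c i by simp
    qed
  qed
  thus ?thesis unfolding total by simp
qed

text \<open>
  The defining conditions on the point process do not mention simplicity; it is derived in \<open>ppp_simple\<close>.
\<close>

locale exp_ppp = prob_space M for M :: "'b measure" +
  fixes \<Xi> :: "'b \<Rightarrow> real measure"
  assumes ppp: "poisson_point_process M exp_intensity \<Xi>"
begin

lemma sets_ppp: "\<omega> \<in> space M \<Longrightarrow> sets (\<Xi> \<omega>) = sets borel"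
  using ppp[unfolded poisson_point_process_def point_process_def, THEN conjunct1, THEN conjunct1] by blast

lemma ppp_integer: "\<omega> \<in> space M \<Longrightarrow> A \<in> sets borel \<Longrightarrow> bounded A \<Longrightarrow> emeasure (\<Xi> \<omega>) A \<in> range of_nat"
  using ppp[unfolded poisson_point_process_def point_process_def, THEN conjunct1, THEN conjunct1] by blast

lemma ppp_measurable: "A \<in> sets borel \<Longrightarrow> (\<lambda>\<omega>. emeasure (\<Xi> \<omega>) A) \<in> borel_measurable M"
  using ppp[unfolded poisson_point_process_def point_process_def, THEN conjunct1, THEN conjunct2] by blast

lemma ppp_event:
  assumes "A \<in> sets borel" "B \<in> sets borel"
  shows "{\<omega>\<in>space M. emeasure (\<Xi> \<omega>) A \<in> B} \<in> sets M"
proof -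
  have "{\<omega>\<in>space M. emeasure (\<Xi> \<omega>) A \<in> B} = (\<lambda>\<omega>. emeasure (\<Xi> \<omega>) A) -` B \<inter> space M" by blast
  thus ?thesis using measurable_sets[OF ppp_measurable[OF assms(1)] assms(2)] by (simp only:)
qed

lemma ppp_count:
  assumes "A \<in> sets borel" "emeasure exp_intensity A < \<infinity>"
  shows "prob {\<omega>\<in>space M. emeasure (\<Xi> \<omega>) A = of_nat k} =
    exp (- measure exp_intensity A) * measure exp_intensity A ^ k / fact k"
  using ppp[unfolded poisson_point_process_def, THEN conjunct2, THEN conjunct1] assms by blast

lemma ppp_indep:
  fixes A :: "nat \<Rightarrow> real set"
  assumes "\<And>j. j < k \<Longrightarrow> A j \<in> sets borel" "disjoint_family_on A {..<k}"
  shows "indep_vars (\<lambda>_. borel) (\<lambda>j \<omega>. emeasure (\<Xi> \<omega>) (A j)) {..<k}"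
  by (rule ppp[unfolded poisson_point_process_def, THEN conjunct2, THEN conjunct2, THEN conjunct2, rule_format])
    (use assms in simp)

text \<open>
  The Poisson weights add up to one. The definition of a point process guarantees integer values only on bounded sets.
\<close>

lemma ppp_AE_integer:
  assumes A: "A \<in> sets borel" "emeasure exp_intensity A < \<infinity>"
  shows "AE \<omega> in M. emeasure (\<Xi> \<omega>) A \<in> range of_nat"
proof -
  define a where "a = measure exp_intensity A"
  define V where "V k = {\<omega>\<in>space M. emeasure (\<Xi> \<omega>) A = of_nat k}" for k :: nat
  have Vs: "V k \<in> sets M" for k
    using ppp_event[OF A(1), of "{of_nat k}"] by (simp add: V_def)
  have disj: "disjoint_family V" by (auto simp: disjoint_family_on_def V_def)
  have "(\<lambda>k. prob (V k)) sums prob (\<Union>k. V k)"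
    using Vs disj by (intro finite_measure_UNION) auto
  moreover have "prob (V k) = exp (- a) * (a ^ k /\<^sub>R fact k)" for k
    unfolding V_def ppp_count[OF A] a_def[symmetric] by (simp add: field_simps)
  moreover have "(\<lambda>k. exp (- a) * (a ^ k /\<^sub>R fact k)) sums (exp (- a) * exp a)"
    by (intro sums_mult exp_converges)
  ultimately have "prob (\<Union>k. V k) = exp (- a) * exp a" using sums_unique2 by (metis (no_types, lifting) sums_cong)
  hence "prob (\<Union>k. V k) = 1" by (simp add: exp_minus)
  hence "AE \<omega> in M. \<omega> \<in> (\<Union>k. V k)" by (rule AE_prob_1)
  thus ?thesis by eventually_elim (auto simp: V_def)
qed

text \<open>
  Cut \<open>(- R, R]\<close> into cells of length \<open>1 / n\<close>. A cell with mean \<open>a\<close> contains at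
  least two points with probability at most \<open>a\<^sup>2\<close>, so the probability that some cell does is
  \<open>O(1 / n)\<close>; but an atom of mass at least two forces this for every \<open>n\<close>.
\<close>

lemma ppp_simple: "AE \<omega> in M. \<forall>y. \<not> 2 \<le> emeasure (\<Xi> \<omega>) {y}"
proof -
  have "AE \<omega> in M. \<forall>y\<in>{-real R<..real R}. \<not> 2 \<le> emeasure (\<Xi> \<omega>) {y}" for R :: nat
  proof -
    define I where "I n j = {-real R + real j / real n<..-real R + real (Suc j) / real n}" for n j :: nat
    define E where "E n = (\<Union>j<2*R*n. {\<omega>\<in>space M. emeasure (\<Xi> \<omega>) (I n j) \<in> - {0, 1}})" for n
    define c where "c = exp (real R)"
    have Es: "E n \<in> sets M" for n
      unfolding E_def by (intro sets.finite_UN ppp_event) (auto simp: I_def)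
    have pE: "prob (E n) \<le> 2 * real R * c\<^sup>2 / real n" if n: "n > 0" for n
    proof -
      have pj: "prob {\<omega>\<in>space M. emeasure (\<Xi> \<omega>) (I n j) \<in> - {0, 1}} \<le> (c / real n)\<^sup>2" for j
      proof -
        define a where "a = measure exp_intensity (I n j)"
        have fin: "emeasure exp_intensity (I n j) < \<infinity>" and Ib: "I n j \<in> sets borel"
          unfolding I_def by (intro exp_intensity_Ioc) (auto simp: n divide_right_mono)
        have a_eq: "a = exp (real R - real j / real n) - exp (real R - real (Suc j) / real n)"
          unfolding a_def I_def by (subst exp_intensity_Ioc) (auto simp: n divide_right_mono)
        have a0: "0 \<le> a" by (simp add: a_def)
        have ac: "a \<le> c / real n"
        proof -
          have "a = exp (real R - real j / real n) * (1 - exp (- (1 / real n)))"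
            by (simp add: a_eq right_diff_distrib exp_add[symmetric] field_simps add_divide_distrib)
          also have "\<dots> \<le> c * (1 / real n)"
            unfolding c_def using exp_ge_add_one_self[of "- (1 / real n)"]
            by (intro mult_mono) auto
          finally show ?thesis by simp
        qed
        let ?Z = "\<lambda>k. {\<omega>\<in>space M. emeasure (\<Xi> \<omega>) (I n j) = of_nat k}"
        have Zs: "?Z k \<in> sets M" for k using ppp_event[OF Ib, of "{of_nat k}"] by simp
        have "{\<omega>\<in>space M. emeasure (\<Xi> \<omega>) (I n j) \<in> - {0, 1}} = space M - (?Z 0 \<union> ?Z 1)" by auto
        hence "prob {\<omega>\<in>space M. emeasure (\<Xi> \<omega>) (I n j) \<in> - {0, 1}} = 1 - prob (?Z 0 \<union> ?Z 1)"
          using Zs prob_compl[of "?Z 0 \<union> ?Z 1"] by (simp only: sets.Un)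
        also have "prob (?Z 0 \<union> ?Z 1) = prob (?Z 0) + prob (?Z 1)"
          using Zs[of 0] Zs[of 1] by (intro finite_measure_Union) auto
        also have "\<dots> = exp (- a) * (1 + a)"
          unfolding ppp_count[OF Ib fin] a_def by (simp add: algebra_simps)
        also have "1 - exp (- a) * (1 + a) \<le> a\<^sup>2"
        proof -
          have "(1 - a) * (1 + a) \<le> exp (- a) * (1 + a)"
            using exp_ge_add_one_self[of "- a"] a0 by (intro mult_right_mono) auto
          thus ?thesis by (simp add: algebra_simps power2_eq_square)
        qed
        also have "\<dots> \<le> (c / real n)\<^sup>2" using ac a0 by (intro power_mono)
        finally show ?thesis .
      qed
      have "prob (E n) \<le> (\<Sum>j<2*R*n. prob {\<omega>\<in>space M. emeasure (\<Xi> \<omega>) (I n j) \<in> - {0, 1}})"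
        unfolding E_def by (intro finite_measure_subadditive_finite image_subsetI ppp_event) (auto simp: I_def)
      also have "\<dots> \<le> (\<Sum>j<2*R*n. (c / real n)\<^sup>2)" by (intro sum_mono pj)
      also have "\<dots> = 2 * real R * c\<^sup>2 / real n" using n by (simp add: power2_eq_square)
      finally show ?thesis .
    qed
    have sub: "{\<omega>\<in>space M. \<exists>y\<in>{-real R<..real R}. 2 \<le> emeasure (\<Xi> \<omega>) {y}} \<subseteq> E n" if n: "n > 0" for n
    proof
      fix \<omega> assume "\<omega> \<in> {\<omega>\<in>space M. \<exists>y\<in>{-real R<..real R}. 2 \<le> emeasure (\<Xi> \<omega>) {y}}"
      then obtain y where w: "\<omega> \<in> space M" and y: "- real R < y" "y \<le> real R" "2 \<le> emeasure (\<Xi> \<omega>) {y}" by auto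
      define j where "j = nat (\<lceil>(y + real R) * real n\<rceil> - 1)"
      have pos: "(y + real R) * real n > 0" using y n by simp
      hence "\<lceil>(y + real R) * real n\<rceil> \<ge> 1" by linarith
      hence j: "real j = real_of_int \<lceil>(y + real R) * real n\<rceil> - 1" by (simp add: j_def)
      have "real j < (y + real R) * real n" "(y + real R) * real n \<le> real j + 1" unfolding j by linarith+
      hence yI: "y \<in> I n j" using n by (auto simp: I_def field_simps)
      have "real j < real (2 * R * n)"
      proof -
        have "(y + real R) * real n \<le> (2 * real R) * real n" using y n by (intro mult_right_mono) auto
        thus ?thesis using \<open>real j < (y + real R) * real n\<close> by simp
      qed
      hence j2: "j < 2 * R * n" by (simp only: of_nat_less_iff)
      have "I n j \<in> sets (\<Xi> \<omega>)" unfolding sets_ppp[OF w] I_def by simp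
      hence "emeasure (\<Xi> \<omega>) {y} \<le> emeasure (\<Xi> \<omega>) (I n j)" using yI by (intro emeasure_mono) simp
      hence "2 \<le> emeasure (\<Xi> \<omega>) (I n j)" by (rule order.trans[OF y(3)])
      hence "emeasure (\<Xi> \<omega>) (I n j) \<in> - {0, 1}" by auto
      thus "\<omega> \<in> E n" using w j2 unfolding E_def by blast
    qed
    define Z where "Z = (\<Inter>n. E (Suc n))"
    have Zs: "Z \<in> sets M" unfolding Z_def using Es by auto
    have "prob Z = 0"
    proof (rule antisym)
      have "(\<lambda>n. 2 * real R * c\<^sup>2 / real (Suc n)) \<longlonglongrightarrow> 0"
        using LIMSEQ_Suc[OF lim_const_over_n[of "2 * real R * c\<^sup>2"]] .
      moreover have "prob Z \<le> 2 * real R * c\<^sup>2 / real (Suc n)" for n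
        using finite_measure_mono[of Z "E (Suc n)"] Es pE[of "Suc n"] by (force simp: Z_def)
      ultimately show "prob Z \<le> 0" by (intro LIMSEQ_le_const) auto
    qed simp
    hence "AE \<omega> in M. \<omega> \<notin> Z" using Zs by (simp add: prob_eq_0)
    thus ?thesis using AE_space
    proof eventually_elim
      case (elim \<omega>)
      then obtain n where "\<omega> \<notin> E (Suc n)" by (auto simp: Z_def)
      with sub[of "Suc n"] elim show ?case by blast
    qed
  qed
  hence "AE \<omega> in M. \<forall>R::nat. \<forall>y\<in>{-real R<..real R}. \<not> 2 \<le> emeasure (\<Xi> \<omega>) {y}"
    by (simp add: AE_all_countable)
  thus ?thesis
  proof eventually_elim
    case (elim \<omega>)
    show ?case
    proof
      fix y :: real
      obtain R :: nat where "\<bar>y\<bar> < real R" using reals_Archimedean2 by blast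
      hence "y \<in> {-real R<..real R}" by auto
      with elim show "\<not> 2 \<le> emeasure (\<Xi> \<omega>) {y}" by blast
    qed
  qed
qed

lemma ppp_finite_above: "AE \<omega> in M. \<forall>x. emeasure (\<Xi> \<omega>) {x<..} < \<infinity>"
proof -
  have "AE \<omega> in M. emeasure (\<Xi> \<omega>) {- real R<..} < \<infinity>" for R :: nat
  proof -
    have "AE \<omega> in M. emeasure (\<Xi> \<omega>) {- real R<..} \<in> range of_nat"
      by (rule ppp_AE_integer) (auto simp: emeasure_exp_intensity_greaterThan)
    thus ?thesis by eventually_elim (auto simp: of_nat_less_top)
  qed
  hence "AE \<omega> in M. \<forall>R::nat. emeasure (\<Xi> \<omega>) {- real R<..} < \<infinity>" by (simp add: AE_all_countable)
  thus ?thesis using AE_space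
  proof eventually_elim
    case (elim \<omega>)
    show ?case
    proof
      fix x :: real
      obtain R :: nat where "- x < real R" using reals_Archimedean2 by blast
      hence "emeasure (\<Xi> \<omega>) {x<..} \<le> emeasure (\<Xi> \<omega>) {- real R<..}"
        using sets_ppp[OF elim(2)] by (intro emeasure_mono) auto
      also have "\<dots> < \<infinity>" using elim by blast
      finally show "emeasure (\<Xi> \<omega>) {x<..} < \<infinity>" .
    qed
  qed
qed

theorem ordered_atom_le_iff:
  assumes "AE \<omega> in M. decreasing_atoms (\<Xi> \<omega>) (\<lambda>i. \<xi> i \<omega>)"
  shows "AE \<omega> in M. \<forall>i\<ge>1. \<forall>x. \<xi> i \<omega> \<le> x \<longleftrightarrow> emeasure (\<Xi> \<omega>) {x<..} \<le> of_nat (i - 1)"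
  using assms ppp_simple ppp_finite_above AE_space
proof eventually_elim
  case (elim \<omega>)
  show ?case
  proof (intro allI impI)
    fix i :: nat and x :: real assume i: "i \<ge> 1"
    show "\<xi> i \<omega> \<le> x \<longleftrightarrow> emeasure (\<Xi> \<omega>) {x<..} \<le> of_nat (i - 1)"
      by (rule atoms_above_iff[OF sets_ppp[OF elim(4)] ppp_integer[OF elim(4)]])
        (use elim i in auto)
  qed
qed

lemma ppp_joint_counts:
  fixes A :: "nat \<Rightarrow> real set"
  assumes "\<And>j. j < k \<Longrightarrow> A j \<in> sets borel" "\<And>j. j < k \<Longrightarrow> emeasure exp_intensity (A j) < \<infinity>"
    "\<And>j. j < k \<Longrightarrow> 0 < measure exp_intensity (A j)"
    and disj: "disjoint_family_on A {..<k}"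
  shows "prob {\<omega>\<in>space M. \<forall>j<k. emeasure (\<Xi> \<omega>) (A j) = of_nat (c j)}
    = (\<Prod>j<k. pmf (poisson_pmf (measure exp_intensity (A j))) (c j))"
proof (cases "k = 0")
  case True
  thus ?thesis by (simp add: prob_space)
next
  case False
  have "prob (\<Inter>j\<in>{..<k}. (\<lambda>\<omega>. emeasure (\<Xi> \<omega>) (A j)) -` {of_nat (c j)} \<inter> space M) =
    (\<Prod>j\<in>{..<k}. prob ((\<lambda>\<omega>. emeasure (\<Xi> \<omega>) (A j)) -` {of_nat (c j)} \<inter> space M))"
    by (rule indep_varsD[OF ppp_indep[OF assms(1) disj]]) (use False in \<open>auto simp: lessThan_empty_iff\<close>)
  also have "(\<Inter>j\<in>{..<k}. (\<lambda>\<omega>. emeasure (\<Xi> \<omega>) (A j)) -` {of_nat (c j)} \<inter> space M)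
     = {\<omega>\<in>space M. \<forall>j<k. emeasure (\<Xi> \<omega>) (A j) = of_nat (c j)}"
    using False by auto
  also have "(\<Prod>j\<in>{..<k}. prob ((\<lambda>\<omega>. emeasure (\<Xi> \<omega>) (A j)) -` {of_nat (c j)} \<inter> space M)) =
    (\<Prod>j<k. pmf (poisson_pmf (measure exp_intensity (A j))) (c j))"
  proof (rule prod.cong[OF refl])
    fix j assume j: "j \<in> {..<k}"
    have "(\<lambda>\<omega>. emeasure (\<Xi> \<omega>) (A j)) -` {of_nat (c j)} \<inter> space M = {\<omega>\<in>space M. emeasure (\<Xi> \<omega>) (A j) = of_nat (c j)}" by auto
    thus "prob ((\<lambda>\<omega>. emeasure (\<Xi> \<omega>) (A j)) -` {of_nat (c j)} \<inter> space M) = pmf (poisson_pmf (measure exp_intensity (A j))) (c j)"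
      using ppp_count[of "A j" "c j"] assms(1-3)[of j] j by simp
  qed
  finally show ?thesis .
qed

end

text \<open>
  For \<open>b \<ge> 1\<close> the derivative of the \<open>b\<close>-th summand is
  \<open>gumbel_density (b + 1) - gumbel_density b\<close>, and for \<open>b = 0\<close> it is
  \<open>gumbel_density 1\<close>, so the sum telescopes.
\<close>

lemma gumbel_cdf_deriv:
  "((\<lambda>s. \<Sum>b\<le>l. exp (- s) ^ b / fact b * exp (- exp (- s))) has_real_derivative gumbel_density (l + 1) s) (at s)"
proof (induction l)
  case 0
  show ?case by (auto intro!: derivative_eq_intros simp: gumbel_density_def exp_add[symmetric] algebra_simps)
next
  case (Suc l)
  have g: "gumbel_density (Suc k) s = exp (- s) ^ Suc k * exp (- exp (- s)) / fact k" for k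
  proof -
    have "exp (- real (Suc k) * s - exp (- s)) = exp (real (Suc k) * (- s) + (- exp (- s)))"
      by (rule arg_cong[where f = exp]) (simp only: minus_mult_left[symmetric] minus_mult_right[symmetric] diff_conv_add_uminus)
    also have "\<dots> = exp (- s) ^ Suc k * exp (- exp (- s))"
      unfolding exp_add exp_of_nat_mult ..
    finally show ?thesis by (simp add: gumbel_density_def)
  qed
  have d1: "((\<lambda>s. exp (- s)) has_real_derivative - exp (- s)) (at s)"
    by (auto intro!: derivative_eq_intros)
  have d2: "((\<lambda>s. exp (- exp (- s))) has_real_derivative exp (- exp (- s)) * exp (- s)) (at s)"
    by (auto intro!: derivative_eq_intros)
  note d3 = DERIV_mult[OF DERIV_cdivide[OF DERIV_power[OF d1, of "Suc l"], of "fact (Suc l)"] d2]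
  have "((\<lambda>s. exp (- s) ^ Suc l / fact (Suc l) * exp (- exp (- s))) has_real_derivative
     (gumbel_density (Suc l + 1) s - gumbel_density (l + 1) s)) (at s)"
  proof (rule DERIV_cong[OF d3])
    have alg: "x * (- q * p) / (x * f) * e + e * q * (q * p / (x * f)) = q * (q * p) * e / (x * f) - q * p * e / f"
      if "x \<noteq> 0" "f \<noteq> 0" for x f q p e :: real
      using that by (simp add: field_simps)
    show "real (Suc l) * (- exp (- s) * exp (- s) ^ (Suc l - Suc 0)) / fact (Suc l) * exp (- exp (- s)) +
        exp (- exp (- s)) * exp (- s) * (exp (- s) ^ Suc l / fact (Suc l)) =
        gumbel_density (Suc l + 1) s - gumbel_density (l + 1) s"
      using alg[of "real (Suc l)" "fact l" "exp (- s)" "exp (- s) ^ l" "exp (- exp (- s))"]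
      unfolding Suc_eq_plus1[symmetric] g fact_Suc power_Suc diff_Suc_Suc diff_zero by simp
  qed
  from DERIV_add[OF Suc this] show ?case by simp
qed

text \<open>
  This identifies the limit of the rescaled hitting time: in the limit the number of processes that are still low at
  rescaled time \<open>s\<close> is Poisson with mean \<open>exp (- s)\<close>, and the hitting time has passed iff
  that number is at most \<open>l\<close>.
\<close>

lemma gumbel_cdf:
  assumes "prob_space M" and d: "distributed M lborel \<tau> (\<lambda>s. ennreal (gumbel_density (l + 1) s))"
  shows "measure M {\<omega>\<in>space M. \<tau> \<omega> \<le> s} = poisson_prob (exp (- s)) {..l}"
proof -
  interpret prob_space M by fact
  define H where "H s = (\<Sum>b\<le>l. exp (- s) ^ b / fact b * exp (- exp (- s)))" for s :: real
  have tm: "\<tau> \<in> borel_measurable M" using distributed_measurable[OF d] by simp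
  have "emeasure M (\<tau> -` {s<..} \<inter> space M) = (\<integral>\<^sup>+x. ennreal (gumbel_density (l + 1) x) * indicator {s<..} x \<partial>lborel)"
    by (rule distributed_emeasure[OF d]) simp
  also have "\<dots> = (\<integral>\<^sup>+x. ennreal (gumbel_density (l + 1) x) * indicator {s..} x \<partial>lborel)"
    by (intro nn_integral_cong_AE) (use AE_lborel_singleton[of s] in eventually_elim, auto simp: indicator_def)
  also have "\<dots> = 1 - H s"
  proof (rule nn_integral_FTC_atLeast)
    show "gumbel_density (l + 1) \<in> borel_measurable borel" unfolding gumbel_density_def by measurable
    show "DERIV H x :> gumbel_density (l + 1) x" for x unfolding H_def by (rule gumbel_cdf_deriv)
    show "0 \<le> gumbel_density (l + 1) x" for x by (simp add: gumbel_density_def)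
    have e0: "((\<lambda>x::real. exp (- x)) \<longlongrightarrow> 0) at_top"
      by (rule filterlim_compose[OF exp_at_bot filterlim_uminus_at_bot_at_top])
    have "(H \<longlongrightarrow> (\<Sum>b\<le>l. 0 ^ b / fact b * exp (- 0))) at_top"
      unfolding H_def by (intro tendsto_intros e0) auto
    also have "(\<Sum>b\<le>l. 0 ^ b / fact b * exp (- 0)) = (\<Sum>b\<le>l. if b = 0 then 1 else 0 :: real)"
      by (intro sum.cong) auto
    also have "\<dots> = 1" by (subst sum.delta) auto
    finally show "(H \<longlongrightarrow> 1) at_top" .
  qed
  finally have e: "emeasure M (\<tau> -` {s<..} \<inter> space M) = ennreal (1 - H s)" by simp
  have H: "H s = poisson_prob (exp (- s)) {..l}"
    unfolding H_def by (subst measure_measure_pmf_finite) (auto simp: mult_ac)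
  hence "H s \<le> 1" by simp
  hence p: "prob (\<tau> -` {s<..} \<inter> space M) = 1 - H s" using e by (simp add: measure_def)
  have "{\<omega>\<in>space M. \<tau> \<omega> \<le> s} = space M - (\<tau> -` {s<..} \<inter> space M)" by auto
  moreover have "\<tau> -` {s<..} \<inter> space M \<in> sets M" by (rule measurable_sets[OF tm]) simp
  ultimately have "prob {\<omega>\<in>space M. \<tau> \<omega> \<le> s} = 1 - (1 - H s)"
    using prob_compl[of "\<tau> -` {s<..} \<inter> space M"] p by simp
  thus ?thesis using H by simp
qed

section \<open>Joint limit of low and high counts\<close>

text \<open>
  The integers above \<open>\<kappa>\<close> are split into \<open>R\<close> disjoint bins: singletons, except that
  the last bin extends to infinity. Then every set \<open>{z<..}\<close> with
  \<open>\<kappa> \<le> z < \<kappa> + R\<close> is a union of final bins.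
\<close>

definition height_bin :: "int \<Rightarrow> nat \<Rightarrow> nat \<Rightarrow> int set" where
  "height_bin \<kappa> R j = (if Suc j < R then {\<kappa> + 1 + int j} else {\<kappa> + 1 + int j..})"

lemma height_bin_disjoint:
  "i < R \<Longrightarrow> j < R \<Longrightarrow> i \<noteq> j \<Longrightarrow> height_bin \<kappa> R i \<inter> height_bin \<kappa> R j = {}"
  by (auto simp: height_bin_def)

lemma greaterThan_eq_bins:
  assumes "\<kappa> \<le> z" "z < \<kappa> + int R"
  shows "{z<..} = (\<Union>j\<in>{nat (z - \<kappa>)..<R}. height_bin \<kappa> R j)"
proof (intro equalityI subsetI)
  fix x assume x: "x \<in> {z<..}"
  define j where "j = min (R - 1) (nat (x - \<kappa> - 1))"
  have "j \<in> {nat (z - \<kappa>)..<R}" using x assms by (auto simp: j_def)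
  moreover have "x \<in> height_bin \<kappa> R j" using x assms by (auto simp: j_def height_bin_def min_def split: if_splits)
  ultimately show "x \<in> (\<Union>j\<in>{nat (z - \<kappa>)..<R}. height_bin \<kappa> R j)" by blast
next
  fix x assume "x \<in> (\<Union>j\<in>{nat (z - \<kappa>)..<R}. height_bin \<kappa> R j)"
  thus "x \<in> {z<..}" using assms by (auto simp: height_bin_def split: if_splits)
qed

lemma card_above_eq_sum_bins:
  assumes "\<kappa> \<le> z" "z < \<kappa> + int R" "finite I"
  shows "card {i\<in>I. z < h i} = (\<Sum>j\<in>{nat (z - \<kappa>)..<R}. card {i\<in>I. h i \<in> height_bin \<kappa> R j})"
proof -
  have "{i\<in>I. z < h i} = (\<Union>j\<in>{nat (z - \<kappa>)..<R}. {i\<in>I. h i \<in> height_bin \<kappa> R j})"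
    using greaterThan_eq_bins[OF assms(1,2)] by (auto simp: set_eq_iff)
  also have "card \<dots> = (\<Sum>j\<in>{nat (z - \<kappa>)..<R}. card {i\<in>I. h i \<in> height_bin \<kappa> R j})"
  proof (rule card_UN_disjoint)
    show "\<forall>i\<in>{nat (z - \<kappa>)..<R}. \<forall>j\<in>{nat (z - \<kappa>)..<R}. i \<noteq> j \<longrightarrow>
      {p\<in>I. h p \<in> height_bin \<kappa> R i} \<inter> {p\<in>I. h p \<in> height_bin \<kappa> R j} = {}"
      using height_bin_disjoint[of _ R _ \<kappa>] by fastforce
  qed (use assms in auto)
  finally show ?thesis .
qed

text \<open>
  A point \<open>x\<close> of the process gives rise to the height \<open>\<lceil>x + \<theta>\<rceil>\<close>. The
  cells translate counts of heights into counts of points in intervals, with \<open>cell_rate\<close> as their means.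
\<close>

definition cell :: "int \<Rightarrow> nat \<Rightarrow> real \<Rightarrow> nat \<Rightarrow> real set" where
  "cell \<kappa> R \<theta> j = {x. \<lceil>x + \<theta>\<rceil> \<in> height_bin \<kappa> R j}"

definition cell_rate :: "int \<Rightarrow> nat \<Rightarrow> real \<Rightarrow> nat \<Rightarrow> real" where
  "cell_rate \<kappa> R \<theta> j = exp (\<theta> - real_of_int (\<kappa> + int j)) -
     (if Suc j < R then exp (\<theta> - real_of_int (\<kappa> + int j + 1)) else 0)"

lemma cell_rate_pos: "0 < cell_rate \<kappa> R \<theta> j"
  by (auto simp: cell_rate_def)

lemma cell_eq:
  "cell \<kappa> R \<theta> j = (if Suc j < R then {real_of_int (\<kappa> + int j) - \<theta><..real_of_int (\<kappa> + int j + 1) - \<theta>}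
     else {real_of_int (\<kappa> + int j) - \<theta><..})"
proof -
  have 1: "\<lceil>x + \<theta>\<rceil> = \<kappa> + 1 + int j \<longleftrightarrow> real_of_int (\<kappa> + int j) - \<theta> < x \<and> x \<le> real_of_int (\<kappa> + int j + 1) - \<theta>" for x
    unfolding ceiling_eq_iff by (simp, linarith)
  have 2: "\<kappa> + 1 + int j \<le> \<lceil>x + \<theta>\<rceil> \<longleftrightarrow> real_of_int (\<kappa> + int j) - \<theta> < x" for x
    unfolding le_ceiling_iff by (simp, linarith)
  show ?thesis
  proof (cases "Suc j < R")
    case True
    thus ?thesis unfolding cell_def height_bin_def
      by (intro set_eqI) (simp only: if_True mem_Collect_eq singleton_iff greaterThanAtMost_iff 1)
  next
    case False
    thus ?thesis unfolding cell_def height_bin_def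
      by (intro set_eqI) (simp only: if_False mem_Collect_eq atLeast_iff greaterThan_iff 2)
  qed
qed

lemma cell_borel: "cell \<kappa> R \<theta> j \<in> sets borel"
  by (simp add: cell_eq)

lemma cell_measure: "measure exp_intensity (cell \<kappa> R \<theta> j) = cell_rate \<kappa> R \<theta> j"
  by (simp add: cell_eq cell_rate_def exp_intensity_Ioc measure_exp_intensity_greaterThan)

lemma cell_finite: "emeasure exp_intensity (cell \<kappa> R \<theta> j) < \<infinity>"
  by (simp add: cell_eq exp_intensity_Ioc(2)[simplified] emeasure_exp_intensity_greaterThan)

text \<open>
  The vectors of bin counts for which, for every \<open>i \<le> K\<close>, at most \<open>i - 1\<close> points lie
  above \<open>k i\<close>. In other words, the \<open>i\<close>-th largest point is at most \<open>k i\<close>.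
  Capping the entries at \<open>K\<close> makes the set visibly finite and loses nothing, as
  \<open>restrict_in_profiles_iff\<close> shows.
\<close>

definition profiles :: "nat \<Rightarrow> (nat \<Rightarrow> int) \<Rightarrow> int \<Rightarrow> nat \<Rightarrow> (nat \<Rightarrow> nat) set" where
  "profiles K k \<kappa> R = {c \<in> {..<R} \<rightarrow>\<^sub>E {..K}. \<forall>i\<in>{1..K}. (\<Sum>j\<in>{nat (k i - \<kappa>)..<R}. c j) \<le> i - 1}"

lemma profiles_ext:
  assumes "c \<in> profiles K k \<kappa> R" "c' \<in> extensional {..<R}" "\<And>j. j < R \<Longrightarrow> c' j = c j"
  shows "c' = c"
  using assms by (intro extensionalityI[of c' "{..<R}" c]) (auto simp: profiles_def PiE_def)

lemma profiles_extensional: "c \<in> profiles K k \<kappa> R \<Longrightarrow> c \<in> extensional {..<R}"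
  by (simp add: profiles_def PiE_def)

lemma finite_profiles: "finite (profiles K k \<kappa> R)"
  unfolding profiles_def by (rule finite_subset[OF _ finite_PiE[of "{..<R}" "\<lambda>_. {..K}"]]) auto

text \<open>
  The constraint whose threshold is the base level \<open>\<kappa>\<close> bounds the sum of all entries, and so
  enforces the cap. The anchor is demanded only if there are bins at all; the case without bins and without
  constraints is used for the low counts alone.
\<close>

lemma restrict_in_profiles_iff:
  assumes anchor: "0 < R \<Longrightarrow> \<exists>i0\<in>{1..K}. k i0 = \<kappa>"
  shows "restrict c {..<R} \<in> profiles K k \<kappa> R \<longleftrightarrow> (\<forall>i\<in>{1..K}. (\<Sum>j\<in>{nat (k i - \<kappa>)..<R}. c j) \<le> i - 1)"
proof -
  have eq: "(\<Sum>j\<in>{a..<R}. restrict c {..<R} j) = (\<Sum>j\<in>{a..<R}. c j)" for a by (intro sum.cong) auto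
  have "restrict c {..<R} \<in> {..<R} \<rightarrow>\<^sub>E {..K}" if *: "\<forall>i\<in>{1..K}. (\<Sum>j\<in>{nat (k i - \<kappa>)..<R}. c j) \<le> i - 1"
  proof (rule restrict_PiE_iff[THEN iffD2], rule ballI)
    fix j assume j: "j \<in> {..<R}"
    then obtain i0 where i0: "i0 \<in> {1..K}" "k i0 = \<kappa>" using anchor by fastforce
    have "c j \<le> (\<Sum>j\<in>{0..<R}. c j)" using j by (intro member_le_sum) auto
    also have "\<dots> \<le> i0 - 1" using *[rule_format, OF i0(1)] i0(2) by simp
    also have "\<dots> \<le> K" using i0(1) unfolding atLeastAtMost_iff by linarith
    finally show "c j \<in> {..K}" by simp
  qed
  thus ?thesis unfolding profiles_def mem_Collect_eq eq by blast
qed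

context exp_ppp begin

text \<open>
  Almost surely all cell counts are finite integers, and then the constraints hold iff the vector of cell counts is
  one of the profiles.
\<close>

lemma counts_above_law:
  assumes anchor: "0 < R \<Longrightarrow> \<exists>i0\<in>{1..K}. k i0 = \<kappa>" and k: "\<And>i. i \<in> {1..K} \<Longrightarrow> \<kappa> \<le> k i \<and> k i < \<kappa> + int R"
  shows "prob {\<omega>\<in>space M. \<forall>i\<in>{1..K}. emeasure (\<Xi> \<omega>) {real_of_int (k i) - \<theta><..} \<le> of_nat (i - 1)}
    = (\<Sum>c\<in>profiles K k \<kappa> R. \<Prod>j<R. pmf (poisson_pmf (cell_rate \<kappa> R \<theta> j)) (c j))"
proof -
  let ?A = "cell \<kappa> R \<theta>"
  let ?E = "{\<omega>\<in>space M. \<forall>i\<in>{1..K}. emeasure (\<Xi> \<omega>) {real_of_int (k i) - \<theta><..} \<le> of_nat (i - 1)}"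
  define V where "V c = {\<omega>\<in>space M. \<forall>j<R. emeasure (\<Xi> \<omega>) (?A j) = of_nat (c j)}" for c :: "nat \<Rightarrow> nat"
  have Vs: "V c \<in> sets M" for c
  proof -
    have "V c = {\<omega>\<in>space M. \<forall>j\<in>{..<R}. emeasure (\<Xi> \<omega>) (?A j) \<in> {of_nat (c j)}}" by (auto simp: V_def)
    also have "\<dots> \<in> sets M" by (intro sets.sets_Collect_finite_All ppp_event cell_borel) auto
    finally show ?thesis .
  qed
  have Es: "?E \<in> sets M"
  proof -
    have "?E = {\<omega>\<in>space M. \<forall>i\<in>{1..K}. emeasure (\<Xi> \<omega>) {real_of_int (k i) - \<theta><..} \<in> {..of_nat (i - 1)}}" by auto
    also have "\<dots> \<in> sets M" by (intro sets.sets_Collect_finite_All ppp_event) auto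
    finally show ?thesis .
  qed
  have disj: "disjoint_family_on ?A {..<R}"
    using height_bin_disjoint[of _ R _ \<kappa>] unfolding disjoint_family_on_def cell_def by blast
  have tot: "emeasure (\<Xi> \<omega>) {real_of_int (k i) - \<theta><..} = (\<Sum>j\<in>{nat (k i - \<kappa>)..<R}. emeasure (\<Xi> \<omega>) (?A j))"
    if w: "\<omega> \<in> space M" and i: "i \<in> {1..K}" for \<omega> i
  proof -
    have "{real_of_int (k i) - \<theta><..} = {x. \<lceil>x + \<theta>\<rceil> \<in> {k i<..}}" by (auto simp: less_ceiling_iff)
    also have "\<dots> = (\<Union>j\<in>{nat (k i - \<kappa>)..<R}. ?A j)"
      using greaterThan_eq_bins[of \<kappa> "k i" R] k[OF i] unfolding cell_def by blast
    finally have "emeasure (\<Xi> \<omega>) {real_of_int (k i) - \<theta><..} = emeasure (\<Xi> \<omega>) (\<Union>j\<in>{nat (k i - \<kappa>)..<R}. ?A j)" by simp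
    also have "\<dots> = (\<Sum>j\<in>{nat (k i - \<kappa>)..<R}. emeasure (\<Xi> \<omega>) (?A j))"
      by (intro sum_emeasure[symmetric] disjoint_family_on_mono[OF _ disj])
        (auto simp: sets_ppp[OF w] cell_borel)
    finally show ?thesis .
  qed
  have "AE \<omega> in M. \<forall>j\<in>{..<R}. emeasure (\<Xi> \<omega>) (?A j) \<in> range of_nat"
    by (intro AE_finite_allI ppp_AE_integer cell_borel cell_finite) auto
  hence "AE \<omega> in M. \<omega> \<in> ?E \<longleftrightarrow> \<omega> \<in> (\<Union>c\<in>profiles K k \<kappa> R. V c)"
    using AE_space
  proof eventually_elim
    case (elim \<omega>)
    have "\<forall>j\<in>{..<R}. \<exists>n::nat. emeasure (\<Xi> \<omega>) (?A j) = of_nat n" using elim(1) by blast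
    then obtain d :: "nat \<Rightarrow> nat" where d: "\<forall>j\<in>{..<R}. emeasure (\<Xi> \<omega>) (?A j) = of_nat (d j)" by metis
    have "emeasure (\<Xi> \<omega>) {real_of_int (k i) - \<theta><..} = of_nat (\<Sum>j\<in>{nat (k i - \<kappa>)..<R}. d j)" if "i \<in> {1..K}" for i
      unfolding tot[OF elim(2) that] of_nat_sum using d by (intro sum.cong) auto
    hence "\<omega> \<in> ?E \<longleftrightarrow> (\<forall>i\<in>{1..K}. (\<Sum>j\<in>{nat (k i - \<kappa>)..<R}. d j) \<le> i - 1)"
      using elim(2) by (simp del: of_nat_sum)
    also have "\<dots> \<longleftrightarrow> restrict d {..<R} \<in> profiles K k \<kappa> R"
      by (rule restrict_in_profiles_iff[OF anchor, symmetric])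
    also have "\<dots> \<longleftrightarrow> \<omega> \<in> (\<Union>c\<in>profiles K k \<kappa> R. V c)"
    proof
      assume "restrict d {..<R} \<in> profiles K k \<kappa> R"
      moreover have "\<omega> \<in> V (restrict d {..<R})" using d elim(2) by (simp add: V_def)
      ultimately show "\<omega> \<in> (\<Union>c\<in>profiles K k \<kappa> R. V c)" by blast
    next
      assume "\<omega> \<in> (\<Union>c\<in>profiles K k \<kappa> R. V c)"
      then obtain c where c: "c \<in> profiles K k \<kappa> R" "\<omega> \<in> V c" by blast
      have "restrict d {..<R} = c"
      proof (rule profiles_ext[OF c(1)])
        fix j assume j: "j < R"
        have "emeasure (\<Xi> \<omega>) (?A j) = of_nat (d j)" using d j by simp
        moreover have "emeasure (\<Xi> \<omega>) (?A j) = of_nat (c j)" using c(2) j by (simp add: V_def)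
        ultimately have "(of_nat (d j) :: ennreal) = of_nat (c j)" by (rule trans[OF sym])
        thus "restrict d {..<R} j = c j" using j by simp
      qed simp
      thus "restrict d {..<R} \<in> profiles K k \<kappa> R" using c(1) by simp
    qed
    finally show ?case .
  qed
  hence "prob ?E = prob (\<Union>c\<in>profiles K k \<kappa> R. V c)"
    using Es Vs finite_profiles by (intro finite_measure_eq_AE) (auto intro!: sets.finite_UN)
  also have "\<dots> = (\<Sum>c\<in>profiles K k \<kappa> R. prob (V c))"
  proof (rule finite_measure_finite_Union[OF finite_profiles])
    show "disjoint_family_on V (profiles K k \<kappa> R)"
      unfolding disjoint_family_on_def
    proof (intro ballI impI)
      fix c c' assume cc: "c \<in> profiles K k \<kappa> R" "c' \<in> profiles K k \<kappa> R" "c \<noteq> c'"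
      have "c' = c" if w: "\<omega> \<in> V c" "\<omega> \<in> V c'" for \<omega>
      proof (rule profiles_ext[OF cc(1) profiles_extensional[OF cc(2)]])
        fix j assume j: "j < R"
        have "emeasure (\<Xi> \<omega>) (?A j) = of_nat (c' j)" using w(2) j by (simp add: V_def)
        moreover have "emeasure (\<Xi> \<omega>) (?A j) = of_nat (c j)" using w(1) j by (simp add: V_def)
        ultimately have "(of_nat (c' j) :: ennreal) = of_nat (c j)" by (rule trans[OF sym])
        thus "c' j = c j" by simp
      qed
      thus "V c \<inter> V c' = {}" using cc(3) by blast
    qed
  qed (use Vs in auto)
  also have "\<dots> = (\<Sum>c\<in>profiles K k \<kappa> R. \<Prod>j<R. pmf (poisson_pmf (cell_rate \<kappa> R \<theta> j)) (c j))"
    unfolding V_def using cell_rate_pos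
    by (intro sum.cong[OF refl]) (subst ppp_joint_counts; simp add: cell_borel cell_finite[simplified] cell_measure disj)
  finally show ?thesis .
qed

end

lemma measure_pmf_tail_to_zero:
  fixes p :: "nat pmf"
  shows "(\<lambda>a. measure (measure_pmf p) {a..}) \<longlonglongrightarrow> 0"
proof -
  have "(\<lambda>a. measure (measure_pmf p) {a..}) \<longlonglongrightarrow> measure (measure_pmf p) (\<Inter>a. {a..})"
    by (rule measure_pmf.finite_Lim_measure_decseq) (auto simp: decseq_def)
  also have "(\<Inter>a::nat. {a..}) = {}"
  proof -
    have "x \<notin> (\<Inter>a::nat. {a..})" for x :: nat by (auto intro!: exI[of _ "Suc x"])
    thus ?thesis by blast
  qed
  finally show ?thesis by simp
qed

lemma measure_poisson_bin:
  fixes t :: real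
  shows "poisson_prob t {x. int x - b \<in> height_bin \<kappa> R j} =
    poisson_prob t {x. b + (\<kappa> + int j) < int x} -
     (if Suc j < R then poisson_prob t {x. b + (\<kappa> + int j + 1) < int x} else 0)"
proof (cases "Suc j < R")
  case True
  have "{x. int x - b \<in> height_bin \<kappa> R j} = {x. b + (\<kappa> + int j) < int x} - {x. b + (\<kappa> + int j + 1) < int x}"
    using True by (auto simp: height_bin_def)
  moreover have "poisson_prob t ({x. b + (\<kappa> + int j) < int x} - {x. b + (\<kappa> + int j + 1) < int x}) =
    poisson_prob t {x. b + (\<kappa> + int j) < int x} - poisson_prob t {x. b + (\<kappa> + int j + 1) < int x}"
    by (intro measure_pmf.finite_measure_Diff) auto
  ultimately show ?thesis using True by simp
next
  case False
  hence "{x. int x - b \<in> height_bin \<kappa> R j} = {x. b + (\<kappa> + int j) < int x}" by (auto simp: height_bin_def)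
  thus ?thesis using False by simp
qed

context poisson_family begin

lemma count_fibre_event:
  assumes "0 \<le> s" "0 \<le> t" and J: "finite J"
  shows "{\<omega>\<in>space M. \<forall>j\<in>J. card {i\<in>{1..n}. (N i s \<omega>, N i t \<omega>) \<in> E j} = c j} \<in> sets M"
proof -
  have ev: "{\<omega>\<in>space M. (N i s \<omega>, N i t \<omega>) \<in> A} \<in> sets M" if "i \<in> {1..n}" for i A
  proof -
    have "(\<lambda>\<omega>. (N i s \<omega>, N i t \<omega>)) \<in> measurable M (count_space UNIV)"
      using indep_pairs[OF assms(1,2), of n] that by (simp add: indep_vars_def)
    from measurable_sets[OF this, of A]
    have "(\<lambda>\<omega>. (N i s \<omega>, N i t \<omega>)) -` A \<inter> space M \<in> sets M" by (simp only: sets_count_space Pow_UNIV UNIV_I simp_thms)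
    moreover have "{\<omega>\<in>space M. (N i s \<omega>, N i t \<omega>) \<in> A} = (\<lambda>\<omega>. (N i s \<omega>, N i t \<omega>)) -` A \<inter> space M" by blast
    ultimately show ?thesis by (simp only:)
  qed
  have "{\<omega>\<in>space M. card {i\<in>{1..n}. (N i s \<omega>, N i t \<omega>) \<in> A} = x} \<in> sets M" for A x
  proof -
    have "(\<lambda>\<omega>. card {i\<in>{1..n}. (N i s \<omega>, N i t \<omega>) \<in> A}) \<in> measurable M (count_space UNIV)"
      unfolding card_filter_eq_sum[OF finite_atLeastAtMost]
    proof (intro measurable_sum_nat measurable_If)
      fix i assume "i \<in> {1..n}"
      thus "{\<omega> \<in> space M. (N i s \<omega>, N i t \<omega>) \<in> A} \<in> sets M" by (rule ev)
    qed auto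
    hence "(\<lambda>\<omega>. card {i\<in>{1..n}. (N i s \<omega>, N i t \<omega>) \<in> A}) -` {x} \<inter> space M \<in> sets M"
      by (rule measurable_sets) simp
    moreover have "{\<omega>\<in>space M. card {i\<in>{1..n}. (N i s \<omega>, N i t \<omega>) \<in> A} = x} =
       (\<lambda>\<omega>. card {i\<in>{1..n}. (N i s \<omega>, N i t \<omega>) \<in> A}) -` {x} \<inter> space M" by blast
    ultimately show ?thesis by (simp only:)
  qed
  thus ?thesis by (intro sets.sets_Collect_finite_All[OF _ J])
qed

text \<open>
  If the high level is tested first, monotonicity excludes the event for large \<open>n\<close>. If it is tested
  later, the process must climb to a level that tends to infinity within a bounded time, which makes the event
  negligible in comparison with being low.
\<close>

lemma low_and_high_rare:
  "(\<lambda>n. \<Sum>i\<in>{1..n}. prob {\<omega>\<in>space M. N i (time_at m n s) \<omega> \<le> m \<and> \<lfloor>centering m n\<rfloor> + \<kappa> < int (N i (time_at m n s') \<omega>)}) \<longlonglongrightarrow> 0"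
proof -
  let ?E = "\<lambda>n i. {\<omega>\<in>space M. N i (time_at m n s) \<omega> \<le> m \<and> \<lfloor>centering m n\<rfloor> + \<kappa> < int (N i (time_at m n s') \<omega>)}"
  define v where "v n = nat (\<lfloor>centering m n\<rfloor> + \<kappa> + 1)" for n
  have vinf: "filterlim (\<lambda>n. v n - m) at_top sequentially"
    unfolding filterlim_at_top
  proof
    fix Z :: nat
    have "\<forall>\<^sub>F n in sequentially. centering m n \<ge> real Z + real m + \<bar>real_of_int \<kappa>\<bar> + 1"
      using centering_at_top[of m] by (auto simp: filterlim_at_top)
    thus "\<forall>\<^sub>F n in sequentially. Z \<le> v n - m"
    proof eventually_elim
      case (elim n)
      hence "\<lfloor>centering m n\<rfloor> \<ge> int Z + int m + \<bar>\<kappa>\<bar>" by linarith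
      thus ?case by (simp add: v_def)
    qed
  qed
  have vm: "\<forall>\<^sub>F n in sequentially. m < v n"
    using vinf[unfolded filterlim_at_top, rule_format, of 1] by eventually_elim simp
  have cond: "\<lfloor>centering m n\<rfloor> + \<kappa> < int x \<longleftrightarrow> v n \<le> x" if "m < v n" for n x
    using that by (auto simp: v_def)
  show ?thesis
  proof (cases "s' \<le> s")
    case True
    have "\<forall>\<^sub>F n in sequentially. 0 = (\<Sum>i\<in>{1..n}. prob (?E n i))"
      using vm
    proof eventually_elim
      case (elim n)
      have "?E n i = {}"
        if i: "i \<in> {1..n}" for i
      proof -
        have "N i (time_at m n s') \<omega> \<le> N i (time_at m n s) \<omega>" if "\<omega> \<in> space M" for \<omega>
          using i by (intro poisson_paths.N_mono[OF paths[OF that]] time_at_nonneg time_at_mono True) simp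
        thus ?thesis unfolding cond[OF elim] using elim by fastforce
      qed
      thus ?case by (intro sum.neutral[symmetric] ballI) (simp only: measure_empty)
    qed
    thus ?thesis by (rule Lim_transform_eventually[OF tendsto_const])
  next
    case False
    define d where "d = s' - s"
    show ?thesis
    proof (rule Lim_null_comparison)
      have "(\<lambda>n. poisson_prob d {v n - m..}) \<longlonglongrightarrow> 0"
        by (rule filterlim_compose[OF measure_pmf_tail_to_zero vinf])
      hence "(\<lambda>n. real n * poisson_prob (time_at m n s) {..m} * poisson_prob d {v n - m..})
        \<longlonglongrightarrow> exp (- s) * 0" by (intro tendsto_mult low_rate)
      thus "(\<lambda>n. real n * poisson_prob (time_at m n s) {..m} * poisson_prob d {v n - m..}) \<longlonglongrightarrow> 0"
        by simp
      show "\<forall>\<^sub>F n in sequentially. norm (\<Sum>i\<in>{1..n}. prob (?E n i))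
         \<le> real n * poisson_prob (time_at m n s) {..m} * poisson_prob d {v n - m..}"
        using vm time_at_eventually[of m s] time_at_eventually[of m s']
      proof eventually_elim
        case (elim n)
        have t: "0 < time_at m n s" "time_at m n s < time_at m n s'" "time_at m n s' - time_at m n s = d"
          using elim False by (auto simp: d_def)
        have "norm (\<Sum>i\<in>{1..n}. prob (?E n i))
          = (\<Sum>i\<in>{1..n}. prob {\<omega>\<in>space M. N i (time_at m n s) \<omega> \<le> m \<and> v n \<le> N i (time_at m n s') \<omega>})"
          unfolding cond[OF elim(1)] real_norm_def by (intro abs_of_nonneg sum_nonneg) simp
        also have "\<dots> \<le> (\<Sum>i\<in>{1..n}. poisson_prob (time_at m n s) {..m} * poisson_prob d {v n - m..})"
        proof (rule sum_mono)
          fix i assume "i \<in> {1..n}"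
          hence "i \<ge> 1" by simp
          from prob_low_then_high[OF this t(1,2)]
          show "prob {\<omega>\<in>space M. N i (time_at m n s) \<omega> \<le> m \<and> v n \<le> N i (time_at m n s') \<omega>}
            \<le> poisson_prob (time_at m n s) {..m} * poisson_prob d {v n - m..}"
            unfolding t(3) .
        qed
        finally show ?case by (simp add: mult_ac)
      qed
    qed
  qed
qed

text \<open>
  The rare events are the bins \<open>j < R\<close> for the heights at time \<open>s'\<close> and, as the event with
  index \<open>R\<close>, being low at time \<open>s\<close>. The probability in question is a finite sum of
  probabilities of count vectors, to which \<open>rare_events_poisson_limit\<close> applies.
\<close>

theorem low_high_joint_limit:
  assumes anchor: "0 < R \<Longrightarrow> \<exists>i0\<in>{1..K}. k i0 = \<kappa>" and k: "\<And>i. i \<in> {1..K} \<Longrightarrow> \<kappa> \<le> k i \<and> k i < \<kappa> + int R"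
  shows "(\<lambda>n. prob {\<omega>\<in>space M. card {i\<in>{1..n}. \<not> m < N i (time_at m n s) \<omega>} \<le> l \<and>
       (\<forall>i\<in>{1..K}. card {j\<in>{1..n}. \<lfloor>centering m n\<rfloor> + k i < int (N j (time_at m n s') \<omega>)} \<le> i - 1)}
     - poisson_prob (exp (- s)) {..l} *
       (\<Sum>c\<in>profiles K k \<kappa> R. \<Prod>j<R. pmf (poisson_pmf (cell_rate \<kappa> R ((exp 1 - 1) * s' + frac (centering m n)) j)) (c j))) \<longlonglongrightarrow> 0"
proof -
  define b where "b n = \<lfloor>centering m n\<rfloor>" for n
  define \<theta> where "\<theta> n = (exp 1 - 1) * s' + frac (centering m n)" for n
  define rate where "rate n j = (if j < R then cell_rate \<kappa> R (\<theta> n) j else exp (- s))" for n j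
  define Z where "Z n i \<omega> = (N i (time_at m n s) \<omega>, N i (time_at m n s') \<omega>)" for n i \<omega>
  define E where "E n j = (if j < R then {(x :: nat, y). int y - b n \<in> height_bin \<kappa> R j} else {(x, y). x \<le> m})" for n j
  have lim: "(\<lambda>n. prob {\<omega>\<in>space M. \<forall>j\<in>{..R}. card {i\<in>{1..n}. Z n i \<omega> \<in> E n j} = c j}
     - (\<Prod>j\<in>{..R}. pmf (poisson_pmf (rate n j)) (c j))) \<longlonglongrightarrow> 0" for c
  proof (rule rare_events_poisson_limit)
    show "indep_vars (\<lambda>_. count_space UNIV) (Z n) {1..n}" for n
      unfolding Z_def by (rule indep_pairs[OF time_at_nonneg time_at_nonneg])
    show "0 < rate n j" for n j using cell_rate_pos by (simp add: rate_def)
    show "rate n j \<le> exp ((exp 1 - 1) * s' + 1 + \<bar>real_of_int \<kappa>\<bar>) + exp (- s)" for n j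
    proof (cases "j < R")
      case True
      have "cell_rate \<kappa> R (\<theta> n) j \<le> exp (\<theta> n - real_of_int (\<kappa> + int j))" by (simp add: cell_rate_def)
      also have "\<dots> \<le> exp ((exp 1 - 1) * s' + 1 + \<bar>real_of_int \<kappa>\<bar>)"
        unfolding exp_le_cancel_iff \<theta>_def using frac_lt_1[of "centering m n"] by simp
      finally show ?thesis using True by (simp add: rate_def add_increasing2)
    qed (simp add: rate_def)
    fix j assume j: "j \<in> {..R}"
    show "(\<lambda>n. \<Sum>i\<in>{1..n}. \<bar>prob (Z n i -` E n j \<inter> space M) - rate n j / real n\<bar>) \<longlonglongrightarrow> 0"
    proof -
      define P where "P n = (if j < R then poisson_prob (time_at m n s') {x. int x - b n \<in> height_bin \<kappa> R j}
         else poisson_prob (time_at m n s) {..m})" for n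
      have "(\<lambda>n. real n * P n - rate n j) \<longlonglongrightarrow> 0"
      proof (cases "j < R")
        case True
        define err where "err n z = real n * poisson_prob (time_at m n s') {x. b n + z < int x} - exp (\<theta> n - real_of_int z)" for n z
        have h: "(\<lambda>n. err n z) \<longlonglongrightarrow> 0" for z
          unfolding err_def b_def \<theta>_def by (rule high_rate)
        have "(\<lambda>n. err n (\<kappa> + int j)
          - (if Suc j < R then err n (\<kappa> + int j + 1) else 0))
          \<longlonglongrightarrow> 0 - (if Suc j < R then 0 else 0)"
        proof (rule tendsto_diff[OF h])
          show "(\<lambda>n. if Suc j < R then err n (\<kappa> + int j + 1) else 0)
            \<longlonglongrightarrow> (if Suc j < R then 0 else 0)" 
            using h[of "\<kappa> + int j + 1"] by (cases "Suc j < R") (simp_all only: if_True if_False tendsto_const)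
        qed
        moreover have "real n * P n - rate n j = err n (\<kappa> + int j)
          - (if Suc j < R then err n (\<kappa> + int j + 1) else 0)" for n
          using True by (simp add: err_def P_def rate_def measure_poisson_bin cell_rate_def right_diff_distrib)
        ultimately show ?thesis by simp
      next
        case False
        have "(\<lambda>n. real n * poisson_prob (time_at m n s) {..m} - exp (- s)) \<longlonglongrightarrow> exp (- s) - exp (- s)"
          by (intro tendsto_diff low_rate tendsto_const)
        thus ?thesis using False by (simp add: P_def rate_def)
      qed
      hence lim: "(\<lambda>n. \<bar>real n * P n - rate n j\<bar>) \<longlonglongrightarrow> 0" by (rule tendsto_rabs_zero)
      show ?thesis
      proof (rule Lim_transform_eventually[OF lim])
        show "\<forall>\<^sub>F n in sequentially. \<bar>real n * P n - rate n j\<bar> = (\<Sum>i\<in>{1..n}. \<bar>prob (Z n i -` E n j \<inter> space M) - rate n j / real n\<bar>)"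
          using time_at_eventually[of m s] time_at_eventually[of m s'] eventually_gt_at_top[of 0]
        proof eventually_elim
          case (elim n)
          have "prob (Z n i -` E n j \<inter> space M) = P n" if "i \<in> {1..n}" for i
          proof -
            have i: "i \<ge> 1" using that by simp
            have "Z n i -` E n j \<inter> space M = (if j < R then {\<omega>\<in>space M. N i (time_at m n s') \<omega> \<in> {x. int x - b n \<in> height_bin \<kappa> R j}}
                else {\<omega>\<in>space M. N i (time_at m n s) \<omega> \<in> {..m}})"
              by (auto simp: Z_def E_def)
            moreover have "0 < time_at m n s'" "0 < time_at m n s" using elim by blast+
            note prob_N[OF i this(1), of "{x. int x - b n \<in> height_bin \<kappa> R j}"] prob_N[OF i this(2), of "{..m}"]
            ultimately show ?thesis by (cases "j < R") (simp_all only: P_def if_True if_False)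
          qed
          hence "(\<Sum>i\<in>{1..n}. \<bar>prob (Z n i -` E n j \<inter> space M) - rate n j / real n\<bar>) = (\<Sum>i\<in>{1..n}. \<bar>P n - rate n j / real n\<bar>)"
            by (intro sum.cong) auto
          also have "\<dots> = \<bar>real n * (P n - rate n j / real n)\<bar>" by (simp add: abs_mult)
          also have "real n * (P n - rate n j / real n) = real n * P n - rate n j" using elim by (simp add: right_diff_distrib)
          finally show ?case ..
        qed
      qed
    qed
    fix j' assume j': "j' \<in> {..R}" "j \<noteq> j'"
    let ?LH = "\<lambda>n i. {\<omega>\<in>space M. N i (time_at m n s) \<omega> \<le> m \<and> \<lfloor>centering m n\<rfloor> + \<kappa> < int (N i (time_at m n s') \<omega>)}"
    have main: "(\<lambda>n. \<Sum>i\<in>{1..n}. prob (Z n i -` (E n p \<inter> E n R) \<inter> space M)) \<longlonglongrightarrow> 0" if p: "p < R" for p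
    proof (rule Lim_null_comparison[OF _ low_and_high_rare[of m s \<kappa> s']])
      show "\<forall>\<^sub>F n in sequentially. norm (\<Sum>i\<in>{1..n}. prob (Z n i -` (E n p \<inter> E n R) \<inter> space M)) \<le>
        (\<Sum>i\<in>{1..n}. prob (?LH n i))"
      proof (rule always_eventually, rule allI)
        fix n
        have "prob (Z n i -` (E n p \<inter> E n R) \<inter> space M) \<le> prob (?LH n i)"
          if i: "i \<in> {1..n}" for i
        proof (rule finite_measure_mono)
          show "Z n i -` (E n p \<inter> E n R) \<inter> space M \<subseteq> ?LH n i"
            using p by (auto simp: Z_def E_def b_def height_bin_def split: if_splits)
          have "?LH n i
            = {\<omega>\<in>space M. N i (time_at m n s) \<omega> \<le> m} \<inter> {\<omega>\<in>space M. \<lfloor>centering m n\<rfloor> + \<kappa> < int (N i (time_at m n s') \<omega>)}" by blast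
          also have "\<dots> \<in> sets M"
            using N_event[of i "time_at m n s" "\<lambda>x. x \<le> m"] N_event[of i "time_at m n s'" "\<lambda>x. \<lfloor>centering m n\<rfloor> + \<kappa> < int x"] i time_at_nonneg
            by (intro sets.Int) auto
          finally show "?LH n i \<in> sets M" .
        qed
        thus "norm (\<Sum>i\<in>{1..n}. prob (Z n i -` (E n p \<inter> E n R) \<inter> space M)) \<le>
          (\<Sum>i\<in>{1..n}. prob (?LH n i))"
          unfolding real_norm_def by (subst abs_of_nonneg) (auto intro!: sum_nonneg sum_mono)
      qed
    qed
    show "(\<lambda>n. \<Sum>i\<in>{1..n}. prob (Z n i -` (E n j \<inter> E n j') \<inter> space M)) \<longlonglongrightarrow> 0"
    proof -
      consider "j < R" "j' < R" | "j < R" "j' = R" | "j = R" "j' < R" using j j' by fastforce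
      thus ?thesis
      proof cases
        case 1
        hence "E n j \<inter> E n j' = {}" for n using height_bin_disjoint[of j R j' \<kappa>] j' by (auto simp: E_def)
        thus ?thesis by simp
      next
        case 2 thus ?thesis using main[of j] by simp
      next
        case 3 thus ?thesis using main[of j'] by (simp add: Int_commute)
      qed
    qed
  qed auto
  let ?F = "{..l} \<times> profiles K k \<kappa> R"
  define V where "V n q = {\<omega>\<in>space M. \<forall>j\<in>{..R}. card {i\<in>{1..n}. Z n i \<omega> \<in> E n j} = ((snd q)(R := fst q)) j}" for n and q :: "nat \<times> (nat \<Rightarrow> nat)"
  have finF: "finite ?F" using finite_profiles by simp
  have Vs: "V n q \<in> sets M" for n q
    unfolding V_def Z_def by (rule count_fibre_event[OF time_at_nonneg time_at_nonneg]) simp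
  have Vdisj: "disjoint_family_on (V n) ?F" for n
    unfolding disjoint_family_on_def
  proof (intro ballI impI)
    fix q q' assume q: "q \<in> ?F" "q' \<in> ?F" "q \<noteq> q'"
    have "q = q'" if w: "\<omega> \<in> V n q" "\<omega> \<in> V n q'" for \<omega>
    proof -
      have eq: "((snd q)(R := fst q)) j = ((snd q')(R := fst q')) j" if "j \<le> R" for j
      proof -
        have "card {i\<in>{1..n}. Z n i \<omega> \<in> E n j} = ((snd q)(R := fst q)) j"
          using w(1) that unfolding V_def mem_Collect_eq atMost_iff[symmetric] by blast
        moreover have "card {i\<in>{1..n}. Z n i \<omega> \<in> E n j} = ((snd q')(R := fst q')) j"
          using w(2) that unfolding V_def mem_Collect_eq atMost_iff[symmetric] by blast
        ultimately show ?thesis by (rule trans[OF sym])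
      qed
      have "fst q = fst q'" using eq[of R] by simp
      moreover have "snd q = snd q'"
      proof (rule profiles_ext)
        show "snd q' \<in> profiles K k \<kappa> R" using q(2) by auto
        show "snd q \<in> extensional {..<R}" using q(1) by (intro profiles_extensional[of _ K k \<kappa>]) auto
        show "snd q j = snd q' j" if "j < R" for j using eq[of j] that by simp
      qed
      ultimately show ?thesis by (rule prod_eqI)
    qed
    thus "V n q \<inter> V n q' = {}" using q(3) by blast
  qed
  have ev: "{\<omega>\<in>space M. card {i\<in>{1..n}. \<not> m < N i (time_at m n s) \<omega>} \<le> l \<and>
       (\<forall>i\<in>{1..K}. card {j\<in>{1..n}. b n + k i < int (N j (time_at m n s') \<omega>)} \<le> i - 1)} = (\<Union>q\<in>?F. V n q)" (is "?L = ?U") for n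
  proof (rule set_eqI)
    fix \<omega>
    define C where "C j = card {i\<in>{1..n}. Z n i \<omega> \<in> E n j}" for j
    have low: "card {i\<in>{1..n}. \<not> m < N i (time_at m n s) \<omega>} = C R"
      unfolding C_def by (intro arg_cong[where f = card]) (auto simp: Z_def E_def)
    have high: "card {j\<in>{1..n}. b n + k i < int (N j (time_at m n s') \<omega>)} = (\<Sum>j\<in>{nat (k i - \<kappa>)..<R}. C j)" if "i \<in> {1..K}" for i
    proof -
      have "{j\<in>{1..n}. b n + k i < int (N j (time_at m n s') \<omega>)} = {j\<in>{1..n}. k i < int (N j (time_at m n s') \<omega>) - b n}" by auto
      also have "card \<dots> = (\<Sum>j\<in>{nat (k i - \<kappa>)..<R}. card {p\<in>{1..n}. int (N p (time_at m n s') \<omega>) - b n \<in> height_bin \<kappa> R j})"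
        using k[OF that] by (intro card_above_eq_sum_bins) auto
      also have "\<dots> = (\<Sum>j\<in>{nat (k i - \<kappa>)..<R}. C j)"
        by (intro sum.cong) (auto simp: C_def Z_def E_def)
      finally show ?thesis .
    qed
    have "\<omega> \<in> ?L \<longleftrightarrow> \<omega> \<in> space M \<and> C R \<le> l \<and> (\<forall>i\<in>{1..K}. (\<Sum>j\<in>{nat (k i - \<kappa>)..<R}. C j) \<le> i - 1)"
      using low high by auto
    also have "\<dots> \<longleftrightarrow> \<omega> \<in> space M \<and> C R \<le> l \<and> restrict C {..<R} \<in> profiles K k \<kappa> R"
      by (simp only: restrict_in_profiles_iff[OF anchor])
    also have "\<dots> \<longleftrightarrow> \<omega> \<in> ?U"
    proof
      assume *: "\<omega> \<in> space M \<and> C R \<le> l \<and> restrict C {..<R} \<in> profiles K k \<kappa> R"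
      have "\<omega> \<in> V n (C R, restrict C {..<R})" using * by (auto simp: V_def C_def)
      thus "\<omega> \<in> ?U" using * by blast
    next
      assume "\<omega> \<in> ?U"
      then obtain p c where pc: "p \<le> l" "c \<in> profiles K k \<kappa> R" "\<omega> \<in> V n (p, c)" by auto
      have "\<omega> \<in> space M" and eq: "\<And>j. j \<le> R \<Longrightarrow> C j = (c(R := p)) j" using pc(3) by (auto simp: V_def C_def)
      have "restrict C {..<R} = c"
      proof (rule profiles_ext[OF pc(2)])
        show "restrict C {..<R} j = c j" if "j < R" for j using eq[of j] that by simp
      qed simp
      thus "\<omega> \<in> space M \<and> C R \<le> l \<and> restrict C {..<R} \<in> profiles K k \<kappa> R"
        using pc \<open>\<omega> \<in> space M\<close> eq[of R] by simp
    qed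
    finally show "\<omega> \<in> ?L \<longleftrightarrow> \<omega> \<in> ?U" .
  qed
  have pr: "prob (\<Union>q\<in>?F. V n q) = (\<Sum>q\<in>?F. prob (V n q))" for n
    using finite_measure_finite_Union[OF finF _ Vdisj] Vs by auto
  have target: "poisson_prob (exp (- s)) {..l} *
       (\<Sum>c\<in>profiles K k \<kappa> R. \<Prod>j<R. pmf (poisson_pmf (cell_rate \<kappa> R (\<theta> n) j)) (c j))
     = (\<Sum>q\<in>?F. \<Prod>j\<in>{..R}. pmf (poisson_pmf (rate n j)) (((snd q)(R := fst q)) j))" for n
  proof -
    have "poisson_prob (exp (- s)) {..l} = (\<Sum>p\<le>l. pmf (poisson_pmf (exp (- s))) p)"
      by (rule measure_measure_pmf_finite) simp
    hence "poisson_prob (exp (- s)) {..l} *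
       (\<Sum>c\<in>profiles K k \<kappa> R. \<Prod>j<R. pmf (poisson_pmf (cell_rate \<kappa> R (\<theta> n) j)) (c j)) =
      (\<Sum>(p, c)\<in>?F. pmf (poisson_pmf (exp (- s))) p * (\<Prod>j<R. pmf (poisson_pmf (cell_rate \<kappa> R (\<theta> n) j)) (c j)))"
      by (simp only: sum_product sum.cartesian_product)
    also have "\<dots> = (\<Sum>q\<in>?F. \<Prod>j\<in>{..R}. pmf (poisson_pmf (rate n j)) (((snd q)(R := fst q)) j))"
    proof (rule sum.cong[OF refl])
      fix q assume "q \<in> ?F"
      obtain p c where q: "q = (p, c)" by (cases q)
      have "(\<Prod>j\<in>{..R}. pmf (poisson_pmf (rate n j)) ((c(R := p)) j)) =
         (\<Prod>j<R. pmf (poisson_pmf (rate n j)) ((c(R := p)) j)) * pmf (poisson_pmf (rate n R)) p"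
        by (simp only: lessThan_Suc_atMost[symmetric] prod.lessThan_Suc fun_upd_same)
      also have "(\<Prod>j<R. pmf (poisson_pmf (rate n j)) ((c(R := p)) j)) = (\<Prod>j<R. pmf (poisson_pmf (cell_rate \<kappa> R (\<theta> n) j)) (c j))"
        by (intro prod.cong) (auto simp: rate_def simp del: pmf_poisson)
      also have "rate n R = exp (- s)" by (simp add: rate_def)
      finally show "(case q of (p, c) \<Rightarrow> pmf (poisson_pmf (exp (- s))) p * (\<Prod>j<R. pmf (poisson_pmf (cell_rate \<kappa> R (\<theta> n) j)) (c j)))
        = (\<Prod>j\<in>{..R}. pmf (poisson_pmf (rate n j)) (((snd q)(R := fst q)) j))"
        by (simp only: q prod.case fst_conv snd_conv mult.commute)
    qed
    finally show ?thesis .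
  qed
  have "(\<lambda>n. \<Sum>q\<in>?F. prob (V n q) - (\<Prod>j\<in>{..R}. pmf (poisson_pmf (rate n j)) (((snd q)(R := fst q)) j))) \<longlonglongrightarrow> 0"
    unfolding V_def by (intro tendsto_null_sum lim)
  thus ?thesis
    unfolding b_def[symmetric] \<theta>_def[symmetric] ev pr target sum_subtractf .
qed

end

section \<open>From distribution functions to total variation\<close>

text \<open>
  Think of \<open>A j\<close> as the event that a random time is at most the \<open>j\<close>-th grid point, of
  \<open>D j\<close> as an event that is decreasing in time, observed at the \<open>j\<close>-th grid point, and of
  \<open>H\<close> as the same event observed at the random time. On the event that the random time lies between two
  neighbouring grid points, \<open>H\<close> is squeezed between the two values of \<open>D\<close>.
\<close>

lemma (in prob_space) monotone_sandwich:
  fixes A D :: "nat \<Rightarrow> 'a set" and J :: nat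
  assumes A: "\<And>j. A j \<in> sets M" and D: "\<And>j. D j \<in> sets M" and H: "H \<in> sets M"
    and mono: "\<And>j. A j \<subseteq> A (Suc j)"
    and lower: "\<And>j. AE \<omega> in M. \<omega> \<in> A (Suc j) - A j \<longrightarrow> \<omega> \<in> D (Suc j) \<longrightarrow> \<omega> \<in> H"
    and upper: "\<And>j. AE \<omega> in M. \<omega> \<in> A (Suc j) - A j \<longrightarrow> \<omega> \<in> H \<longrightarrow> \<omega> \<in> D j"
  shows "(\<Sum>j<J. prob (A (Suc j) \<inter> D (Suc j)) - prob (A j \<inter> D (Suc j))) \<le> prob H" (is ?low)
    and "prob H \<le> prob (A 0) + (1 - prob (A J)) + (\<Sum>j<J. prob (A (Suc j) \<inter> D j) - prob (A j \<inter> D j))" (is ?up)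
proof -
  have diff: "prob ((A (Suc j) - A j) \<inter> X) = prob (A (Suc j) \<inter> X) - prob (A j \<inter> X)" if "X \<in> sets M" for j X
  proof -
    have "(A (Suc j) - A j) \<inter> X = A (Suc j) \<inter> X - A j \<inter> X" by blast
    moreover have "prob (A (Suc j) \<inter> X - A j \<inter> X) = prob (A (Suc j) \<inter> X) - prob (A j \<inter> X)"
      using A that mono[of j] by (intro finite_measure_Diff) auto
    ultimately show ?thesis by (simp only:)
  qed
  have step: "prob (H \<inter> A (Suc j)) = prob (H \<inter> A j) + prob ((A (Suc j) - A j) \<inter> H)" for j
    using diff[OF H, of j] by (simp add: Int_commute)
  have lo: "prob ((A (Suc j) - A j) \<inter> D (Suc j)) \<le> prob ((A (Suc j) - A j) \<inter> H)" for j
    using lower[of j] A D H by (intro finite_measure_mono_AE) (auto elim!: eventually_mono)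
  have up: "prob ((A (Suc j) - A j) \<inter> H) \<le> prob ((A (Suc j) - A j) \<inter> D j)" for j
    using upper[of j] A D H by (intro finite_measure_mono_AE) (auto elim!: eventually_mono)
  have 1: "(\<Sum>j<J. prob (A (Suc j) \<inter> D (Suc j)) - prob (A j \<inter> D (Suc j))) \<le> prob (H \<inter> A J)"
  proof (induction J)
    case (Suc J)
    thus ?case using step[of J] lo[of J] diff[OF D, of J "Suc J"] by simp
  qed simp
  have 2: "prob (H \<inter> A J) \<le> prob (A 0) + (\<Sum>j<J. prob (A (Suc j) \<inter> D j) - prob (A j \<inter> D j))"
  proof (induction J)
    case 0
    show ?case using A by (auto intro: finite_measure_mono)
  next
    case (Suc J)
    thus ?case using step[of J] up[of J] diff[OF D, of J J] by simp
  qed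
  have "prob (H \<inter> A J) \<le> prob H" using H by (intro finite_measure_mono) auto
  thus ?low using 1 by linarith
  have "prob H \<le> prob ((H \<inter> A J) \<union> (space M - A J))"
    using H A sets.sets_into_space[OF H] by (intro finite_measure_mono) auto
  also have "\<dots> \<le> prob (H \<inter> A J) + prob (space M - A J)"
    using H A by (intro measure_Un_le) auto
  also have "prob (space M - A J) = 1 - prob (A J)" using A by (rule prob_compl)
  finally show ?up using 2 by linarith
qed

lemma int_event:
  fixes X :: "nat \<Rightarrow> 'a \<Rightarrow> int"
  assumes "\<And>i. i \<in> {1..K} \<Longrightarrow> X i \<in> measurable M (count_space UNIV)"
  shows "{\<omega>\<in>space M. \<forall>i\<in>{1..K}. P i (X i \<omega>)} \<in> sets M"
proof (rule sets.sets_Collect_finite_All)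
  fix i assume "i \<in> {1..K}"
  hence "X i -` {x. P i x} \<inter> space M \<in> sets M" using assms by (intro measurable_sets[of "X i" M "count_space UNIV"]) auto
  moreover have "{\<omega>\<in>space M. P i (X i \<omega>)} = X i -` {x. P i x} \<inter> space M" by blast
  ultimately show "{\<omega>\<in>space M. P i (X i \<omega>)} \<in> sets M" by (simp only:)
qed simp

text \<open>
  Interpolates between the distribution function, for empty \<open>I\<close>, and the point probabilities.
\<close>

definition eq_on_le_off :: "nat set \<Rightarrow> (nat \<Rightarrow> int) \<Rightarrow> nat \<Rightarrow> int \<Rightarrow> bool" where
  "eq_on_le_off I v i x \<longleftrightarrow> (if i \<in> I then x = v i else x \<le> v i)"

text \<open>
  An integer equals \<open>v\<close> iff it is at most \<open>v\<close> but not at most \<open>v - 1\<close>.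
\<close>

lemma (in prob_space) eq_on_le_off_insert:
  fixes W :: "nat \<Rightarrow> 'a \<Rightarrow> int"
  assumes W: "\<And>i. i \<in> {1..K} \<Longrightarrow> W i \<in> measurable M (count_space UNIV)" and a: "a \<in> {1..K}" "a \<notin> I"
  shows "prob {\<omega>\<in>space M. \<forall>i\<in>{1..K}. eq_on_le_off (insert a I) v i (W i \<omega>)} =
      prob {\<omega>\<in>space M. \<forall>i\<in>{1..K}. eq_on_le_off I v i (W i \<omega>)} -
      prob {\<omega>\<in>space M. \<forall>i\<in>{1..K}. eq_on_le_off I (v(a := v a - 1)) i (W i \<omega>)}"
proof -
  let ?S = "\<lambda>I v. {\<omega>\<in>space M. \<forall>i\<in>{1..K}. eq_on_le_off I v i (W i \<omega>)}"
  have m: "?S I v \<in> sets M" for I v using W by (rule int_event)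
  have off: "eq_on_le_off (insert a I) v j x \<longleftrightarrow> eq_on_le_off I v j x"
    "eq_on_le_off I (v(a := v a - 1)) j x \<longleftrightarrow> eq_on_le_off I v j x" if "j \<noteq> a" for j x
    using that by (simp_all add: eq_on_le_off_def)
  have at: "eq_on_le_off (insert a I) v a x \<longleftrightarrow> eq_on_le_off I v a x \<and> \<not> eq_on_le_off I (v(a := v a - 1)) a x"
    "eq_on_le_off I (v(a := v a - 1)) a x \<longrightarrow> eq_on_le_off I v a x" for x
    using a(2) by (auto simp: eq_on_le_off_def)
  have "?S (insert a I) v = ?S I v - ?S I (v(a := v a - 1))"
  proof (rule set_eqI)
    fix \<omega>
    show "\<omega> \<in> ?S (insert a I) v \<longleftrightarrow> \<omega> \<in> ?S I v - ?S I (v(a := v a - 1))"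
      unfolding mem_Collect_eq Diff_iff using off at a(1) by metis
  qed
  moreover have "?S I (v(a := v a - 1)) \<subseteq> ?S I v"
  proof (rule subsetI)
    fix \<omega>
    show "\<omega> \<in> ?S I (v(a := v a - 1)) \<Longrightarrow> \<omega> \<in> ?S I v"
      unfolding mem_Collect_eq using off at(2) by metis
  qed
  ultimately show ?thesis using finite_measure_Diff[OF m m] by (simp only:)
qed

text \<open>
  Equality is imposed on one more coordinate at a time; by \<open>eq_on_le_off_insert\<close> each step is a
  difference of two probabilities that are already under control.
\<close>

lemma atoms_limit_from_cdf_limit:
  fixes X :: "nat \<Rightarrow> nat \<Rightarrow> 'a \<Rightarrow> int" and Y :: "nat \<Rightarrow> nat \<Rightarrow> 'b \<Rightarrow> int"
  assumes "prob_space M" "prob_space M'"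
    and X: "\<And>n i. i \<in> {1..K} \<Longrightarrow> X n i \<in> measurable M (count_space UNIV)"
    and Y: "\<And>n i. i \<in> {1..K} \<Longrightarrow> Y n i \<in> measurable M' (count_space UNIV)"
    and cdf: "\<And>v. (\<lambda>n. measure M {\<omega>\<in>space M. \<forall>i\<in>{1..K}. X n i \<omega> \<le> v i}
       - measure M' {\<omega>\<in>space M'. \<forall>i\<in>{1..K}. Y n i \<omega> \<le> v i}) \<longlonglongrightarrow> 0"
  shows "(\<lambda>n. measure M {\<omega>\<in>space M. \<forall>i\<in>{1..K}. X n i \<omega> = v i}
       - measure M' {\<omega>\<in>space M'. \<forall>i\<in>{1..K}. Y n i \<omega> = v i}) \<longlonglongrightarrow> 0"
proof -
  interpret M: prob_space M by fact
  interpret M': prob_space M' by fact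
  have "(\<lambda>n. measure M {\<omega>\<in>space M. \<forall>i\<in>{1..K}. eq_on_le_off I v i (X n i \<omega>)}
       - measure M' {\<omega>\<in>space M'. \<forall>i\<in>{1..K}. eq_on_le_off I v i (Y n i \<omega>)}) \<longlonglongrightarrow> 0"
    if "I \<subseteq> {1..K}" for I v
    using finite_subset[OF that finite_atLeastAtMost] that
  proof (induction I arbitrary: v rule: finite_induct)
    case empty
    show ?case using cdf[of v] by (simp add: eq_on_le_off_def)
  next
    case (insert a I)
    have lim: "(\<lambda>n. (measure M {\<omega>\<in>space M. \<forall>i\<in>{1..K}. eq_on_le_off I v i (X n i \<omega>)}
       - measure M' {\<omega>\<in>space M'. \<forall>i\<in>{1..K}. eq_on_le_off I v i (Y n i \<omega>)})
      - (measure M {\<omega>\<in>space M. \<forall>i\<in>{1..K}. eq_on_le_off I (v(a := v a - 1)) i (X n i \<omega>)}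
       - measure M' {\<omega>\<in>space M'. \<forall>i\<in>{1..K}. eq_on_le_off I (v(a := v a - 1)) i (Y n i \<omega>)})) \<longlonglongrightarrow> 0 - 0"
      using insert.prems by (intro tendsto_diff insert.IH) auto
    have eX: "measure M {\<omega>\<in>space M. \<forall>i\<in>{1..K}. eq_on_le_off (insert a I) v i (X n i \<omega>)} =
      measure M {\<omega>\<in>space M. \<forall>i\<in>{1..K}. eq_on_le_off I v i (X n i \<omega>)} -
      measure M {\<omega>\<in>space M. \<forall>i\<in>{1..K}. eq_on_le_off I (v(a := v a - 1)) i (X n i \<omega>)}" for n
      using insert by (intro M.eq_on_le_off_insert X) auto
    have eY: "measure M' {\<omega>\<in>space M'. \<forall>i\<in>{1..K}. eq_on_le_off (insert a I) v i (Y n i \<omega>)} =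
      measure M' {\<omega>\<in>space M'. \<forall>i\<in>{1..K}. eq_on_le_off I v i (Y n i \<omega>)} -
      measure M' {\<omega>\<in>space M'. \<forall>i\<in>{1..K}. eq_on_le_off I (v(a := v a - 1)) i (Y n i \<omega>)}" for n
      using insert by (intro M'.eq_on_le_off_insert Y) auto
    show ?case unfolding eX eY
      using lim unfolding diff_0_right by (rule Lim_transform_eventually) (intro always_eventually allI, linarith)
  qed
  from this[OF order.refl, of v] show ?thesis by (simp add: eq_on_le_off_def)
qed

lemma tv_dist_nonneg: "0 \<le> tv_dist P Q" if "prob_space P" "prob_space Q"
proof -
  interpret P: prob_space P by fact
  interpret Q: prob_space Q by fact
  have "bdd_above ((\<lambda>A. \<bar>measure P A - measure Q A\<bar>) ` sets P)"
  proof (rule bdd_aboveI2)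
    fix A
    show "\<bar>measure P A - measure Q A\<bar> \<le> 1"
      using P.prob_le_1[of A] Q.prob_le_1[of A] measure_nonneg[of P A] measure_nonneg[of Q A] by linarith
  qed
  hence "\<bar>measure P {} - measure Q {}\<bar> \<le> tv_dist P Q"
    unfolding tv_dist_def by (intro cSUP_upper) auto
  thus ?thesis by simp
qed

lemma int_vector_law_measure:
  fixes X :: "nat \<Rightarrow> 'a \<Rightarrow> int"
  assumes X: "\<And>i. i \<in> {1..K} \<Longrightarrow> X i \<in> measurable M (count_space UNIV)"
    and A: "A \<in> sets (PiM {1..K} (\<lambda>_. count_space UNIV))"
  shows "measure (int_vector_law M K X) A = measure M {\<omega>\<in>space M. (\<lambda>i\<in>{1..K}. X i \<omega>) \<in> A}"
    and "(\<lambda>\<omega>. \<lambda>i\<in>{1..K}. X i \<omega>) \<in> measurable M (PiM {1..K} (\<lambda>_. count_space UNIV))"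
    and "{\<omega>\<in>space M. (\<lambda>i\<in>{1..K}. X i \<omega>) \<in> A} \<in> sets M"
proof -
  show m: "(\<lambda>\<omega>. \<lambda>i\<in>{1..K}. X i \<omega>) \<in> measurable M (PiM {1..K} (\<lambda>_. count_space UNIV))"
    using X by (rule measurable_restrict)
  have eq: "{\<omega>\<in>space M. (\<lambda>i\<in>{1..K}. X i \<omega>) \<in> A} = (\<lambda>\<omega>. \<lambda>i\<in>{1..K}. X i \<omega>) -` A \<inter> space M" by blast
  show "measure (int_vector_law M K X) A = measure M {\<omega>\<in>space M. (\<lambda>i\<in>{1..K}. X i \<omega>) \<in> A}"
    unfolding int_vector_law_def eq by (rule measure_distr[OF m A])
  show "{\<omega>\<in>space M. (\<lambda>i\<in>{1..K}. X i \<omega>) \<in> A} \<in> sets M"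
    unfolding eq by (rule measurable_sets[OF m A])
qed

text \<open>
  A law on integer vectors is determined by finitely many point probabilities up to the mass that it puts outside a
  finite box.
\<close>

lemma (in prob_space) int_vector_law_finite_box:
  fixes X :: "nat \<Rightarrow> 'a \<Rightarrow> int"
  assumes X: "\<And>i. i \<in> {1..K} \<Longrightarrow> X i \<in> measurable M (count_space UNIV)"
    and B: "finite B" "B \<subseteq> extensional {1..K}"
    and A: "A \<in> sets (PiM {1..K} (\<lambda>_. count_space UNIV))"
  defines "p \<equiv> \<lambda>v. prob {\<omega>\<in>space M. \<forall>i\<in>{1..K}. X i \<omega> = v i}"
    and "out \<equiv> prob {\<omega>\<in>space M. (\<lambda>i\<in>{1..K}. X i \<omega>) \<notin> B}"
  shows "\<bar>measure (int_vector_law M K X) A - (\<Sum>v\<in>A \<inter> B. p v)\<bar> \<le> out"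
    and "out = 1 - (\<Sum>v\<in>B. p v)"
proof -
  define f where "f \<omega> = (\<lambda>i\<in>{1..K}. X i \<omega>)" for \<omega>
  have feq: "f \<omega> = v \<longleftrightarrow> (\<forall>i\<in>{1..K}. X i \<omega> = v i)" if "v \<in> B" for v \<omega>
  proof
    assume *: "\<forall>i\<in>{1..K}. X i \<omega> = v i"
    show "f \<omega> = v" using * B(2) that by (intro extensionalityI[of _ "{1..K}"]) (auto simp: f_def)
  qed (auto simp: f_def)
  have fset: "{\<omega>\<in>space M. f \<omega> \<in> C} \<in> sets M" and fsum: "prob {\<omega>\<in>space M. f \<omega> \<in> C} = (\<Sum>v\<in>C. p v)"
    if "C \<subseteq> B" for C
  proof -
    have fin: "finite C" using that B(1) by (rule finite_subset)
    have fm: "{\<omega>\<in>space M. f \<omega> = v} \<in> sets M" and p: "p v = prob {\<omega>\<in>space M. f \<omega> = v}" if "v \<in> B" for v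
      unfolding feq[OF that] p_def by (rule int_event[OF X], assumption) (rule refl)
    have eq: "{\<omega>\<in>space M. f \<omega> \<in> C} = (\<Union>v\<in>C. {\<omega>\<in>space M. f \<omega> = v})" by blast
    show "{\<omega>\<in>space M. f \<omega> \<in> C} \<in> sets M" unfolding eq using fm that fin by (intro sets.finite_UN) auto
    have "prob (\<Union>v\<in>C. {\<omega>\<in>space M. f \<omega> = v}) = (\<Sum>v\<in>C. prob {\<omega>\<in>space M. f \<omega> = v})"
      using fm that fin by (intro finite_measure_finite_Union) (auto simp: disjoint_family_on_def)
    also have "\<dots> = (\<Sum>v\<in>C. p v)" using p that by (intro sum.cong) auto
    finally show "prob {\<omega>\<in>space M. f \<omega> \<in> C} = (\<Sum>v\<in>C. p v)" unfolding eq .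
  qed
  have out_eq: "{\<omega>\<in>space M. f \<omega> \<notin> B} = space M - {\<omega>\<in>space M. f \<omega> \<in> B}" by blast
  show "out = 1 - (\<Sum>v\<in>B. p v)"
    unfolding out_def f_def[symmetric] out_eq prob_compl[OF fset[OF order.refl]] fsum[OF order.refl] ..
  have fA: "{\<omega>\<in>space M. f \<omega> \<in> A} \<in> sets M" unfolding f_def using X A by (rule int_vector_law_measure(3))
  have "measure (int_vector_law M K X) A - (\<Sum>v\<in>A \<inter> B. p v) = prob {\<omega>\<in>space M. f \<omega> \<in> A} - prob {\<omega>\<in>space M. f \<omega> \<in> A \<inter> B}"
    unfolding f_def[symmetric] fsum[OF Int_lower2]
    using int_vector_law_measure(1)[of K X M A] X A by (simp add: f_def)
  also have "\<dots> = prob ({\<omega>\<in>space M. f \<omega> \<in> A} - {\<omega>\<in>space M. f \<omega> \<in> A \<inter> B})"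
    using fA fset[of "A \<inter> B"] by (intro finite_measure_Diff[symmetric]) auto
  finally have diff: "measure (int_vector_law M K X) A - (\<Sum>v\<in>A \<inter> B. p v) =
    prob ({\<omega>\<in>space M. f \<omega> \<in> A} - {\<omega>\<in>space M. f \<omega> \<in> A \<inter> B})" .
  have "prob ({\<omega>\<in>space M. f \<omega> \<in> A} - {\<omega>\<in>space M. f \<omega> \<in> A \<inter> B}) \<le> out"
    unfolding out_def f_def[symmetric] out_eq using fset[OF order.refl] by (intro finite_measure_mono) auto
  thus "\<bar>measure (int_vector_law M K X) A - (\<Sum>v\<in>A \<inter> B. p v)\<bar> \<le> out" unfolding diff by simp
qed

text \<open>
  Inside the finite box \<open>B\<close> the two laws are compared point by point. The mass that the first law puts
  outside \<open>B\<close> is controlled by the second one, because both laws have total mass one.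
\<close>

lemma tv_dist_int_vector_law_le:
  fixes X :: "nat \<Rightarrow> 'a \<Rightarrow> int" and Y :: "nat \<Rightarrow> 'b \<Rightarrow> int"
  assumes "prob_space M" "prob_space M'"
    and X: "\<And>i. i \<in> {1..K} \<Longrightarrow> X i \<in> measurable M (count_space UNIV)"
    and Y: "\<And>i. i \<in> {1..K} \<Longrightarrow> Y i \<in> measurable M' (count_space UNIV)"
    and B: "finite B" "B \<subseteq> extensional {1..K}"
  shows "tv_dist (int_vector_law M K X) (int_vector_law M' K Y) \<le>
    2 * (\<Sum>v\<in>B. \<bar>measure M {\<omega>\<in>space M. \<forall>i\<in>{1..K}. X i \<omega> = v i} - measure M' {\<omega>\<in>space M'. \<forall>i\<in>{1..K}. Y i \<omega> = v i}\<bar>)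
    + 2 * measure M' {\<omega>\<in>space M'. (\<lambda>i\<in>{1..K}. Y i \<omega>) \<notin> B}"
proof -
  interpret M: prob_space M by fact
  interpret M': prob_space M' by fact
  define p where "p v = M.prob {\<omega>\<in>space M. \<forall>i\<in>{1..K}. X i \<omega> = v i}" for v
  define p' where "p' v = M'.prob {\<omega>\<in>space M'. \<forall>i\<in>{1..K}. Y i \<omega> = v i}" for v
  define S where "S = (\<Sum>v\<in>B. \<bar>p v - p' v\<bar>)"
  define T where "T = M.prob {\<omega>\<in>space M. (\<lambda>i\<in>{1..K}. X i \<omega>) \<notin> B}"
  define T' where "T' = M'.prob {\<omega>\<in>space M'. (\<lambda>i\<in>{1..K}. Y i \<omega>) \<notin> B}"
  note box = M.int_vector_law_finite_box[of K X B, OF X B, folded p_def T_def]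
  note box' = M'.int_vector_law_finite_box[of K Y B, OF Y B, folded p'_def T'_def]
  have main: "\<bar>measure (int_vector_law M K X) A - measure (int_vector_law M' K Y) A\<bar> \<le> 2 * S + 2 * T'"
    if A: "A \<in> sets (PiM {1..K} (\<lambda>_. count_space UNIV))" for A
  proof -
    have "T - T' = (\<Sum>v\<in>B. p' v - p v)" using box(2)[OF _ A] box'(2)[OF _ A] by (simp add: sum_subtractf)
    also have "\<dots> \<le> S" unfolding S_def by (intro sum_mono) linarith
    finally have "T \<le> T' + S" by linarith
    moreover have "\<bar>(\<Sum>v\<in>A \<inter> B. p v) - (\<Sum>v\<in>A \<inter> B. p' v)\<bar> \<le> S"
    proof -
      have "\<bar>\<Sum>v\<in>A \<inter> B. p v - p' v\<bar> \<le> (\<Sum>v\<in>A \<inter> B. \<bar>p v - p' v\<bar>)" by (rule sum_abs)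
      also have "\<dots> \<le> S" unfolding S_def using B(1) by (intro sum_mono2) auto
      finally show ?thesis by (simp add: sum_subtractf)
    qed
    moreover have "\<bar>measure (int_vector_law M K X) A - (\<Sum>v\<in>A \<inter> B. p v)\<bar> \<le> T"
      "\<bar>measure (int_vector_law M' K Y) A - (\<Sum>v\<in>A \<inter> B. p' v)\<bar> \<le> T'"
      using box(1)[OF _ A] box'(1)[OF _ A] by simp_all
    ultimately show ?thesis by linarith
  qed
  have "tv_dist (int_vector_law M K X) (int_vector_law M' K Y) \<le> 2 * S + 2 * T'"
    unfolding tv_dist_def
  proof (rule cSUP_least)
    show "sets (int_vector_law M K X) \<noteq> {}" by auto
    fix A assume "A \<in> sets (int_vector_law M K X)"
    thus "\<bar>measure (int_vector_law M K X) A - measure (int_vector_law M' K Y) A\<bar> \<le> 2 * S + 2 * T'"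
      by (intro main) (simp add: int_vector_law_def)
  qed
  thus ?thesis unfolding S_def p_def p'_def T'_def .
qed

text \<open>
  Point probabilities are compared on a finite box, and tightness of \<open>Y\<close> makes the mass outside it small
  for both sequences, by \<open>tv_dist_int_vector_law_le\<close>.
\<close>

theorem tv_limit_from_cdf_limit:
  fixes X :: "nat \<Rightarrow> nat \<Rightarrow> 'a \<Rightarrow> int" and Y :: "nat \<Rightarrow> nat \<Rightarrow> 'b \<Rightarrow> int"
  assumes "prob_space M" "prob_space M'"
    and X: "\<And>n i. i \<in> {1..K} \<Longrightarrow> X n i \<in> measurable M (count_space UNIV)"
    and Y: "\<And>n i. i \<in> {1..K} \<Longrightarrow> Y n i \<in> measurable M' (count_space UNIV)"
    and cdf: "\<And>v. (\<lambda>n. measure M {\<omega>\<in>space M. \<forall>i\<in>{1..K}. X n i \<omega> \<le> v i}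
       - measure M' {\<omega>\<in>space M'. \<forall>i\<in>{1..K}. Y n i \<omega> \<le> v i}) \<longlonglongrightarrow> 0"
    and tight: "\<And>e. e > 0 \<Longrightarrow> \<exists>R. \<forall>n. measure M' {\<omega>\<in>space M'. \<not> (\<forall>i\<in>{1..K}. Y n i \<omega> \<in> {-R..R})} \<le> e"
  shows "(\<lambda>n. tv_dist (int_vector_law M K (X n)) (int_vector_law M' K (Y n))) \<longlonglongrightarrow> 0"
proof (rule tendstoI)
  fix e :: real assume e: "e > 0"
  obtain R where R: "\<And>n. measure M' {\<omega>\<in>space M'. \<not> (\<forall>i\<in>{1..K}. Y n i \<omega> \<in> {-R..R})} \<le> e / 4"
    using tight[of "e / 4"] e by auto
  define B where "B = PiE {1..K} (\<lambda>_. {-R..R})"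
  have B: "finite B" "B \<subseteq> extensional {1..K}"
    unfolding B_def by (rule finite_PiE, simp, simp) (simp add: PiE_def)
  have nB: "(\<lambda>i\<in>{1..K}. Y n i \<omega>) \<notin> B \<longleftrightarrow> \<not> (\<forall>i\<in>{1..K}. Y n i \<omega> \<in> {-R..R})" for n \<omega>
    unfolding B_def restrict_PiE_iff ..
  let ?S = "\<lambda>n. \<Sum>v\<in>B. \<bar>measure M {\<omega>\<in>space M. \<forall>i\<in>{1..K}. X n i \<omega> = v i} - measure M' {\<omega>\<in>space M'. \<forall>i\<in>{1..K}. Y n i \<omega> = v i}\<bar>"
  have "?S \<longlonglongrightarrow> 0"
    by (intro tendsto_null_sum tendsto_rabs_zero atoms_limit_from_cdf_limit[OF assms(1,2) X Y cdf])
  hence "\<forall>\<^sub>F n in sequentially. ?S n < e / 4" by (rule order_tendstoD) (use e in simp)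
  thus "\<forall>\<^sub>F n in sequentially. dist (tv_dist (int_vector_law M K (X n)) (int_vector_law M' K (Y n))) 0 < e"
  proof eventually_elim
    case (elim n)
    have "tv_dist (int_vector_law M K (X n)) (int_vector_law M' K (Y n)) \<le>
      2 * ?S n + 2 * measure M' {\<omega>\<in>space M'. (\<lambda>i\<in>{1..K}. Y n i \<omega>) \<notin> B}"
      by (rule tv_dist_int_vector_law_le[OF assms(1,2) X Y B])
    also have "\<dots> < e" using elim R[of n] e unfolding nB by linarith
    finally have "tv_dist (int_vector_law M K (X n)) (int_vector_law M' K (Y n)) < e" .
    moreover have "0 \<le> tv_dist (int_vector_law M K (X n)) (int_vector_law M' K (Y n))"
      unfolding int_vector_law_def using X Y
      by (intro tv_dist_nonneg prob_space.prob_space_distr assms(1,2) measurable_restrict) auto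
    ultimately show ?case by simp
  qed
qed

section \<open>The limiting vector\<close>

lemma (in prob_space) real_rv_tails:
  fixes T :: "'a \<Rightarrow> real"
  assumes T: "T \<in> borel_measurable M" and e: "e > 0"
  obtains S :: real where "S > 0" "prob {\<omega>\<in>space M. T \<omega> \<le> - S} < e" "1 - e < prob {\<omega>\<in>space M. T \<omega> \<le> S}"
proof -
  have ev: "{\<omega>\<in>space M. T \<omega> \<le> x} \<in> sets M" for x using T by measurable
  have "(\<lambda>n. prob {\<omega>\<in>space M. T \<omega> \<le> - real n}) \<longlonglongrightarrow> prob (\<Inter>n. {\<omega>\<in>space M. T \<omega> \<le> - real n})"
    by (rule finite_Lim_measure_decseq) (use ev in \<open>auto simp: decseq_def\<close>)
  also have "(\<Inter>n. {\<omega>\<in>space M. T \<omega> \<le> - real n}) = {}"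
  proof -
    have False if "\<And>n. T \<omega> \<le> - real n" for \<omega>
    proof -
      obtain n where "- T \<omega> < real n" using reals_Archimedean2 by blast
      thus False using that[of n] by simp
    qed
    thus ?thesis by blast
  qed
  finally have "(\<lambda>n. prob {\<omega>\<in>space M. T \<omega> \<le> - real n}) \<longlonglongrightarrow> 0" by simp
  hence lo: "\<forall>\<^sub>F n in sequentially. prob {\<omega>\<in>space M. T \<omega> \<le> - real n} < e" using e by (rule order_tendstoD)
  have "(\<lambda>n. prob {\<omega>\<in>space M. T \<omega> \<le> real n}) \<longlonglongrightarrow> prob (\<Union>n. {\<omega>\<in>space M. T \<omega> \<le> real n})"
    by (rule finite_Lim_measure_incseq) (use ev in \<open>auto simp: incseq_def\<close>)
  also have "(\<Union>n. {\<omega>\<in>space M. T \<omega> \<le> real n}) = space M"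
    using real_arch_simple by auto
  finally have "(\<lambda>n. prob {\<omega>\<in>space M. T \<omega> \<le> real n}) \<longlonglongrightarrow> 1" by (simp add: prob_space)
  hence hi: "\<forall>\<^sub>F n in sequentially. 1 - e < prob {\<omega>\<in>space M. T \<omega> \<le> real n}" using e by (intro order_tendstoD) auto
  have "\<forall>\<^sub>F n in sequentially. n > 0 \<and> prob {\<omega>\<in>space M. T \<omega> \<le> - real n} < e \<and> 1 - e < prob {\<omega>\<in>space M. T \<omega> \<le> real n}"
    using lo hi eventually_gt_at_top[of 0] by eventually_elim auto
  then obtain n where "n > 0" "prob {\<omega>\<in>space M. T \<omega> \<le> - real n} < e" "1 - e < prob {\<omega>\<in>space M. T \<omega> \<le> real n}"
    by (auto simp: eventually_sequentially)
  thus thesis using that[of "real n"] by simp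
qed

lemma exp_diff_le: "exp y - exp x \<le> exp y * (y - x)" for x y :: real
proof -
  have "exp x = exp y * exp (x - y)" by (simp add: exp_add[symmetric])
  moreover have "1 + (x - y) \<le> exp (x - y)" by (rule exp_ge_add_one_self)
  hence "exp y * (1 + (x - y)) \<le> exp y * exp (x - y)" by (intro mult_left_mono) auto
  ultimately show ?thesis by (simp add: algebra_simps)
qed

locale limit_model = exp_ppp M \<Xi> for M :: "'b measure" and \<Xi> +
  fixes \<xi> :: "nat \<Rightarrow> 'b \<Rightarrow> real" and \<tau> :: "'b \<Rightarrow> real" and l K :: nat
  assumes \<xi>_measurable: "\<And>i. i \<ge> 1 \<Longrightarrow> \<xi> i \<in> borel_measurable M"
    and atoms: "AE \<omega> in M. decreasing_atoms (\<Xi> \<omega>) (\<lambda>i. \<xi> i \<omega>)"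
    and gumbel: "distributed M lborel \<tau> (\<lambda>s. ennreal (gumbel_density (l + 1) s))"
    and indep: "indep_of_point_process M \<tau> \<Xi>"
begin

lemma \<tau>_measurable: "\<tau> \<in> borel_measurable M"
  using distributed_measurable[OF gumbel] by simp

definition counts_le :: "(nat \<Rightarrow> int) \<Rightarrow> real \<Rightarrow> 'b set" where
  "counts_le k \<theta> = {\<omega>\<in>space M. \<forall>i\<in>{1..K}. emeasure (\<Xi> \<omega>) {real_of_int (k i) - \<theta><..} \<le> of_nat (i - 1)}"

definition early :: "real \<Rightarrow> 'b set" where
  "early s = {\<omega>\<in>space M. \<tau> \<omega> \<le> s}"

lemma early_event: "early s \<in> sets M"
  unfolding early_def using \<tau>_measurable by measurable

lemma counts_le_event: "counts_le k \<theta> \<in> sets M"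
proof -
  have "counts_le k \<theta> = {\<omega>\<in>space M. \<forall>i\<in>{1..K}. emeasure (\<Xi> \<omega>) {real_of_int (k i) - \<theta><..} \<in> {..of_nat (i - 1)}}"
    by (simp add: counts_le_def)
  also have "\<dots> \<in> sets M" by (intro sets.sets_Collect_finite_All ppp_event) auto
  finally show ?thesis .
qed

lemma early_counts_independent: "prob (early s \<inter> counts_le k \<theta>) = prob (early s) * prob (counts_le k \<theta>)"
proof -
  let ?V = "\<lambda>\<omega>. \<lambda>A\<in>sets borel. emeasure (\<Xi> \<omega>) A"
  have ind: "indep_set (sets (vimage_algebra (space M) \<tau> borel)) (sets (vimage_algebra (space M) ?V (PiM (sets borel) (\<lambda>_. borel))))"
    using indep unfolding indep_of_point_process_def by blast
  have 1: "early s \<in> sets (vimage_algebra (space M) \<tau> borel)"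
  proof -
    have "\<tau> -` {..s} \<inter> space M \<in> sets (vimage_algebra (space M) \<tau> borel)" by (rule in_vimage_algebra) simp
    moreover have "early s = \<tau> -` {..s} \<inter> space M" unfolding early_def by blast
    ultimately show ?thesis by (simp only:)
  qed
  have 2: "counts_le k \<theta> \<in> sets (vimage_algebra (space M) ?V (PiM (sets borel) (\<lambda>_. borel)))"
  proof -
    let ?P = "PiM (sets (borel :: real measure)) (\<lambda>_. borel :: ennreal measure)"
    define C where "C = {f\<in>space ?P. \<forall>i\<in>{1..K}. f {real_of_int (k i) - \<theta><..} \<in> {..of_nat (i - 1)}}"
    have "C \<in> sets ?P"
      unfolding C_def
    proof (rule sets.sets_Collect_finite_All)
      fix i
      have "(\<lambda>f. f {real_of_int (k i) - \<theta><..}) \<in> measurable ?P borel"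
        by (rule measurable_component_singleton) simp
      hence "(\<lambda>f. f {real_of_int (k i) - \<theta><..}) -` {..of_nat (i - 1)} \<inter> space ?P \<in> sets ?P"
        by (rule measurable_sets) simp
      moreover have "{f\<in>space ?P. f {real_of_int (k i) - \<theta><..} \<in> {..of_nat (i - 1)}} =
        (\<lambda>f. f {real_of_int (k i) - \<theta><..}) -` {..of_nat (i - 1)} \<inter> space ?P" by blast
      ultimately show "{f\<in>space ?P. f {real_of_int (k i) - \<theta><..} \<in> {..of_nat (i - 1)}} \<in> sets ?P" by (simp only:)
    qed simp
    hence "?V -` C \<inter> space M \<in> sets (vimage_algebra (space M) ?V ?P)" by (rule in_vimage_algebra)
    moreover have "?V \<omega> \<in> space ?P" for \<omega> by (simp add: space_PiM)
    hence "?V -` C \<inter> space M = counts_le k \<theta>" unfolding C_def counts_le_def by auto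
    ultimately show ?thesis by (simp only:)
  qed
  show ?thesis by (rule indep_setD[OF ind 1 2])
qed

lemma counts_le_antimono:
  assumes "\<theta> \<le> \<theta>'"
  shows "counts_le k \<theta>' \<subseteq> counts_le k \<theta>"
proof
  fix \<omega> assume w: "\<omega> \<in> counts_le k \<theta>'"
  hence ws: "\<omega> \<in> space M" by (simp add: counts_le_def)
  have "emeasure (\<Xi> \<omega>) {real_of_int (k i) - \<theta><..} \<le> of_nat (i - 1)" if "i \<in> {1..K}" for i
  proof -
    have "emeasure (\<Xi> \<omega>) {real_of_int (k i) - \<theta><..} \<le> emeasure (\<Xi> \<omega>) {real_of_int (k i) - \<theta>'<..}"
      using assms sets_ppp[OF ws] by (intro emeasure_mono) auto
    also have "\<dots> \<le> of_nat (i - 1)" using w that by (simp add: counts_le_def)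
    finally show ?thesis .
  qed
  thus "\<omega> \<in> counts_le k \<theta>" using ws by (simp add: counts_le_def)
qed

text \<open>
  The two events can only differ if one of \<open>K\<close> short intervals contains a point, which has at most the
  probability given by the intensity of the interval.
\<close>

lemma counts_le_continuous:
  assumes "\<theta> \<le> \<theta>'"
  shows "prob (counts_le k \<theta>) - prob (counts_le k \<theta>') \<le> (\<Sum>i\<in>{1..K}. exp (- real_of_int (k i))) * (exp \<theta>' - exp \<theta>)"
proof -
  define I where "I i = {real_of_int (k i) - \<theta>'<..real_of_int (k i) - \<theta>}" for i
  define Z where "Z i = {\<omega>\<in>space M. emeasure (\<Xi> \<omega>) (I i) \<in> - {0}}" for i
  have Ifin: "emeasure exp_intensity (I i) < \<infinity>" and Imeas: "measure exp_intensity (I i) = exp (- real_of_int (k i)) * (exp \<theta>' - exp \<theta>)" for i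
    unfolding I_def using assms by (simp_all add: exp_intensity_Ioc[simplified] exp_diff exp_minus field_simps)
  have Ib: "I i \<in> sets borel" for i by (simp add: I_def)
  have Zs: "Z i \<in> sets M" for i unfolding Z_def by (rule ppp_event[OF Ib]) simp
  have pZ: "prob (Z i) \<le> exp (- real_of_int (k i)) * (exp \<theta>' - exp \<theta>)" for i
  proof -
    let ?O = "{\<omega>\<in>space M. emeasure (\<Xi> \<omega>) (I i) = of_nat 0}"
    have O: "?O \<in> sets M" using ppp_event[OF Ib, of "{0}" i] by simp
    have "Z i = space M - ?O" by (auto simp: Z_def)
    hence "prob (Z i) = 1 - prob ?O" using prob_compl[OF O] by (simp only:)
    also have "prob ?O = exp (- measure exp_intensity (I i))" using ppp_count[OF Ib Ifin, of i 0] by simp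
    also have "1 - exp (- measure exp_intensity (I i)) \<le> measure exp_intensity (I i)"
      using exp_ge_add_one_self[of "- measure exp_intensity (I i)"] by linarith
    finally show ?thesis unfolding Imeas .
  qed
  have "counts_le k \<theta> \<subseteq> counts_le k \<theta>' \<union> (\<Union>i\<in>{1..K}. Z i)"
  proof
    fix \<omega> assume w: "\<omega> \<in> counts_le k \<theta>"
    hence ws: "\<omega> \<in> space M" by (simp add: counts_le_def)
    show "\<omega> \<in> counts_le k \<theta>' \<union> (\<Union>i\<in>{1..K}. Z i)"
    proof (cases "\<exists>i\<in>{1..K}. \<omega> \<in> Z i")
      case False
      have "emeasure (\<Xi> \<omega>) {real_of_int (k i) - \<theta>'<..} \<le> of_nat (i - 1)" if i: "i \<in> {1..K}" for i
      proof -
        have z: "emeasure (\<Xi> \<omega>) (I i) = 0" using False i ws unfolding Z_def by blast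
        have "{real_of_int (k i) - \<theta>'<..} = I i \<union> {real_of_int (k i) - \<theta><..}" using assms by (auto simp: I_def)
        hence "emeasure (\<Xi> \<omega>) {real_of_int (k i) - \<theta>'<..} \<le> emeasure (\<Xi> \<omega>) (I i) + emeasure (\<Xi> \<omega>) {real_of_int (k i) - \<theta><..}"
          using emeasure_subadditive[of "I i" "\<Xi> \<omega>" "{real_of_int (k i) - \<theta><..}"] sets_ppp[OF ws] Ib by simp
        also have "\<dots> \<le> of_nat (i - 1)" using w i z by (simp add: counts_le_def)
        finally show ?thesis .
      qed
      thus ?thesis using ws by (simp add: counts_le_def)
    qed blast
  qed
  hence "prob (counts_le k \<theta>) \<le> prob (counts_le k \<theta>' \<union> (\<Union>i\<in>{1..K}. Z i))"
    using counts_le_event Zs by (intro finite_measure_mono) auto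
  also have "\<dots> \<le> prob (counts_le k \<theta>') + prob (\<Union>i\<in>{1..K}. Z i)"
    using counts_le_event Zs by (intro measure_Un_le) auto
  also have "prob (\<Union>i\<in>{1..K}. Z i) \<le> (\<Sum>i\<in>{1..K}. prob (Z i))"
    using Zs by (intro finite_measure_subadditive_finite) auto
  also have "\<dots> \<le> (\<Sum>i\<in>{1..K}. exp (- real_of_int (k i)) * (exp \<theta>' - exp \<theta>))" by (intro sum_mono pZ)
  finally show ?thesis by (simp add: sum_distrib_right)
qed

definition limit_height :: "real \<Rightarrow> nat \<Rightarrow> 'b \<Rightarrow> int" where
  "limit_height c i \<omega> = \<lceil>\<xi> i \<omega> + (exp 1 - 1) * \<tau> \<omega> + c\<rceil>"

lemma limit_height_measurable:
  assumes "i \<ge> 1"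
  shows "limit_height c i \<in> measurable M (count_space UNIV)"
proof -
  have "(\<lambda>\<omega>. \<xi> i \<omega> + (exp 1 - 1) * \<tau> \<omega> + c) \<in> borel_measurable M"
    using \<xi>_measurable[OF assms] \<tau>_measurable by measurable
  thus ?thesis unfolding limit_height_def[abs_def] by measurable
qed

lemma limit_height_le_event: "{\<omega>\<in>space M. \<forall>i\<in>{1..K}. limit_height c i \<omega> \<le> k i} \<in> sets M"
  by (rule int_event) (simp add: limit_height_measurable)

text \<open>
  Bounding the \<open>i\<close>-th height means bounding the number of points above a threshold; the shift is
  evaluated at the random \<open>\<tau>\<close>, which the exceptional null set allows because it is the same for all
  thresholds.
\<close>

lemma limit_height_le_iff:
  "AE \<omega> in M. \<forall>k. (\<forall>i\<in>{1..K}. limit_height c i \<omega> \<le> k i) \<longleftrightarrow> \<omega> \<in> counts_le k ((exp 1 - 1) * \<tau> \<omega> + c)"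
  using ordered_atom_le_iff[OF atoms] AE_space
proof eventually_elim
  case (elim \<omega>)
  show ?case
  proof
    fix k
    have "limit_height c i \<omega> \<le> k i \<longleftrightarrow> emeasure (\<Xi> \<omega>) {real_of_int (k i) - ((exp 1 - 1) * \<tau> \<omega> + c)<..} \<le> of_nat (i - 1)"
      if "i \<in> {1..K}" for i
    proof -
      have "limit_height c i \<omega> \<le> k i \<longleftrightarrow> \<xi> i \<omega> \<le> real_of_int (k i) - ((exp 1 - 1) * \<tau> \<omega> + c)"
        unfolding limit_height_def ceiling_le_iff by linarith
      thus ?thesis using elim(1) that by simp
    qed
    thus "(\<forall>i\<in>{1..K}. limit_height c i \<omega> \<le> k i) \<longleftrightarrow> \<omega> \<in> counts_le k ((exp 1 - 1) * \<tau> \<omega> + c)"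
      using elim(2) by (simp add: counts_le_def)
  qed
qed

lemma limit_heights_tight:
  assumes e: "e > 0"
  shows "\<exists>R. \<forall>c\<in>{0..1}. prob {\<omega>\<in>space M. \<not> (\<forall>i\<in>{1..K}. limit_height c i \<omega> \<in> {-R..R})} \<le> e"
proof -
  define V where "V \<omega> = (\<Sum>i\<in>{1..K}. \<bar>\<xi> i \<omega>\<bar>) + (exp 1 - 1) * \<bar>\<tau> \<omega>\<bar>" for \<omega>
  have Vm: "V \<in> borel_measurable M"
    unfolding V_def using \<xi>_measurable \<tau>_measurable by (intro borel_measurable_add borel_measurable_sum borel_measurable_times borel_measurable_abs) auto
  obtain S where S: "S > 0" "1 - e < prob {\<omega>\<in>space M. V \<omega> \<le> S}" using real_rv_tails[OF Vm e] by metis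
  have ev: "{\<omega>\<in>space M. V \<omega> \<le> S} \<in> sets M" using Vm by measurable
  \<comment> \<open>One unit allows for the fractional part \<open>c\<close> and one for rounding up.\<close>
  define R where "R = \<lceil>S\<rceil> + 2"
  have "prob {\<omega>\<in>space M. \<not> (\<forall>i\<in>{1..K}. limit_height c i \<omega> \<in> {-R..R})} \<le> e" if c: "c \<in> {0..1}" for c
  proof -
    have "{\<omega>\<in>space M. \<not> (\<forall>i\<in>{1..K}. limit_height c i \<omega> \<in> {-R..R})} \<subseteq> space M - {\<omega>\<in>space M. V \<omega> \<le> S}"
    proof
      fix \<omega> assume w: "\<omega> \<in> {\<omega>\<in>space M. \<not> (\<forall>i\<in>{1..K}. limit_height c i \<omega> \<in> {-R..R})}"
      then obtain i where i: "i \<in> {1..K}" "limit_height c i \<omega> \<notin> {-R..R}" by blast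
      have "\<not> V \<omega> \<le> S"
      proof
        assume V: "V \<omega> \<le> S"
        have "\<bar>\<xi> i \<omega>\<bar> \<le> (\<Sum>i\<in>{1..K}. \<bar>\<xi> i \<omega>\<bar>)" using i by (intro member_le_sum) auto
        moreover have "\<bar>(exp 1 - 1) * \<tau> \<omega>\<bar> = (exp 1 - 1) * \<bar>\<tau> \<omega>\<bar>" by (simp add: abs_mult)
        ultimately have "\<bar>\<xi> i \<omega> + (exp 1 - 1) * \<tau> \<omega>\<bar> \<le> S" using V unfolding V_def by linarith
        hence "\<bar>\<xi> i \<omega> + (exp 1 - 1) * \<tau> \<omega> + c\<bar> \<le> S + 1" using c by auto
        hence "limit_height c i \<omega> \<le> R" "- R \<le> limit_height c i \<omega>" unfolding limit_height_def R_def by linarith+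
        thus False using i(2) by simp
      qed
      thus "\<omega> \<in> space M - {\<omega>\<in>space M. V \<omega> \<le> S}" using w by blast
    qed
    hence "prob {\<omega>\<in>space M. \<not> (\<forall>i\<in>{1..K}. limit_height c i \<omega> \<in> {-R..R})} \<le> prob (space M - {\<omega>\<in>space M. V \<omega> \<le> S})"
      using ev by (intro finite_measure_mono) auto
    also have "\<dots> = 1 - prob {\<omega>\<in>space M. V \<omega> \<le> S}" by (rule prob_compl[OF ev])
    finally show ?thesis using S by linarith
  qed
  thus ?thesis by blast
qed

end

section \<open>Comparison along a time grid\<close>

context poisson_family begin

definition few_low :: "nat \<Rightarrow> nat \<Rightarrow> nat \<Rightarrow> real \<Rightarrow> 'w set" where
  "few_low m l n s = {\<omega>\<in>space M. card {i\<in>{1..n}. \<not> m < N i (time_at m n s) \<omega>} \<le> l}"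

definition tops_le :: "nat \<Rightarrow> nat \<Rightarrow> nat \<Rightarrow> (nat \<Rightarrow> int) \<Rightarrow> real \<Rightarrow> 'w set" where
  "tops_le m K n k s = {\<omega>\<in>space M. \<forall>i\<in>{1..K}.
     card {j\<in>{1..n}. \<lfloor>centering m n\<rfloor> + k i < int (N j (time_at m n s) \<omega>)} \<le> i - 1}"

definition height :: "nat \<Rightarrow> nat \<Rightarrow> nat \<Rightarrow> nat \<Rightarrow> 'w \<Rightarrow> int" where
  "height m l n i \<omega> = int (order_stat_hit N m l n i \<omega>) - \<lfloor>centering m n\<rfloor>"

lemma few_low_event: "few_low m l n s \<in> sets M"
  unfolding few_low_def
  by (rule count_event[OF time_at_nonneg, where P = "\<lambda>x. \<not> m < x" and Q = "\<lambda>c. c \<le> l"])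

lemma tops_le_event: "tops_le m K n k s \<in> sets M"
  unfolding tops_le_def
proof (rule sets.sets_Collect_finite_All)
  fix i
  show "{\<omega>\<in>space M. card {j\<in>{1..n}. \<lfloor>centering m n\<rfloor> + k i < int (N j (time_at m n s) \<omega>)} \<le> i - 1} \<in> sets M"
    by (rule count_event[OF time_at_nonneg, where P = "\<lambda>x. \<lfloor>centering m n\<rfloor> + k i < int x" and Q = "\<lambda>c. c \<le> i - 1"])
qed simp

lemma height_measurable:
  assumes "1 \<le> i" "i \<le> n"
  shows "height m l n i \<in> measurable M (count_space UNIV)"
  unfolding height_def[abs_def]
  by (rule measurable_compose[OF order_stat_hit_measurable[OF assms], where g = "\<lambda>x. x - \<lfloor>centering m n\<rfloor>"]) simp

lemma few_low_mono:
  assumes "s \<le> s'"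
  shows "few_low m l n s \<subseteq> few_low m l n s'"
proof
  fix \<omega> assume w: "\<omega> \<in> few_low m l n s"
  hence ws: "\<omega> \<in> space M" by (simp add: few_low_def)
  show "\<omega> \<in> few_low m l n s'"
    using poisson_paths.low_count_antimono[OF paths[OF ws] time_at_nonneg time_at_mono[OF assms], of n m m n]
      w unfolding few_low_def mem_Collect_eq by linarith
qed

lemma height_le_iff:
  assumes "1 \<le> i" "i \<le> n"
  shows "height m l n i \<omega> \<le> z \<longleftrightarrow>
    card {j\<in>{1..n}. \<lfloor>centering m n\<rfloor> + z < int (N j (hitting_time N m l n \<omega>) \<omega>)} \<le> i - 1"
proof -
  have "height m l n i \<omega> \<le> z \<longleftrightarrow> int (order_stat N n i (hitting_time N m l n \<omega>) \<omega>) \<le> \<lfloor>centering m n\<rfloor> + z"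
    unfolding height_def order_stat_hit_def by linarith
  thus ?thesis by (simp only: order_stat_le_iff[OF assms])
qed

lemma hitting_time_between:
  assumes "\<omega> \<in> few_low m l n s'" "\<omega> \<notin> few_low m l n s"
  shows "time_at m n s \<le> hitting_time N m l n \<omega>" "hitting_time N m l n \<omega> \<le> time_at m n s'"
proof -
  have ws: "\<omega> \<in> space M" using assms(1) by (simp add: few_low_def)
  interpret poisson_paths N \<omega> by (rule paths[OF ws])
  have ex: "\<exists>t\<ge>0. card {i\<in>{1..n}. \<not> m < N i t \<omega>} \<le> l"
    using assms(1) time_at_nonneg unfolding few_low_def by blast
  have "card {i\<in>{1..n}. \<not> m < N i (time_at m n s') \<omega>} \<le> l" using assms(1) unfolding few_low_def by blast
  thus "hitting_time N m l n \<omega> \<le> time_at m n s'"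
    using hitting_time_attained(2)[OF ex time_at_nonneg] by blast
  have "\<not> card {i\<in>{1..n}. \<not> m < N i (time_at m n s) \<omega>} \<le> l" using assms(2) ws unfolding few_low_def by blast
  hence "\<not> hitting_time N m l n \<omega> \<le> time_at m n s"
    using hitting_time_attained(2)[OF ex time_at_nonneg] by blast
  thus "time_at m n s \<le> hitting_time N m l n \<omega>" by simp
qed

lemma tops_le_imp_heights_le:
  assumes "K \<le> n" "\<omega> \<in> few_low m l n s'" "\<omega> \<notin> few_low m l n s" "\<omega> \<in> tops_le m K n k s'"
  shows "\<forall>i\<in>{1..K}. height m l n i \<omega> \<le> k i"
proof
  fix i assume i: "i \<in> {1..K}"
  have ws: "\<omega> \<in> space M" using assms(2) by (simp add: few_low_def)
  interpret poisson_paths N \<omega> by (rule paths[OF ws])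
  have "card {j\<in>{1..n}. \<lfloor>centering m n\<rfloor> + k i < int (N j (hitting_time N m l n \<omega>) \<omega>)}
     \<le> card {j\<in>{1..n}. \<lfloor>centering m n\<rfloor> + k i < int (N j (time_at m n s') \<omega>)}"
    by (rule high_count_mono[OF hitting_time_nonneg hitting_time_between(2)[OF assms(2,3)]])
  also have "\<dots> \<le> i - 1" using assms(4) i unfolding tops_le_def by blast
  finally show "height m l n i \<omega> \<le> k i" using i assms(1) by (subst height_le_iff) auto
qed

lemma heights_le_imp_tops_le:
  assumes "K \<le> n" "\<omega> \<in> few_low m l n s'" "\<omega> \<notin> few_low m l n s"
    "\<forall>i\<in>{1..K}. height m l n i \<omega> \<le> k i"
  shows "\<omega> \<in> tops_le m K n k s"
proof -
  have ws: "\<omega> \<in> space M" using assms(2) by (simp add: few_low_def)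
  interpret poisson_paths N \<omega> by (rule paths[OF ws])
  have "card {j\<in>{1..n}. \<lfloor>centering m n\<rfloor> + k i < int (N j (time_at m n s) \<omega>)} \<le> i - 1" if i: "i \<in> {1..K}" for i
  proof -
    have "card {j\<in>{1..n}. \<lfloor>centering m n\<rfloor> + k i < int (N j (time_at m n s) \<omega>)}
      \<le> card {j\<in>{1..n}. \<lfloor>centering m n\<rfloor> + k i < int (N j (hitting_time N m l n \<omega>) \<omega>)}"
      by (rule high_count_mono[OF time_at_nonneg hitting_time_between(1)[OF assms(2,3)]])
    also have "\<dots> \<le> i - 1"
      using assms(4)[rule_format, OF i] i assms(1) by (subst (asm) height_le_iff) auto
    finally show ?thesis .
  qed
  thus ?thesis using ws unfolding tops_le_def by blast
qed

text \<open>
  The joint limit without any constraint on the high counts.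
\<close>

lemma few_low_limit:
  "(\<lambda>n. prob (few_low m l n s)) \<longlonglongrightarrow> poisson_prob (exp (- s)) {..l}"
proof -
  \<comment> \<open>Without bins there is exactly one, empty, profile.\<close>
  have p: "profiles 0 k \<kappa> 0 = {\<lambda>_. undefined}" for k \<kappa> by (auto simp: profiles_def)
  have "(\<lambda>n. prob (few_low m l n s) - poisson_prob (exp (- s)) {..l}) \<longlonglongrightarrow> 0"
    using low_high_joint_limit[of 0 0 "\<lambda>_. 0" 0 m s l s] by (simp add: few_low_def p del: pmf_poisson)
  thus ?thesis by (rule LIM_zero_cancel)
qed

end

lemma joint_limit_product:
  fixes M :: "'a measure" and M' :: "'b measure"
  assumes "poisson_family M N" and "limit_model M' \<Xi> \<xi> \<tau> l" and K: "K \<ge> 1"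
  shows "(\<lambda>n. measure M (poisson_family.few_low M N m l n s \<inter> poisson_family.tops_le M N m K n k s') -
    measure M' (limit_model.early M' \<tau> s \<inter> limit_model.counts_le M' \<Xi> K k ((exp 1 - 1) * s' + frac (centering m n)))) \<longlonglongrightarrow> 0"
proof -
  interpret P: poisson_family M N by fact
  interpret L: limit_model M' \<Xi> \<xi> \<tau> l K by fact
  define \<kappa> where "\<kappa> = Min (k ` {1..K})"
  \<comment> \<open>One bin for each level from the lowest to the highest threshold; the last one contains everything above the highest.\<close>
  define R where "R = nat (Max (k ` {1..K}) - \<kappa>) + 1"
  have fin: "finite (k ` {1..K})" "k ` {1..K} \<noteq> {}" using K by auto
  have anchor: "\<exists>i0\<in>{1..K}. k i0 = \<kappa>" using Min_in[OF fin] unfolding \<kappa>_def by force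
  have range: "\<kappa> \<le> k i \<and> k i < \<kappa> + int R" if "i \<in> {1..K}" for i
  proof -
    have "\<kappa> \<le> k i" "k i \<le> Max (k ` {1..K})" using that fin by (auto simp: \<kappa>_def)
    thus ?thesis by (simp add: R_def)
  qed
  have early: "L.prob (L.early s) = poisson_prob (exp (- s)) {..l}"
    unfolding L.early_def by (rule gumbel_cdf[OF L.prob_space_axioms L.gumbel])
  have counts: "L.prob (L.counts_le k \<theta>) = (\<Sum>c\<in>profiles K k \<kappa> R. \<Prod>j<R. pmf (poisson_pmf (cell_rate \<kappa> R \<theta> j)) (c j))" for \<theta>
    unfolding L.counts_le_def by (rule L.counts_above_law[OF anchor range])
  have ev: "P.few_low m l n s \<inter> P.tops_le m K n k s' = {\<omega>\<in>space M. card {i\<in>{1..n}. \<not> m < N i (time_at m n s) \<omega>} \<le> l \<and>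
       (\<forall>i\<in>{1..K}. card {j\<in>{1..n}. \<lfloor>centering m n\<rfloor> + k i < int (N j (time_at m n s') \<omega>)} \<le> i - 1)}" for n
    unfolding P.few_low_def P.tops_le_def by blast
  show ?thesis
    unfolding L.early_counts_independent early counts ev
    by (rule P.low_high_joint_limit[OF anchor range])
qed

text \<open>
  The sandwich is applied on both probability spaces with the same grid in rescaled time. For a fixed grid the two
  lower bounds approach each other, and so do the two upper bounds, by \<open>joint_limit_product\<close>. On the
  limit side upper and lower bound differ by the two tails of \<open>\<tau>\<close> and by the oscillation of the
  point process probabilities over one grid step.
\<close>

theorem cdf_limit:
  fixes M :: "'a measure" and M' :: "'b measure"
  assumes P: "poisson_family M N" and L: "limit_model M' \<Xi> \<xi> \<tau> l" and K: "K \<ge> 1"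
  shows "(\<lambda>n. measure M {\<omega>\<in>space M. \<forall>i\<in>{1..K}. poisson_family.height N m l n i \<omega> \<le> k i} -
    measure M' {\<omega>\<in>space M'. \<forall>i\<in>{1..K}. limit_model.limit_height \<xi> \<tau> (frac (centering m n)) i \<omega> \<le> k i}) \<longlonglongrightarrow> 0"
proof (rule tendstoI)
  fix e :: real assume e: "e > 0"
  interpret P: poisson_family M N by fact
  interpret L: limit_model M' \<Xi> \<xi> \<tau> l K by fact
  \<comment> \<open>Three terms bound the gap of the limiting sandwich and one more bounds its distance to the sandwich at stage \<open>n\<close>.\<close>
  define e8 where "e8 = e / 8"
  have e8: "e8 > 0" using e by (simp add: e8_def)
  obtain S where S: "S > 0" "L.prob (L.early (- S)) < e8" "1 - e8 < L.prob (L.early S)"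
    unfolding L.early_def using L.real_rv_tails[OF L.\<tau>_measurable e8] by metis
  define a where "a = exp (1::real) - 1"
  have a0: "a > 0" by (simp add: a_def)
  define Q where "Q = (\<Sum>i\<in>{1..K}. exp (- real_of_int (k i)))"
  have Q0: "Q \<ge> 0" unfolding Q_def by (intro sum_nonneg) simp
  \<comment> \<open>With \<open>J\<close> grid steps on \<open>[-S, S]\<close> the point process probability changes by at most \<open>B / J\<close> per step,
    whatever the fractional part in \<open>[0, 1)\<close>.\<close>
  define B where "B = Q * exp (a * S + 1) * a * (2 * S)"
  have B0: "B \<ge> 0" unfolding B_def using Q0 a0 S(1) by simp
  obtain J :: nat where J: "B / e8 < real J" using reals_Archimedean2 by blast
  have "0 \<le> B / e8" using B0 e8 by simp
  hence J0: "J > 0" using J by (cases J) auto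
  have BJ: "B / real J \<le> e8" using J J0 e8 by (simp add: field_simps)
  define g where "g j = - S + 2 * S * real j / real J" for j
  have g_step: "g (Suc j) - g j = 2 * S / real J" for j using J0 by (simp add: g_def field_simps)
  have g_mono: "g j \<le> g (Suc j)" for j using g_step[of j] S(1) J0 by (smt (verit) divide_nonneg_nonneg of_nat_0_le_iff)
  have gJ: "g 0 = - S" "g J = S" using J0 by (simp_all add: g_def)
  have g_le: "g (Suc j) \<le> S" if "j < J" for j
  proof -
    have "2 * S * real (Suc j) \<le> 2 * S * real J" using that S(1) by (intro mult_left_mono) auto
    hence "2 * S * real (Suc j) / real J \<le> 2 * S" using J0 by (simp add: field_simps)
    thus ?thesis by (simp add: g_def)
  qed
  define c where "c n = frac (centering m n)" for n
  have c01: "0 \<le> c n" "c n < 1" for n by (simp_all add: c_def frac_lt_1)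
  define \<theta> where "\<theta> n j = a * g j + c n" for n j
  define G where "G j = L.prob (L.early (g j))" for j
  define F where "F n j = L.prob (L.counts_le k (\<theta> n j))" for n j
  define A where "A n j = P.few_low m l n (g j)" for n j
  define D where "D n j = P.tops_le m K n k (g j)" for n j
  define H where "H n = {\<omega>\<in>space M. \<forall>i\<in>{1..K}. P.height m l n i \<omega> \<le> k i}" for n
  define H' where "H' n = {\<omega>\<in>space M'. \<forall>i\<in>{1..K}. L.limit_height (c n) i \<omega> \<le> k i}" for n
  define low where "low n = (\<Sum>j<J. P.prob (A n (Suc j) \<inter> D n (Suc j)) - P.prob (A n j \<inter> D n (Suc j)))" for n
  define up where "up n = P.prob (A n 0) + (1 - P.prob (A n J)) + (\<Sum>j<J. P.prob (A n (Suc j) \<inter> D n j) - P.prob (A n j \<inter> D n j))" for n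
  define low' where "low' n = (\<Sum>j<J. G (Suc j) * F n (Suc j) - G j * F n (Suc j))" for n
  define up' where "up' n = G 0 + (1 - G J) + (\<Sum>j<J. G (Suc j) * F n j - G j * F n j)" for n
  have sandwich: "low n \<le> P.prob (H n)" "P.prob (H n) \<le> up n" if n: "K \<le> n" for n
  proof -
    have sets: "A n j \<in> sets M" "D n j \<in> sets M" "H n \<in> sets M" for j
    proof -
      show "A n j \<in> sets M" unfolding A_def by (rule P.few_low_event)
      show "D n j \<in> sets M" unfolding D_def by (rule P.tops_le_event)
      show "H n \<in> sets M" unfolding H_def by (rule int_event, rule P.height_measurable) (use n in auto)
    qed
    have mono: "A n j \<subseteq> A n (Suc j)" for j unfolding A_def by (rule P.few_low_mono[OF g_mono])
    have lo: "AE \<omega> in M. \<omega> \<in> A n (Suc j) - A n j \<longrightarrow> \<omega> \<in> D n (Suc j) \<longrightarrow> \<omega> \<in> H n" for j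
    proof (rule AE_I2, intro impI)
      fix \<omega> assume "\<omega> \<in> space M" "\<omega> \<in> A n (Suc j) - A n j" "\<omega> \<in> D n (Suc j)"
      thus "\<omega> \<in> H n" unfolding H_def A_def D_def using P.tops_le_imp_heights_le[OF n] by blast
    qed
    have hi: "AE \<omega> in M. \<omega> \<in> A n (Suc j) - A n j \<longrightarrow> \<omega> \<in> H n \<longrightarrow> \<omega> \<in> D n j" for j
    proof (rule AE_I2, intro impI)
      fix \<omega> assume "\<omega> \<in> space M" "\<omega> \<in> A n (Suc j) - A n j" "\<omega> \<in> H n"
      thus "\<omega> \<in> D n j" unfolding H_def A_def D_def using P.heights_le_imp_tops_le[OF n] by blast
    qed
    show "low n \<le> P.prob (H n)" unfolding low_def by (rule P.monotone_sandwich(1)[where A = "A n" and D = "D n", OF sets mono lo hi])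
    show "P.prob (H n) \<le> up n" unfolding up_def by (rule P.monotone_sandwich(2)[where A = "A n" and D = "D n", OF sets mono lo hi])
  qed
  have sandwich': "low' n \<le> L.prob (H' n)" "L.prob (H' n) \<le> up' n" for n
  proof -
    let ?A = "\<lambda>j. L.early (g j)" and ?D = "\<lambda>j. L.counts_le k (\<theta> n j)"
    have H'm: "H' n \<in> sets M'" unfolding H'_def by (rule L.limit_height_le_event)
    have mono: "?A j \<subseteq> ?A (Suc j)" for j unfolding L.early_def using g_mono[of j] by auto
    have iff: "AE \<omega> in M'. \<omega> \<in> H' n \<longleftrightarrow> \<omega> \<in> L.counts_le k (a * \<tau> \<omega> + c n)"
      using L.limit_height_le_iff[of "c n"] AE_space
    proof eventually_elim
      case (elim \<omega>)
      thus ?case unfolding H'_def a_def by blast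
    qed
    have lo: "AE \<omega> in M'. \<omega> \<in> ?A (Suc j) - ?A j \<longrightarrow> \<omega> \<in> ?D (Suc j) \<longrightarrow> \<omega> \<in> H' n" for j
      using iff
    proof eventually_elim
      case (elim \<omega>)
      show ?case
      proof (intro impI)
        assume w: "\<omega> \<in> ?A (Suc j) - ?A j" "\<omega> \<in> ?D (Suc j)"
        hence "\<tau> \<omega> \<le> g (Suc j)" by (simp add: L.early_def)
        hence "a * \<tau> \<omega> + c n \<le> \<theta> n (Suc j)" unfolding \<theta>_def using a0 by simp
        thus "\<omega> \<in> H' n" using L.counts_le_antimono[of "a * \<tau> \<omega> + c n" "\<theta> n (Suc j)" k] w(2) elim by blast
      qed
    qed
    have hi: "AE \<omega> in M'. \<omega> \<in> ?A (Suc j) - ?A j \<longrightarrow> \<omega> \<in> H' n \<longrightarrow> \<omega> \<in> ?D j" for j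
      using iff AE_space
    proof eventually_elim
      case (elim \<omega>)
      show ?case
      proof (intro impI)
        assume w: "\<omega> \<in> ?A (Suc j) - ?A j" "\<omega> \<in> H' n"
        hence "g j \<le> \<tau> \<omega>" using elim(2) by (auto simp: L.early_def)
        hence "\<theta> n j \<le> a * \<tau> \<omega> + c n" unfolding \<theta>_def using a0 by simp
        thus "\<omega> \<in> ?D j" using L.counts_le_antimono[of "\<theta> n j" "a * \<tau> \<omega> + c n" k] w(2) elim by blast
      qed
    qed
    note s = L.monotone_sandwich[where A = "\<lambda>j. L.early (g j)" and D = "\<lambda>j. L.counts_le k (\<theta> n j)", OF L.early_event L.counts_le_event H'm mono lo hi]
    show "low' n \<le> L.prob (H' n)"
      using s(1)[of J] unfolding low'_def G_def F_def L.early_counts_independent .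
    show "L.prob (H' n) \<le> up' n"
      using s(2)[of J] unfolding up'_def G_def F_def L.early_counts_independent .
  qed
  have Phi: "(\<lambda>n. P.prob (A n i \<inter> D n j) - G i * F n j) \<longlonglongrightarrow> 0" for i j
    using joint_limit_product[OF P L K, of m "g i" k "g j"]
    unfolding A_def D_def G_def F_def \<theta>_def c_def a_def L.early_counts_independent .
  have Alim: "(\<lambda>n. P.prob (A n j) - G j) \<longlonglongrightarrow> 0" for j
  proof -
    have "G j = poisson_prob (exp (- g j)) {..l}"
      unfolding G_def L.early_def by (rule gumbel_cdf[OF L.prob_space_axioms L.gumbel])
    thus ?thesis unfolding A_def using P.few_low_limit[of m l "g j"] by (simp only: LIM_zero)
  qed
  have low_lim: "(\<lambda>n. low n - low' n) \<longlonglongrightarrow> 0"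
  proof -
    have "(\<lambda>n. \<Sum>j<J. (P.prob (A n (Suc j) \<inter> D n (Suc j)) - G (Suc j) * F n (Suc j)) - (P.prob (A n j \<inter> D n (Suc j)) - G j * F n (Suc j)))
       \<longlonglongrightarrow> (\<Sum>j<J. 0 - 0)" by (intro tendsto_sum tendsto_diff Phi)
    moreover have "low n - low' n = (\<Sum>j<J. (P.prob (A n (Suc j) \<inter> D n (Suc j)) - G (Suc j) * F n (Suc j)) - (P.prob (A n j \<inter> D n (Suc j)) - G j * F n (Suc j)))" for n
      unfolding low_def low'_def by (simp add: sum_subtractf)
    ultimately show ?thesis by simp
  qed
  have up_lim: "(\<lambda>n. up n - up' n) \<longlonglongrightarrow> 0"
  proof -
    have "(\<lambda>n. (P.prob (A n 0) - G 0) - (P.prob (A n J) - G J) + (\<Sum>j<J. (P.prob (A n (Suc j) \<inter> D n j) - G (Suc j) * F n j) - (P.prob (A n j \<inter> D n j) - G j * F n j)))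
       \<longlonglongrightarrow> 0 - 0 + (\<Sum>j<J. 0 - 0)" by (intro tendsto_add tendsto_sum tendsto_diff Phi Alim)
    moreover have "up n - up' n = (P.prob (A n 0) - G 0) - (P.prob (A n J) - G J) + (\<Sum>j<J. (P.prob (A n (Suc j) \<inter> D n j) - G (Suc j) * F n j) - (P.prob (A n j \<inter> D n j) - G j * F n j))" for n
      unfolding up_def up'_def by (simp add: sum_subtractf)
    ultimately show ?thesis by simp
  qed
  have F_step: "F n j - F n (Suc j) \<le> e8" if j: "j < J" for n j
  proof -
    have le: "\<theta> n j \<le> \<theta> n (Suc j)" unfolding \<theta>_def using a0 g_mono[of j] by simp
    have "F n j - F n (Suc j) \<le> Q * (exp (\<theta> n (Suc j)) - exp (\<theta> n j))"
      unfolding F_def Q_def by (rule L.counts_le_continuous[OF le])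
    also have "\<dots> \<le> Q * (exp (a * S + 1) * (a * (2 * S / real J)))"
    proof (rule mult_left_mono[OF _ Q0])
      have "exp (\<theta> n (Suc j)) - exp (\<theta> n j) \<le> exp (\<theta> n (Suc j)) * (\<theta> n (Suc j) - \<theta> n j)" by (rule exp_diff_le)
      also have "\<theta> n (Suc j) - \<theta> n j = a * (2 * S / real J)" unfolding \<theta>_def g_step[symmetric, of j] by (simp add: algebra_simps)
      also have "exp (\<theta> n (Suc j)) * (a * (2 * S / real J)) \<le> exp (a * S + 1) * (a * (2 * S / real J))"
      proof (rule mult_right_mono)
        have "a * g (Suc j) \<le> a * S" using g_le[OF j] a0 by simp
        thus "exp (\<theta> n (Suc j)) \<le> exp (a * S + 1)" unfolding \<theta>_def using c01[of n] by simp
        show "0 \<le> a * (2 * S / real J)" using a0 S(1) by simp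
      qed
      finally show "exp (\<theta> n (Suc j)) - exp (\<theta> n j) \<le> exp (a * S + 1) * (a * (2 * S / real J))" .
    qed
    also have "\<dots> = B / real J" by (simp add: B_def)
    finally show ?thesis using BJ by linarith
  qed
  have gap: "up' n - low' n \<le> 3 * e8" for n
  proof -
    have Gm: "0 \<le> G (Suc j) - G j" for j
    proof -
      have "L.early (g j) \<subseteq> L.early (g (Suc j))" unfolding L.early_def using g_mono[of j] by auto
      from L.finite_measure_mono[OF this L.early_event] show ?thesis by (simp add: G_def)
    qed
    have "up' n - low' n = G 0 + (1 - G J) + (\<Sum>j<J. (G (Suc j) - G j) * (F n j - F n (Suc j)))"
      unfolding up'_def low'_def by (simp add: sum_subtractf algebra_simps sum.distrib)
    also have "(\<Sum>j<J. (G (Suc j) - G j) * (F n j - F n (Suc j))) \<le> (\<Sum>j<J. (G (Suc j) - G j) * e8)"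
      by (intro sum_mono mult_left_mono F_step Gm) auto
    also have "\<dots> = (G J - G 0) * e8"
      unfolding sum_distrib_right[symmetric] sum_lessThan_telescope ..
    also have "\<dots> \<le> 1 * e8"
      using e8 unfolding G_def by (intro mult_right_mono) (auto intro: order.trans[OF _ L.prob_le_1] simp: diff_le_eq add_increasing2)
    finally show ?thesis using S(2,3) unfolding G_def gJ by linarith
  qed
  have "\<forall>\<^sub>F n in sequentially. \<bar>low n - low' n\<bar> < e8" using tendstoD[OF low_lim e8] by simp
  moreover have "\<forall>\<^sub>F n in sequentially. \<bar>up n - up' n\<bar> < e8" using tendstoD[OF up_lim e8] by simp
  ultimately have "\<forall>\<^sub>F n in sequentially. \<bar>P.prob (H n) - L.prob (H' n)\<bar> < e"
    using eventually_ge_at_top[of K]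
  proof eventually_elim
    case (elim n)
    have "e = 8 * e8" by (simp add: e8_def)
    thus ?case using elim(1,2) sandwich[OF elim(3)] sandwich'[of n] gap[of n] e8 by linarith
  qed
  thus "\<forall>\<^sub>F n in sequentially. dist (P.prob {\<omega>\<in>space M. \<forall>i\<in>{1..K}. P.height m l n i \<omega> \<le> k i} -
    L.prob {\<omega>\<in>space M'. \<forall>i\<in>{1..K}. L.limit_height (frac (centering m n)) i \<omega> \<le> k i}) 0 < e"
    unfolding H_def H'_def c_def by simp
qed

theorem theorem5p6:
  fixes M :: "'a measure" and M' :: "'b measure"
    and N :: "nat \<Rightarrow> real \<Rightarrow> 'a \<Rightarrow> nat"
    and \<Xi> :: "'b \<Rightarrow> real measure" and \<xi> :: "nat \<Rightarrow> 'b \<Rightarrow> real" and \<tau> :: "'b \<Rightarrow> real"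
    and m l K :: nat
  assumes "prob_space M" and "iid_unit_poisson_processes M N"
    and "prob_space M'"
    and "poisson_point_process M' exp_intensity \<Xi>"
    and "\<And>i. i \<ge> 1 \<Longrightarrow> \<xi> i \<in> borel_measurable M'"
    and "AE \<omega> in M'. decreasing_atoms (\<Xi> \<omega>) (\<lambda>i. \<xi> i \<omega>)"
    and "distributed M' lborel \<tau> (\<lambda>s. ennreal (gumbel_density (l + 1) s))"
    and "indep_of_point_process M' \<tau> \<Xi>"
    and "K \<ge> 1"
  shows "(\<lambda>n. tv_dist
            (int_vector_law M K
              (\<lambda>i \<omega>. int (order_stat_hit N m l n i \<omega>) - \<lfloor>centering m n\<rfloor>))
            (int_vector_law M' K
              (\<lambda>i \<omega>. \<lceil>\<xi> i \<omega> + (exp 1 - 1) * \<tau> \<omega> + frac (centering m n)\<rceil>)))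
         \<longlonglongrightarrow> 0"
proof -
  have P: "poisson_family M N"
    using assms(1,2) by (simp add: poisson_family_def poisson_family_axioms_def)
  have L: "limit_model M' \<Xi> \<xi> \<tau> l"
    by (intro limit_model.intro exp_ppp.intro exp_ppp_axioms.intro limit_model_axioms.intro assms)
  interpret P: poisson_family M N by (rule P)
  interpret L: limit_model M' \<Xi> \<xi> \<tau> l K by (rule L)
  let ?X = "\<lambda>n. P.height m l n" and ?Y = "\<lambda>n. L.limit_height (frac (centering m n))"
  \<comment> \<open>The \<open>K\<close> largest values exist, and are measurable, only if there are at least \<open>K\<close> processes.\<close>
  have "(\<lambda>n. tv_dist (int_vector_law M K (?X (n + K))) (int_vector_law M' K (?Y (n + K)))) \<longlonglongrightarrow> 0"
  proof (rule tv_limit_from_cdf_limit[OF assms(1,3)])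
    show "?X (n + K) i \<in> measurable M (count_space UNIV)" if "i \<in> {1..K}" for n i
      using that by (intro P.height_measurable) auto
    show "?Y (n + K) i \<in> measurable M' (count_space UNIV)" if "i \<in> {1..K}" for n i
      using that by (intro L.limit_height_measurable) auto
    show "(\<lambda>n. measure M {\<omega>\<in>space M. \<forall>i\<in>{1..K}. ?X (n + K) i \<omega> \<le> v i} -
      measure M' {\<omega>\<in>space M'. \<forall>i\<in>{1..K}. ?Y (n + K) i \<omega> \<le> v i}) \<longlonglongrightarrow> 0" for v
      by (rule LIMSEQ_ignore_initial_segment[OF cdf_limit[OF P L assms(9)]])
    fix e :: real assume "e > 0"
    then obtain R where R: "\<And>c. c \<in> {0..1} \<Longrightarrow> L.prob {\<omega>\<in>space M'. \<not> (\<forall>i\<in>{1..K}. L.limit_height c i \<omega> \<in> {-R..R})} \<le> e"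
      using L.limit_heights_tight by blast
    have "frac (centering m (n + K)) \<in> {0..1}" for n
      using frac_lt_1[of "centering m (n + K)"] by simp
    thus "\<exists>R. \<forall>n. measure M' {\<omega>\<in>space M'. \<not> (\<forall>i\<in>{1..K}. ?Y (n + K) i \<omega> \<in> {-R..R})} \<le> e"
      using R by blast
  qed
  hence "(\<lambda>n. tv_dist (int_vector_law M K (?X n)) (int_vector_law M' K (?Y n))) \<longlonglongrightarrow> 0"
    by (rule LIMSEQ_offset)
  thus ?thesis unfolding P.height_def[abs_def] L.limit_height_def[abs_def] .
qed

end
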